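(* Let $q\in(0,1)$ and let $z$ be a non-zero $q$-normal operator with $X:=\mathrm{spec}(|z|)\neq[0,\infty)$ and $1\notin X$. For $n\in\mathbb{N}$, let $P_{\pm n}$ denote the Bott projections and $R_n$ the Powers--Rieffel type projection defined in the context. Then the following equalities hold in $K_0(C_0^*(z,z^* )\dotplus\mathbb{C})$: $$[P_n]=[1]+[R_n]=[1]+n[\chi_{(q,1)}]=\left[\begin{pmatrix}1&0\\0&\chi_{(q^n,1)}\end{pmatrix}\right],$$ $$[P_{-n}]=[1]-[R_n]=[1]-n[\chi_{(q,1)}]=[1-\chi_{(q^n,1)}].$$
   Context: **Algebra.** Fix $q\in(0,1)$. A $q$-normal operator is a densely defined closed linear operator $z$ on a Hilbert space such that $zz^*=q^2z^*z$ on $\mathrm{dom}(z^*z)=\mathrm{dom}(zz^* )$; put $|z|=\sqrt{z^*z}$. For a non-zero $q$-normal operator, $X=\mathrm{spec}(|z|)\subset[0,\infty)$ is closed, contains $0$, and satisfies $qX=X$. Put $\alpha_q(f)(x):=f(qx)$. The crossed product $C_0(X)\rtimes\mathbb{Z}$ is the enveloping C*-algebra of the *-algebra of finite sums $\sum_kf_kU^k$, $f_k\in C_0(X)$, where $U$ is a unitary with $UfU^*=\alpha_q(f)$. Define $$C_0^*(z,z^* ):=\text{norm closure of }\Big\{\sum_{\text{finite}}f_kU^k\in C_0(X)\rtimes\mathbb{Z}: f_k(0)=0\text{ if }k\neq0\Big\}.$$ With $X\cup\{\infty\}$ the one-point compactification ($\alpha_q$ fixing the point $\infty$), its unitization $C_0^*(z,z^*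 )\dotplus\mathbb{C}$ is the norm closure of the finite sums $\sum f_kU^k\in C(X\cup\{\infty\})\rtimes\mathbb{Z}$ with $f_k(0)=f_k(\infty)=0$ for $k\neq0$. **Indicator projections.** $\chi_A$ denotes the indicator function of $A\subset\mathbb{R}$. Since $1\notin X$ and $qX=X$, no power $q^k$ ($k\in\mathbb{Z}$) lies in $X$, so $\chi_{(q^n,1)}$ restricted to $X$ is a continuous projection in $C_0(X)\subset C_0^*(z,z^* )\dotplus\mathbb{C}$ for $n\in\mathbb{N}$. **Bott projections.** For $n\in\mathbb{N}=\{1,2,\dots\}$, with rational functions of $|z|$ identified with continuous functions on $X\cup\{\infty\}$, let $$P_n=\begin{pmatrix}\frac{q^{-n(n-1)}|z|^{2n}}{1+q^{-n(n-1)}|z|^{2n}}&\frac{q^{-\frac n2(n-1)}|z|^n}{1+q^{-n(n-1)}|z|^{2n}}U^{*n}\\[6pt]\frac{q^{\frac n2(n+1)}|z|^n}{1+q^{n(n+1)}|z|^{2n}}U^n&\frac{1}{1+q^{n(n+1)}|z|^{2n}}\end{pmatrix},\qquad P_{-n}=\begin{pmatrix}\frac{q^{n(n+1)}|z|^{2n}}{1+q^{n(n+1)}|z|^{2n}}&\frac{q^{\frac n2(n+1)}|z|^n}{1+q^{n(n+1)}|z|^{2n}}U^n\\[6pt]\frac{q^{-\frac n2(n-1)}|z|^n}{1+q^{-n(n-1)}|z|^{2n}}U^{*n}&\frac{1}{1+q^{-n(n-1)}|z|^{2n}}\end{pmatrix}.$$ These are self-adjoint projections in $\mathrm{Mat}_2(C_0^*(z,z^*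 )\dotplus\mathbb{C})$. **Powers--Rieffel type projections.** Choose a continuous $\phi:[q,1]\to\mathbb{R}$ with $0\le\phi\le1$, $\phi(q)=0$, $\phi(1)=1$. Let $h(t)=\sqrt{\phi(t)(1-\phi(t))}$ for $t\in[q,1]$ and $h(t)=0$ otherwise. For $n\in\mathbb{N}$ let $f_n(t)=\phi(t)$ for $t\in[q,1]$, $f_n(t)=1$ for $t\in(1,q^{-n+1})$, $f_n(t)=1-\phi(q^nt)$ for $t\in[q^{-n+1},q^{-n}]$, and $f_n(t)=0$ for $t\notin[q,q^{-n}]$. Then $R_n:=U^nh+f_n+hU^{*n}\in C_0^*(z,z^* )$ is a self-adjoint projection. *)

theory Defs
  imports
    "HOL-Analysis.Analysis"
    "HOL-Algebra.Group"
    "Jordan_Normal_Form.Matrix"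
begin

class complex_banach = banach +
  fixes scaleC :: "complex \<Rightarrow> 'a \<Rightarrow> 'a"
  assumes scaleC_add_right: "scaleC c (x + y) = scaleC c x + scaleC c y"
    and scaleC_add_left: "scaleC (c + d) x = scaleC c x + scaleC d x"
    and scaleC_scaleC: "scaleC c (scaleC d x) = scaleC (c * d) x"
    and scaleC_of_real: "scaleC (complex_of_real r) x = scaleR r x"
    and norm_scaleC: "norm (scaleC c x) = cmod c * norm x"

text \<open>The inner product is linear in the second argument, hence antilinear in the first.
  Symmetry and the last axiom make it positive definite.\<close>

class complex_hilbert = complex_banach +
  fixes cinner :: "'a \<Rightarrow> 'a \<Rightarrow> complex"
  assumes cinner_commute: "cinner x y = cnj (cinner y x)"
    and cinner_add_right: "cinner x (y + y') = cinner x y + cinner x y'"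
    and cinner_scaleC_right: "cinner x (scaleC c y) = c * cinner x y"
    and cinner_self: "cinner x x = complex_of_real ((norm x)\<^sup>2)"

class cstar_algebra_1 = complex_banach + real_normed_algebra_1 +
  fixes star :: "'a \<Rightarrow> 'a"
  assumes scaleC_mult_left: "scaleC c x * y = scaleC c (x * y)"
    and scaleC_mult_right: "x * scaleC c y = scaleC c (x * y)"
    and star_star: "star (star x) = x"
    and star_add: "star (x + y) = star x + star y"
    and star_scaleC: "star (scaleC c x) = scaleC (cnj c) (star x)"
    and star_mult: "star (x * y) = star y * star x"
    and cstar_identity: "norm (star x * x) = (norm x)\<^sup>2"


text \<open>Unbounded operators on a Hilbert space, represented by their graphs. As relations compose
  from left to right, \<open>S O T\<close> is the operator product \<open>T S\<close> on its natural domain.\<close>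

type_synonym 'h operator = "('h \<times> 'h) set"

definition linear_operator :: "'h::complex_hilbert operator \<Rightarrow> bool" where
  "linear_operator T \<longleftrightarrow> single_valued T \<and> (0, 0) \<in> T \<and>
     (\<forall>x y x' y'. (x, y) \<in> T \<longrightarrow> (x', y') \<in> T \<longrightarrow> (x + x', y + y') \<in> T) \<and>
     (\<forall>c x y. (x, y) \<in> T \<longrightarrow> (scaleC c x, scaleC c y) \<in> T)"

definition densely_defined :: "'h::complex_hilbert operator \<Rightarrow> bool" where
  "densely_defined T \<longleftrightarrow> closure (Domain T) = UNIV"

definition adjoint_op :: "'h::complex_hilbert operator \<Rightarrow> 'h operator" where
  "adjoint_op T = {(x, y). \<forall>(u, v)\<in>T. cinner v x = cinner u y}"

definition scale_op :: "complex \<Rightarrow> 'h::complex_hilbert operator \<Rightarrow> 'h operator" where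
  "scale_op c T = {(x, scaleC c y) | x y. (x, y) \<in> T}"

text \<open>Equality of graphs includes the equality of the domains of \<open>z z\<^sup>*\<close> and \<open>z\<^sup>* z\<close>.\<close>

definition q_normal :: "real \<Rightarrow> 'h::complex_hilbert operator \<Rightarrow> bool" where
  "q_normal q z \<longleftrightarrow> linear_operator z \<and> densely_defined z \<and> closed z \<and>
     adjoint_op z O z = scale_op (complex_of_real (q\<^sup>2)) (z O adjoint_op z)"

definition nonzero_op :: "'h::complex_hilbert operator \<Rightarrow> bool" where
  "nonzero_op T \<longleftrightarrow> (\<exists>(x, y)\<in>T. y \<noteq> 0)"

definition positive_selfadjoint :: "'h::complex_hilbert operator \<Rightarrow> bool" where
  "positive_selfadjoint T \<longleftrightarrow> linear_operator T \<and> densely_defined T \<and> adjoint_op T = T \<and>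
     (\<forall>(x, y)\<in>T. 0 \<le> Re (cinner x y))"

text \<open>\<open>modulus_of z T\<close> says that \<open>T = |z|\<close>, that is, that \<open>T\<close> is the positive self-adjoint square
  root of \<open>z\<^sup>* z\<close>. For closed densely defined \<open>z\<close> there is exactly one such \<open>T\<close>.\<close>

definition modulus_of :: "'h::complex_hilbert operator \<Rightarrow> 'h operator \<Rightarrow> bool" where
  "modulus_of z T \<longleftrightarrow> positive_selfadjoint T \<and> T O T = z O adjoint_op z"

definition shift_op :: "'h::complex_hilbert operator \<Rightarrow> complex \<Rightarrow> 'h operator" where
  "shift_op T c = {(x, y - scaleC c x) | x y. (x, y) \<in> T}"

definition op_spectrum :: "'h::complex_hilbert operator \<Rightarrow> complex set" where
  "op_spectrum T = - {c. (\<forall>y. \<exists>!x. (x, y) \<in> shift_op T c) \<and>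
                         (\<exists>C. \<forall>(x, y)\<in>shift_op T c. norm x \<le> C * norm y)}"


text \<open>The *-algebra of finite sums \<open>\<Sum>\<^sub>k f\<^sub>k U\<^sup>k\<close> with \<open>f\<^sub>k \<in> C(K)\<close>, written as the function
  \<open>k \<mapsto> f\<^sub>k\<close>. The family \<open>\<theta>\<close> of maps \<open>K \<rightarrow> K\<close> is an action of the integers, and
  \<open>U\<^sup>k f U\<^sup>-\<^sup>k = f \<circ> \<theta> k\<close>. So that elements of \<open>C(K)\<close> are determined by their values on \<open>K\<close>,
  they are taken to be \<open>0\<close> outside \<open>K\<close>.\<close>

type_synonym 'x laurent = "int \<Rightarrow> 'x \<Rightarrow> complex"

definition cont_fun :: "'x topology \<Rightarrow> ('x \<Rightarrow> complex) set" where
  "cont_fun K = {f. continuous_map K euclidean f \<and> (\<forall>x. x \<notin> topspace K \<longrightarrow> f x = 0)}"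

definition lau_alg :: "'x topology \<Rightarrow> 'x laurent set" where
  "lau_alg K = {a. finite {k. a k \<noteq> (\<lambda>x. 0)} \<and> (\<forall>k. a k \<in> cont_fun K)}"

definition lau_monom :: "int \<Rightarrow> ('x \<Rightarrow> complex) \<Rightarrow> 'x laurent" where
  "lau_monom k f = (\<lambda>m x. if m = k then f x else 0)"

definition lau_one :: "'x topology \<Rightarrow> 'x laurent" where
  "lau_one K = lau_monom 0 (indicator (topspace K))"

definition lau_add :: "'x laurent \<Rightarrow> 'x laurent \<Rightarrow> 'x laurent" where
  "lau_add a b = (\<lambda>m x. a m x + b m x)"

definition lau_scale :: "complex \<Rightarrow> 'x laurent \<Rightarrow> 'x laurent" where
  "lau_scale c a = (\<lambda>m x. c * a m x)"

text \<open>\<open>(f U\<^sup>k) (g U\<^sup>l) = f (g \<circ> \<theta> k) U\<^sup>k\<^sup>+\<^sup>l\<close> and \<open>(f U\<^sup>-\<^sup>k)\<^sup>* = (cnj f \<circ> \<theta> k) U\<^sup>k\<close>\<close>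

definition lau_mult :: "(int \<Rightarrow> 'x \<Rightarrow> 'x) \<Rightarrow> 'x laurent \<Rightarrow> 'x laurent \<Rightarrow> 'x laurent" where
  "lau_mult \<theta> a b = (\<lambda>m x. \<Sum>k\<in>{k. a k \<noteq> (\<lambda>x. 0)}. a k x * b (m - k) (\<theta> k x))"

definition lau_star :: "(int \<Rightarrow> 'x \<Rightarrow> 'x) \<Rightarrow> 'x laurent \<Rightarrow> 'x laurent" where
  "lau_star \<theta> a = (\<lambda>m x. cnj (a (- m) (\<theta> m x)))"


text \<open>The enveloping C*-algebra is the completion in the largest C*-seminorm (after dividing out
  the elements of seminorm zero; the supremum below is finite since every C*-seminorm is bounded by
  \<open>\<Sum>\<^sub>k \<parallel>f\<^sub>k\<parallel>\<^sub>\<infinity>\<close>). \<open>enveloping_map K \<theta> \<iota>\<close> says that \<open>\<iota>\<close> is the canonical *-homomorphism into the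
  enveloping C*-algebra, which is realised as the closed subalgebra
  \<open>closure (\<iota> ` lau_alg K)\<close> of the type \<open>'a\<close>.\<close>

definition cstar_seminorm ::
    "'x topology \<Rightarrow> (int \<Rightarrow> 'x \<Rightarrow> 'x) \<Rightarrow> ('x laurent \<Rightarrow> real) \<Rightarrow> bool" where
  "cstar_seminorm K \<theta> p \<longleftrightarrow>
     (\<forall>a\<in>lau_alg K. 0 \<le> p a) \<and>
     (\<forall>a\<in>lau_alg K. \<forall>b\<in>lau_alg K. p (lau_add a b) \<le> p a + p b) \<and>
     (\<forall>c. \<forall>a\<in>lau_alg K. p (lau_scale c a) = cmod c * p a) \<and>
     (\<forall>a\<in>lau_alg K. \<forall>b\<in>lau_alg K. p (lau_mult \<theta> a b) \<le> p a * p b) \<and>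
     (\<forall>a\<in>lau_alg K. p (lau_mult \<theta> (lau_star \<theta> a) a) = (p a)\<^sup>2)"

definition enveloping_norm :: "'x topology \<Rightarrow> (int \<Rightarrow> 'x \<Rightarrow> 'x) \<Rightarrow> 'x laurent \<Rightarrow> real" where
  "enveloping_norm K \<theta> a = (SUP p\<in>{p. cstar_seminorm K \<theta> p}. p a)"

definition enveloping_map ::
    "'x topology \<Rightarrow> (int \<Rightarrow> 'x \<Rightarrow> 'x) \<Rightarrow> ('x laurent \<Rightarrow> 'a::cstar_algebra_1) \<Rightarrow> bool" where
  "enveloping_map K \<theta> \<iota> \<longleftrightarrow>
     \<iota> (lau_one K) = 1 \<and>
     (\<forall>a\<in>lau_alg K. \<forall>b\<in>lau_alg K. \<iota> (lau_add a b) = \<iota> a + \<iota> b) \<and>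
     (\<forall>c. \<forall>a\<in>lau_alg K. \<iota> (lau_scale c a) = scaleC c (\<iota> a)) \<and>
     (\<forall>a\<in>lau_alg K. \<forall>b\<in>lau_alg K. \<iota> (lau_mult \<theta> a b) = \<iota> a * \<iota> b) \<and>
     (\<forall>a\<in>lau_alg K. \<iota> (lau_star \<theta> a) = star (\<iota> a)) \<and>
     (\<forall>a\<in>lau_alg K. norm (\<iota> a) = enveloping_norm K \<theta> a)"


text \<open>\<open>X \<union> {\<infinity>}\<close>, with \<open>None\<close> as the point at infinity, and the action generated by
  \<open>\<alpha>\<^sub>q f x = f (q x)\<close>\<close>

definition Xinf :: "real set \<Rightarrow> real option topology" where
  "Xinf X = Alexandroff_compactification (top_of_set X)"

definition dilation :: "real \<Rightarrow> int \<Rightarrow> real option \<Rightarrow> real option" where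
  "dilation q k = map_option (\<lambda>t. q powi k * t)"

definition unitized_alg :: "real set \<Rightarrow> (real option laurent \<Rightarrow> 'a::cstar_algebra_1) \<Rightarrow> 'a set" where
  "unitized_alg X \<iota> =
     closure (\<iota> ` {a \<in> lau_alg (Xinf X). \<forall>k. k \<noteq> 0 \<longrightarrow> a k (Some 0) = 0 \<and> a k None = 0})"

text \<open>The element \<open>f(|z|)\<close>, where \<open>c\<close> is the value of \<open>f\<close> at infinity\<close>

definition fn_elt ::
    "real set \<Rightarrow> (real option laurent \<Rightarrow> 'a) \<Rightarrow> real \<Rightarrow> (real \<Rightarrow> real) \<Rightarrow> 'a" where
  "fn_elt X \<iota> c f = \<iota> (lau_monom 0 (\<lambda>x. case x of None \<Rightarrow> complex_of_real c
     | Some t \<Rightarrow> if t \<in> X then complex_of_real (f t) else 0))"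

definition U_elt :: "real set \<Rightarrow> (real option laurent \<Rightarrow> 'a) \<Rightarrow> 'a" where
  "U_elt X \<iota> = \<iota> (lau_monom 1 (indicator (topspace (Xinf X))))"

definition chi_elt ::
    "real set \<Rightarrow> (real option laurent \<Rightarrow> 'a) \<Rightarrow> real \<Rightarrow> real \<Rightarrow> 'a" where
  "chi_elt X \<iota> a b = fn_elt X \<iota> 0 (indicator {a<..<b})"


definition bott_pos :: "real \<Rightarrow> real set \<Rightarrow> (real option laurent \<Rightarrow> 'a::cstar_algebra_1) \<Rightarrow> nat \<Rightarrow> 'a mat" where
  "bott_pos q X \<iota> n = (let
     a = (\<lambda>t. q powr (- real n * (real n - 1)) * t ^ (2 * n));
     a' = (\<lambda>t. q powr (- (real n / 2) * (real n - 1)) * t ^ n);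
     b = (\<lambda>t. q powr (real n * (real n + 1)) * t ^ (2 * n));
     b' = (\<lambda>t. q powr (real n / 2 * (real n + 1)) * t ^ n);
     U = U_elt X \<iota>
   in mat_of_rows_list 2
     [[fn_elt X \<iota> 1 (\<lambda>t. a t / (1 + a t)), fn_elt X \<iota> 0 (\<lambda>t. a' t / (1 + a t)) * star U ^ n],
      [fn_elt X \<iota> 0 (\<lambda>t. b' t / (1 + b t)) * U ^ n, fn_elt X \<iota> 0 (\<lambda>t. 1 / (1 + b t))]])"

definition bott_neg :: "real \<Rightarrow> real set \<Rightarrow> (real option laurent \<Rightarrow> 'a::cstar_algebra_1) \<Rightarrow> nat \<Rightarrow> 'a mat" where
  "bott_neg q X \<iota> n = (let
     a = (\<lambda>t. q powr (- real n * (real n - 1)) * t ^ (2 * n));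
     a' = (\<lambda>t. q powr (- (real n / 2) * (real n - 1)) * t ^ n);
     b = (\<lambda>t. q powr (real n * (real n + 1)) * t ^ (2 * n));
     b' = (\<lambda>t. q powr (real n / 2 * (real n + 1)) * t ^ n);
     U = U_elt X \<iota>
   in mat_of_rows_list 2
     [[fn_elt X \<iota> 1 (\<lambda>t. b t / (1 + b t)), fn_elt X \<iota> 0 (\<lambda>t. b' t / (1 + b t)) * U ^ n],
      [fn_elt X \<iota> 0 (\<lambda>t. a' t / (1 + a t)) * star U ^ n, fn_elt X \<iota> 0 (\<lambda>t. 1 / (1 + a t))]])"

definition pr_h :: "real \<Rightarrow> (real \<Rightarrow> real) \<Rightarrow> real \<Rightarrow> real" where
  "pr_h q \<phi> t = (if t \<in> {q..1} then sqrt (\<phi> t * (1 - \<phi> t)) else 0)"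

definition pr_f :: "real \<Rightarrow> (real \<Rightarrow> real) \<Rightarrow> nat \<Rightarrow> real \<Rightarrow> real" where
  "pr_f q \<phi> n t =
     (if t \<in> {q..1} then \<phi> t
      else if t \<in> {1<..<q powi (- int n + 1)} then 1
      else if t \<in> {q powi (- int n + 1)..q powi (- int n)} then 1 - \<phi> (q ^ n * t)
      else 0)"

definition powers_rieffel ::
    "real \<Rightarrow> real set \<Rightarrow> (real option laurent \<Rightarrow> 'a::cstar_algebra_1) \<Rightarrow> (real \<Rightarrow> real) \<Rightarrow> nat \<Rightarrow> 'a" where
  "powers_rieffel q X \<iota> \<phi> n = (let U = U_elt X \<iota>; h = fn_elt X \<iota> 0 (pr_h q \<phi>) in
     U ^ n * h + fn_elt X \<iota> 0 (pr_f q \<phi> n) + h * star U ^ n)"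


text \<open>\<open>K\<^sub>0\<close> of a unital C*-subalgebra \<open>B\<close> of the type \<open>'a\<close>: the Grothendieck group of the monoid of
  Murray-von Neumann classes of projections in matrices of any size over \<open>B\<close>. The partial
  isometries may be rectangular. All monoids are written with the multiplicative record fields, so
  that \<open>mult\<close>, \<open>[^]\<close> and \<open>inv\<close> are addition, integer multiples and negation.\<close>

definition star_mat :: "'a::cstar_algebra_1 mat \<Rightarrow> 'a mat" where
  "star_mat A = map_mat star (transpose_mat A)"

definition mat_projections :: "'a::cstar_algebra_1 set \<Rightarrow> 'a mat set" where
  "mat_projections B =
     {p. dim_row p = dim_col p \<and> elements_mat p \<subseteq> B \<and> star_mat p = p \<and> p * p = p}"

definition mvn_rel :: "'a::cstar_algebra_1 set \<Rightarrow> 'a mat rel" where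
  "mvn_rel B = {(p, p'). p \<in> mat_projections B \<and> p' \<in> mat_projections B \<and>
     (\<exists>v\<in>carrier_mat (dim_row p') (dim_row p).
        elements_mat v \<subseteq> B \<and> star_mat v * v = p \<and> v * star_mat v = p')}"

definition direct_sum :: "'a::zero mat \<Rightarrow> 'a mat \<Rightarrow> 'a mat" where
  "direct_sum p p' =
     four_block_mat p (0\<^sub>m (dim_row p) (dim_col p')) (0\<^sub>m (dim_row p') (dim_col p)) p'"

definition V_monoid :: "'a::cstar_algebra_1 set \<Rightarrow> 'a mat set monoid" where
  "V_monoid B = \<lparr>carrier = mat_projections B // mvn_rel B,
     mult = (\<lambda>P P'. \<Union>p\<in>P. \<Union>p'\<in>P'. mvn_rel B `` {direct_sum p p'}),
     one = mvn_rel B `` {0\<^sub>m 0 0}\<rparr>"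

definition groth_rel :: "'b monoid \<Rightarrow> ('b \<times> 'b) rel" where
  "groth_rel M = {((x, y), (x', y')). x \<in> carrier M \<and> y \<in> carrier M \<and> x' \<in> carrier M \<and> y' \<in> carrier M \<and>
     (\<exists>e\<in>carrier M. x \<otimes>\<^bsub>M\<^esub> y' \<otimes>\<^bsub>M\<^esub> e = x' \<otimes>\<^bsub>M\<^esub> y \<otimes>\<^bsub>M\<^esub> e)}"

definition grothendieck_group :: "'b monoid \<Rightarrow> ('b \<times> 'b) set monoid" where
  "grothendieck_group M = \<lparr>carrier = (carrier M \<times> carrier M) // groth_rel M,
     mult = (\<lambda>u w. \<Union>(x, y)\<in>u. \<Union>(x', y')\<in>w. groth_rel M `` {(x \<otimes>\<^bsub>M\<^esub> x', y \<otimes>\<^bsub>M\<^esub> y')}),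
     one = groth_rel M `` {(\<one>\<^bsub>M\<^esub>, \<one>\<^bsub>M\<^esub>)}\<rparr>"

definition K0_group :: "'a::cstar_algebra_1 set \<Rightarrow> ('a mat set \<times> 'a mat set) set monoid" where
  "K0_group B = grothendieck_group (V_monoid B)"

definition K0_class :: "'a::cstar_algebra_1 set \<Rightarrow> 'a mat \<Rightarrow> ('a mat set \<times> 'a mat set) set" where
  "K0_class B p = groth_rel (V_monoid B) `` {(mvn_rel B `` {p}, \<one>\<^bsub>V_monoid B\<^esub>)}"

abbreviation mat1 :: "'a \<Rightarrow> 'a mat" where
  "mat1 a \<equiv> mat_of_rows_list 1 [[a]]"

end

theory Submission
  imports Defs "HOL-Real_Asymp.Real_Asymp"
begin

text \<open>All the equivalences are implemented by explicit finite sums. With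
  \<open>a = q\<^bsup>-n(n-1)\<^esup>|z|\<^bsup>2n\<^esup>\<close>, \<open>F = \<surd>(a / (1 + a))\<close> and \<open>G = \<surd>(1 / (1 + a))\<close>, the Bott projection \<open>P\<^sub>n\<close>
  is \<open>v v\<^sup>*\<close> for the isometric column \<open>v = (F, U\<^sup>n G)\<close>. As \<open>1 \<notin> X\<close>, the pair \<open>(F, G)\<close> may be replaced
  by \<open>(\<chi>\<^bsub>(1,\<infinity>)\<^esub>, \<chi>\<^bsub>[0,1)\<^esub>)\<close>, which gives a column \<open>v'\<close> such that the off-diagonal entries of
  \<open>v' v\<^sup>*\<close> vanish at \<open>0\<close> and \<open>\<infinity>\<close>; hence \<open>P\<^sub>n\<close> is equivalent to the diagonal matrix of \<open>\<chi>\<^bsub>(1,\<infinity>)\<^esub>\<close> and \<open>\<chi>\<^bsub>[0,q\<^sup>-\<^sup>n)\<^esub>\<close>. The case of \<open>P\<^sub>-\<^sub>n\<close> is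
  similar, with \<open>v = (U\<^sup>n F, G)\<close>. The partial isometry \<open>w = \<surd>\<phi> \<chi>\<^bsub>(q,1)\<^esub> + \<chi>\<^bsub>(1,q\<^sup>1\<^sup>-\<^sup>n)\<^esub> + U\<^sup>n \<surd>(1 - \<phi>) \<chi>\<^bsub>(q,1)\<^esub>\<close>
  satisfies \<open>w w\<^sup>* = R\<^sub>n\<close> and \<open>w\<^sup>* w = \<chi>\<^bsub>(q,q\<^sup>1\<^sup>-\<^sup>n)\<^esub>\<close>. Finally \<open>U\<close> moves \<open>\<chi>\<^bsub>(q\<^sup>k\<^sup>+\<^sup>1,q\<^sup>k)\<^esub>\<close> to \<open>\<chi>\<^bsub>(q\<^sup>k,q\<^sup>k\<^sup>-\<^sup>1)\<^esub>\<close>.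
  The invariance \<open>qX = X\<close> holds because \<open>z\<close> and \<open>z\<^sup>*\<close> map approximate eigenvectors of \<open>|z|\<close> for \<open>t\<close> to
  approximate eigenvectors for \<open>t / q\<close> and \<open>q t\<close>.\<close>

section \<open>Complex Hilbert spaces\<close>

lemma cinner_add_left: "cinner (x + y) (z :: 'h::complex_hilbert) = cinner x z + cinner y z"
  by (metis cinner_add_right cinner_commute complex_cnj_add)

lemma cinner_scaleC_left: "cinner (scaleC c x) (y :: 'h::complex_hilbert) = cnj c * cinner x y"
  by (metis cinner_scaleC_right cinner_commute complex_cnj_mult)

lemma scaleC_minus_one: "scaleC (- 1) (x :: 'h::complex_banach) = - x"
  using scaleC_of_real[of "- 1" x] by simp

lemma scaleC_zero_left [simp]: "scaleC 0 (x :: 'h::complex_banach) = 0"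
  using scaleC_of_real[of 0 x] by simp

lemma scaleC_zero_right [simp]: "scaleC c (0 :: 'h::complex_banach) = 0"
  using scaleC_add_right[of c 0 0] by simp

lemma scaleC_minus_right: "scaleC c (- x :: 'h::complex_banach) = - scaleC c x"
  using scaleC_add_right[of c x "- x"] by (simp add: eq_neg_iff_add_eq_0 add.commute)

lemma scaleC_diff_right: "scaleC c (x - y :: 'h::complex_banach) = scaleC c x - scaleC c y"
  using scaleC_add_right[of c x "- y"] by (simp add: scaleC_minus_right)

lemma cinner_minus_right: "cinner x (- y :: 'h::complex_hilbert) = - cinner x y"
  by (metis cinner_scaleC_right mult_minus1 scaleC_minus_one)

lemma cinner_diff_right: "cinner x (y - z :: 'h::complex_hilbert) = cinner x y - cinner x z"
  using cinner_add_right[of x y "- z"] by (simp add: cinner_minus_right)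

lemma cinner_zero_left [simp]: "cinner 0 (x :: 'h::complex_hilbert) = 0"
  using cinner_scaleC_left[of 0 0 x] by simp

lemma cinner_zero_right [simp]: "cinner x (0 :: 'h::complex_hilbert) = 0"
  using cinner_scaleC_right[of x 0 0] by simp

lemma norm_eq_Re_cinner: "(norm (x :: 'h::complex_hilbert))\<^sup>2 = Re (cinner x x)"
  by (simp add: cinner_self)

lemma norm_add_square:
  "(norm (x + y :: 'h::complex_hilbert))\<^sup>2 = (norm x)\<^sup>2 + 2 * Re (cinner x y) + (norm y)\<^sup>2"
proof -
  have "Re (cinner y x) = Re (cinner x y)"
    by (metis cinner_commute cnj.sel(1))
  then show ?thesis
    by (simp add: norm_eq_Re_cinner cinner_add_left cinner_add_right)
qed

lemma parallelogram:
  "(norm (x + y :: 'h::complex_hilbert))\<^sup>2 + (norm (x - y))\<^sup>2 = 2 * (norm x)\<^sup>2 + 2 * (norm y)\<^sup>2"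
  using norm_add_square[of x y] norm_add_square[of x "- y"] by (simp add: cinner_minus_right)

text \<open>Along the direction \<open>m\<close> the squared norm is a quadratic in the coefficient;
  it can be minimal at coefficient 0 only if its linear part, given by \<open>cinner y m\<close>,
  vanishes.\<close>

lemma minimal_imp_orthogonal:
  fixes y m :: "'h::complex_hilbert"
  assumes "\<And>c. norm y \<le> norm (y + scaleC c m)"
  shows "cinner y m = 0"
proof (cases "m = 0")
  case False
  \<comment> \<open>The minimiser of this quadratic; there the squared norm drops by |<y, m>|^2 /
    |m|^2.\<close>
  define c where "c = - cinner m y / (norm m)\<^sup>2"
  have "(norm y)\<^sup>2 \<le> (norm (y + scaleC c m))\<^sup>2"
    using assms by (simp add: power_mono)
  also have "\<dots> = (norm y)\<^sup>2 + 2 * Re (c * cinner y m) + (cmod c * norm m)\<^sup>2"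
    by (simp add: norm_add_square cinner_scaleC_right norm_scaleC)
  also have "c * cinner y m = - complex_of_real ((cmod (cinner y m))\<^sup>2 / (norm m)\<^sup>2)"
    unfolding c_def by (subst cinner_commute) (simp add: mult.commute flip: complex_norm_square)
  also have "cmod c * norm m = cmod (cinner y m) / norm m"
    unfolding c_def by (subst cinner_commute) (simp add: norm_divide norm_mult power2_eq_square)
  also have "(cmod (cinner y m) / norm m)\<^sup>2 = (cmod (cinner y m))\<^sup>2 / (norm m)\<^sup>2"
    by (rule power_divide)
  finally have "(cmod (cinner y m))\<^sup>2 / (norm m)\<^sup>2 \<le> 0"
    by simp
  then show ?thesis
    using False by (simp add: divide_le_0_iff)
qed simp

lemma cinner_cauchy_schwarz: "cmod (cinner x (y :: 'h::complex_hilbert)) \<le> norm x * norm y"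
proof (cases "y = 0")
  case False
  \<comment> \<open>The same minimising coefficient as in \<open>minimal_imp_orthogonal\<close>;
    nonnegativity of the minimum is the claim.\<close>
  define c where "c = - cinner y x / (norm y)\<^sup>2"
  have "0 \<le> (norm (x + scaleC c y))\<^sup>2"
    by simp
  also have "\<dots> = (norm x)\<^sup>2 + 2 * Re (c * cinner x y) + (cmod c * norm y)\<^sup>2"
    by (simp add: norm_add_square cinner_scaleC_right norm_scaleC)
  also have "c * cinner x y = - complex_of_real ((cmod (cinner x y))\<^sup>2 / (norm y)\<^sup>2)"
    unfolding c_def by (subst cinner_commute) (simp add: mult.commute flip: complex_norm_square)
  also have "cmod c * norm y = cmod (cinner x y) / norm y"
    unfolding c_def by (subst cinner_commute) (simp add: norm_divide norm_mult power2_eq_square)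
  also have "(cmod (cinner x y) / norm y)\<^sup>2 = (cmod (cinner x y))\<^sup>2 / (norm y)\<^sup>2"
    by (rule power_divide)
  finally have "(cmod (cinner x y))\<^sup>2 / (norm y)\<^sup>2 \<le> (norm x)\<^sup>2"
    by simp
  then have "(cmod (cinner x y))\<^sup>2 \<le> (norm x * norm y)\<^sup>2"
    using False by (simp add: pos_divide_le_eq power_mult_distrib)
  then show ?thesis
    by (rule power2_le_imp_le) simp
qed simp

lemma bounded_bilinear_cinner: "bounded_bilinear (cinner :: 'h::complex_hilbert \<Rightarrow> 'h \<Rightarrow> complex)"
proof
  show "\<exists>K. \<forall>a b. cmod (cinner a (b::'h)) \<le> norm a * norm b * K"
    using cinner_cauchy_schwarz by (metis mult.right_neutral)
qed (simp_all add: cinner_add_left cinner_add_right cinner_scaleC_left cinner_scaleC_right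
    scaleR_conv_of_real[where 'a=complex] flip: scaleC_of_real)

lemmas tendsto_cinner = bounded_bilinear.tendsto[OF bounded_bilinear_cinner]

text \<open>Projection theorem: for a point \<open>z\<close> outside \<open>M\<close>, a sequence in
  \<open>M\<close> minimising the distance is Cauchy, its limit \<open>l\<close> is a nearest point,
  and \<open>z - l\<close> is orthogonal to \<open>M\<close>.\<close>

lemma orthogonal_vector_exists:
  fixes M :: "'h::complex_hilbert set"
  assumes "closed M" and "0 \<in> M" and add: "\<And>x y. x \<in> M \<Longrightarrow> y \<in> M \<Longrightarrow> x + y \<in> M"
    and scale: "\<And>c x. x \<in> M \<Longrightarrow> scaleC c x \<in> M" and "M \<noteq> UNIV"
  obtains y where "y \<noteq> 0" and "\<And>m. m \<in> M \<Longrightarrow> cinner y m = 0"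
proof -
  obtain z where z: "z \<notin> M"
    using assms(5) by blast
  define d where "d = infdist z M"
  have d: "d \<le> norm (z - m)" if "m \<in> M" for m
    using infdist_le[OF that, of z] by (simp add: d_def dist_norm)
  have "\<exists>m\<in>M. norm (z - m) < d + 1 / Suc n" for n
  proof (rule ccontr)
    assume "\<not> ?thesis"
    then have "d + 1 / Suc n \<le> infdist z M"
      unfolding infdist_def using assms(2) by (auto simp: dist_norm not_less intro!: cINF_greatest)
    then show False
      by (simp add: d_def)
  qed
  then obtain s where sM: "\<And>n. s n \<in> M" and s: "\<And>n. norm (z - s n) < d + 1 / Suc n"
    by metis
  have d0: "0 \<le> d"
    by (simp add: d_def infdist_nonneg)
  \<comment> \<open>Midpoints stay in \<open>M\<close>, so the mean of two differences is not
    shorter than \<open>d\<close>.\<close>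
  have mid: "2 * d \<le> norm ((z - s m) + (z - s n))" for m n
  proof -
    have "scaleC (1/2) (s m + s n) \<in> M"
      by (intro scale add sM)
    then have "d \<le> norm (z - scaleC (1/2) (s m + s n))"
      by (rule d)
    moreover have "(z - s m) + (z - s n) = 2 *\<^sub>R (z - scaleC (1/2) (s m + s n))"
      using scaleC_of_real[of "1/2" "s m + s n"]
      by (simp add: algebra_simps scaleR_2)
    ultimately show ?thesis
      by simp
  qed
  \<comment> \<open>By the parallelogram law, two nearly minimal differences whose mean is not
    shorter than \<open>d\<close> are close to each other.\<close>
  have bound: "(norm (s m - s n))\<^sup>2 \<le> 4 * (2 * d + 1) / Suc N" if "N \<le> m" "N \<le> n" for m n N
  proof -
    have a: "(norm (z - s k))\<^sup>2 \<le> d\<^sup>2 + (2 * d + 1) / Suc N" if "N \<le> k" for k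
    proof -
      have "norm (z - s k) \<le> d + 1 / Suc N"
        using s[of k] frac_le[of 1 1 "real (Suc N)" "real (Suc k)"] that by simp
      then have "(norm (z - s k))\<^sup>2 \<le> (d + 1 / Suc N)\<^sup>2"
        by (simp add: power_mono)
      also have "\<dots> = d\<^sup>2 + 2 * d / Suc N + 1 / Suc N * (1 / Suc N)"
        by (simp add: power2_eq_square algebra_simps)
      also have "\<dots> \<le> d\<^sup>2 + 2 * d / Suc N + 1 / Suc N * 1"
        by (intro add_left_mono mult_left_mono) auto
      finally show ?thesis
        by (simp add: add_divide_distrib)
    qed
    have "(norm (s m - s n))\<^sup>2 = 2 * (norm (z - s m))\<^sup>2 + 2 * (norm (z - s n))\<^sup>2
        - (norm ((z - s m) + (z - s n)))\<^sup>2"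
      using parallelogram[of "z - s m" "z - s n"] by (simp add: norm_minus_commute)
    also have "\<dots> \<le> 2 * (norm (z - s m))\<^sup>2 + 2 * (norm (z - s n))\<^sup>2 - (2 * d)\<^sup>2"
      using power_mono[OF mid[of m n], of 2] d0 by simp
    also have "\<dots> \<le> 4 * ((2 * d + 1) / Suc N)"
    proof -
      have "2 * x + 2 * y - (2 * d)\<^sup>2 \<le> 4 * e" if "x \<le> d\<^sup>2 + e" "y \<le> d\<^sup>2 + e" for x y e :: real
        using that by (simp add: power_mult_distrib)
      then show ?thesis
        using a that by blast
    qed
    finally show ?thesis
      by simp
  qed
  have "Cauchy s"
  proof (rule metric_CauchyI)
    fix e :: real assume "0 < e"
    have "(\<lambda>N. 4 * (2 * d + 1) / real (Suc N)) \<longlonglongrightarrow> 0"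
      by (rule LIMSEQ_Suc[OF lim_const_over_n])
    then have "\<forall>\<^sub>F N in sequentially. 4 * (2 * d + 1) / real (Suc N) < e\<^sup>2"
      using \<open>0 < e\<close> by (intro order_tendstoD) auto
    then obtain N where N: "4 * (2 * d + 1) / real (Suc N) < e\<^sup>2"
      using eventually_happens by force
    have "dist (s m) (s n) < e" if "N \<le> m" "N \<le> n" for m n
    proof -
      have "(dist (s m) (s n))\<^sup>2 < e\<^sup>2"
        using bound[OF that] N by (simp add: dist_norm)
      then show ?thesis
        using \<open>0 < e\<close> power_less_imp_less_base by fastforce
    qed
    then show "\<exists>N. \<forall>m\<ge>N. \<forall>n\<ge>N. dist (s m) (s n) < e"
      by blast
  qed
  then obtain l where l: "s \<longlonglongrightarrow> l"
    using Cauchy_convergent convergent_def by blast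
  have lM: "l \<in> M"
    using closed_sequentially[OF assms(1) _ l] sM by blast
  have nl: "norm (z - l) \<le> d"
  proof (rule LIMSEQ_le)
    show "(\<lambda>n. norm (z - s n)) \<longlonglongrightarrow> norm (z - l)"
      by (intro tendsto_intros l)
    show "(\<lambda>n. d + 1 / real (Suc n)) \<longlonglongrightarrow> d"
      using tendsto_add[OF tendsto_const LIMSEQ_Suc[OF lim_const_over_n[of 1]], of d] by simp
  qed (use s less_imp_le in blast)
  show ?thesis
  proof (rule that)
    show "z - l \<noteq> 0"
      using z lM by auto
    fix m assume m: "m \<in> M"
    show "cinner (z - l) m = 0"
    proof (rule minimal_imp_orthogonal)
      fix c
      have "l + scaleC (- c) m \<in> M"
        by (intro add scale lM m)
      then have "d \<le> norm (z - (l + scaleC (- c) m))"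
        by (rule d)
      moreover have "z - (l + scaleC (- c) m) = z - l + scaleC c m"
        using scaleC_add_left[of c "- c" m] by (simp add: algebra_simps)
      ultimately show "norm (z - l) \<le> norm (z - l + scaleC c m)"
        using nl by simp
    qed
  qed
qed

section \<open>Spectra of positive self-adjoint operators\<close>

lemma linear_operatorD:
  assumes "linear_operator T"
  shows linear_operator_zero: "(0, 0) \<in> T"
    and linear_operator_add: "(x, y) \<in> T \<Longrightarrow> (x', y') \<in> T \<Longrightarrow> (x + x', y + y') \<in> T"
    and linear_operator_scale: "(x, y) \<in> T \<Longrightarrow> (scaleC c x, scaleC c y) \<in> T"
  using assms unfolding linear_operator_def by auto

lemma linear_operator_diff:
  assumes "linear_operator T" "(x, y) \<in> T" "(x', y') \<in> T"
  shows "(x - x', y - y') \<in> T"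
  using linear_operator_add[OF assms(1,2) linear_operator_scale[OF assms(1,3), of "- 1"]]
  by (simp add: scaleC_minus_one)

lemma adjoint_op_diff:
  assumes "(x, y) \<in> adjoint_op T" "(x', y') \<in> adjoint_op T"
  shows "(x - x', y - y') \<in> adjoint_op T"
  using assms unfolding adjoint_op_def by (force simp: cinner_diff_right)

lemma adjoint_op_scale:
  assumes "(x, y) \<in> adjoint_op T"
  shows "(scaleC c x, scaleC c y) \<in> adjoint_op T"
  using assms unfolding adjoint_op_def by (force simp: cinner_scaleC_right)

lemma closed_adjoint_op: "closed (adjoint_op (T :: 'h::complex_hilbert operator))"
  unfolding closed_sequential_limits
proof (intro allI impI)
  fix s :: "nat \<Rightarrow> 'h \<times> 'h" and l
  assume s: "(\<forall>n. s n \<in> adjoint_op T) \<and> s \<longlonglongrightarrow> l"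
  have "cinner v (fst l) = cinner u (snd l)" if "(u, v) \<in> T" for u v
  proof (rule LIMSEQ_unique)
    show "(\<lambda>n. cinner v (fst (s n))) \<longlonglongrightarrow> cinner v (fst l)"
      using s by (intro tendsto_cinner tendsto_intros) auto
    have "cinner v (fst (s n)) = cinner u (snd (s n))" for n
      using s that unfolding adjoint_op_def by (metis (mono_tags, lifting) case_prodD case_prod_unfold mem_Collect_eq)
    then show "(\<lambda>n. cinner v (fst (s n))) \<longlonglongrightarrow> cinner u (snd l)"
      using s by (simp only:) (intro tendsto_cinner tendsto_intros; auto)
  qed
  then show "l \<in> adjoint_op T"
    unfolding adjoint_op_def by (auto simp: case_prod_unfold)
qed

text \<open>If the images converge, the bound makes the preimages Cauchy, and the closed graph
  contains the limit pair.\<close>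

lemma bounded_below_range_closed:
  fixes T :: "'h::complex_hilbert operator"
  assumes T: "linear_operator T" "closed T"
    and bound: "\<And>x y. (x, y) \<in> T \<Longrightarrow> norm x \<le> C * norm (y - scaleC c x)"
  shows "closed (Range (shift_op T c))"
  unfolding closed_sequential_limits
proof (intro allI impI)
  fix w :: "nat \<Rightarrow> 'h" and l
  assume w: "(\<forall>n. w n \<in> Range (shift_op T c)) \<and> w \<longlonglongrightarrow> l"
  then have "\<forall>n. \<exists>x y. (x, y) \<in> T \<and> w n = y - scaleC c x"
    unfolding shift_op_def by blast
  then obtain x y where xy: "\<And>n. (x n, y n) \<in> T" and wn: "\<And>n. w n = y n - scaleC c (x n)"
    by metis
  have C: "norm (x m - x n) \<le> \<bar>C\<bar> * norm (w m - w n)" for m n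
  proof -
    have "norm (x m - x n) \<le> C * norm (y m - y n - scaleC c (x m - x n))"
      by (intro bound linear_operator_diff T xy)
    also have "y m - y n - scaleC c (x m - x n) = w m - w n"
      by (simp add: wn scaleC_diff_right)
    also have "C * norm (w m - w n) \<le> \<bar>C\<bar> * norm (w m - w n)"
      by (intro mult_right_mono) auto
    finally show ?thesis .
  qed
  have "Cauchy x"
  proof (rule metric_CauchyI)
    fix e :: real assume e: "0 < e"
    have "Cauchy w"
      using w by (blast intro: LIMSEQ_imp_Cauchy)
    \<comment> \<open>\<open>C\<close> may be zero or negative; |C| + 1 is a positive
      substitute.\<close>
    moreover have "0 < e / (\<bar>C\<bar> + 1)"
      using e by simp
    ultimately obtain N where N: "\<And>m n. N \<le> m \<Longrightarrow> N \<le> n \<Longrightarrow> dist (w m) (w n) < e / (\<bar>C\<bar> + 1)"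
      by (metis metric_CauchyD)
    have "dist (x m) (x n) < e" if "N \<le> m" "N \<le> n" for m n
    proof -
      have "dist (x m) (x n) \<le> (\<bar>C\<bar> + 1) * dist (w m) (w n)"
        using C[of m n] by (simp add: dist_norm distrib_right add_increasing2)
      also have "\<dots> < e"
        using N[OF that] by (simp add: field_simps)
      finally show ?thesis .
    qed
    then show "\<exists>N. \<forall>m\<ge>N. \<forall>n\<ge>N. dist (x m) (x n) < e"
      by blast
  qed
  then obtain k where k: "x \<longlonglongrightarrow> k"
    using Cauchy_convergent convergent_def by blast
  have "(\<lambda>n. scaleC c (x n)) \<longlonglongrightarrow> scaleC c k"
  proof -
    have "bounded_linear (scaleC c :: 'h \<Rightarrow> 'h)"
    proof
      show "scaleC c (r *\<^sub>R v) = r *\<^sub>R scaleC c v" for r and v :: 'h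
        by (simp add: scaleC_scaleC mult.commute flip: scaleC_of_real)
      show "\<exists>K. \<forall>v::'h. norm (scaleC c v) \<le> norm v * K"
        by (metis norm_scaleC mult.commute order_refl)
    qed (rule scaleC_add_right)
    then show ?thesis
      using k by (rule bounded_linear.tendsto)
  qed
  with w have "(\<lambda>n. w n + scaleC c (x n)) \<longlonglongrightarrow> l + scaleC c k"
    by (intro tendsto_add) auto
  then have "y \<longlonglongrightarrow> l + scaleC c k"
    by (simp add: wn)
  then have "(\<lambda>n. (x n, y n)) \<longlonglongrightarrow> (k, l + scaleC c k)"
    by (intro tendsto_Pair k)
  then have "(k, l + scaleC c k) \<in> T"
    using closed_sequentially[OF T(2), of "\<lambda>n. (x n, y n)"] xy by blast
  then have "(k, l) \<in> shift_op T c"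
    unfolding shift_op_def by force
  then show "l \<in> Range (shift_op T c)"
    by blast
qed

lemma positive_selfadjointD:
  assumes "positive_selfadjoint T"
  shows positive_selfadjoint_linear: "linear_operator T"
    and positive_selfadjoint_adjoint: "adjoint_op T = T"
    and positive_selfadjoint_closed: "closed T"
    and positive_selfadjoint_symmetric:
      "(x, y) \<in> T \<Longrightarrow> (x', y') \<in> T \<Longrightarrow> cinner y x' = cinner x y'"
    and positive_selfadjoint_nonneg: "(x, y) \<in> T \<Longrightarrow> 0 \<le> Re (cinner x y)"
proof -
  show *: "linear_operator T" "adjoint_op T = T"
    and "(x, y) \<in> T \<Longrightarrow> 0 \<le> Re (cinner x y)"
    using assms by (auto simp: positive_selfadjoint_def)
  show "closed T"
    using closed_adjoint_op[of T] * by simp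
  assume "(x, y) \<in> T" "(x', y') \<in> T"
  then have "(x', y') \<in> adjoint_op T"
    using * by simp
  then show "cinner y x' = cinner x y'"
    using \<open>(x, y) \<in> T\<close> unfolding adjoint_op_def by blast
qed

text \<open>A lower bound for T - c already yields a bounded inverse: it makes the range closed, and
  a vector orthogonal to the range would be an eigenvector for \<open>c\<close>, which the bound
  excludes. Below, real spectral points are handled through this criterion.\<close>

lemma real_spectrum_iff:
  assumes T: "positive_selfadjoint T"
  shows "complex_of_real c \<notin> op_spectrum T \<longleftrightarrow>
    (\<exists>C. \<forall>(x, y)\<in>T. norm x \<le> C * norm (y - c *\<^sub>R x))"
    (is "?l \<longleftrightarrow> ?r")
proof
  assume ?l
  then obtain C where C: "\<forall>(x, y)\<in>shift_op T c. norm x \<le> C * norm y"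
    unfolding op_spectrum_def by blast
  have "norm x \<le> C * norm (y - c *\<^sub>R x)" if "(x, y) \<in> T" for x y
  proof -
    have "(x, y - c *\<^sub>R x) \<in> shift_op T c"
      using that unfolding shift_op_def by (auto simp: scaleC_of_real)
    then show ?thesis
      using C by blast
  qed
  then show ?r
    by blast
next
  assume ?r
  then obtain C where C: "\<And>x y. (x, y) \<in> T \<Longrightarrow> norm x \<le> C * norm (y - scaleC c x)"
    by (auto simp: scaleC_of_real)
  note lin = positive_selfadjoint_linear[OF T]
  let ?M = "Range (shift_op T c)"
  have M: "w \<in> ?M \<longleftrightarrow> (\<exists>x y. (x, y) \<in> T \<and> w = y - scaleC c x)" for w
    by (auto simp: shift_op_def Range_iff)
  have "?M = UNIV"
  proof (rule ccontr)
    assume ne: "?M \<noteq> UNIV"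
    obtain u where u: "u \<noteq> 0" "\<And>m. m \<in> ?M \<Longrightarrow> cinner u m = 0"
    proof (rule orthogonal_vector_exists[OF _ _ _ _ ne])
      show "closed ?M"
        by (rule bounded_below_range_closed[OF lin positive_selfadjoint_closed[OF T] C])
      show "0 \<in> ?M"
        unfolding M using linear_operator_zero[OF lin] by (intro exI[of _ 0]) simp
      show "x + y \<in> ?M" if "x \<in> ?M" "y \<in> ?M" for x y
      proof -
        from that obtain x1 y1 x2 y2 where *: "(x1, y1) \<in> T" "x = y1 - scaleC c x1"
          "(x2, y2) \<in> T" "y = y2 - scaleC c x2"
          unfolding M by blast
        have "(x1 + x2, y1 + y2) \<in> T"
          by (intro linear_operator_add lin *)
        moreover have "x + y = y1 + y2 - scaleC c (x1 + x2)"
          by (simp add: * scaleC_add_right)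
        ultimately show ?thesis
          unfolding M by blast
      qed
      show "scaleC d x \<in> ?M" if "x \<in> ?M" for d x
      proof -
        from that obtain x1 y1 where *: "(x1, y1) \<in> T" "x = y1 - scaleC c x1"
          unfolding M by blast
        have "scaleC d x = scaleC d y1 - scaleC c (scaleC d x1)"
          by (simp add: * scaleC_diff_right scaleC_scaleC mult.commute)
        then show ?thesis
          unfolding M using linear_operator_scale[OF lin *(1)] by blast
      qed
    qed (use that in blast)
    \<comment> \<open>Orthogonality to the range, conjugated, is the defining equation of the
      adjoint for the pair \<open>(u, scaleC c u)\<close>; the conjugate of \<open>c\<close> is
      \<open>c\<close> itself because \<open>c\<close> is real.\<close>
    have "cinner y u = cinner x (scaleC c u)" if "(x, y) \<in> T" for x y
    proof -
      have "cinner u (y - scaleC c x) = 0"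
        using that u(2) M by blast
      then have "cinner u y = complex_of_real c * cinner u x"
        by (simp add: cinner_diff_right cinner_scaleC_right)
      then have "cnj (cinner u y) = complex_of_real c * cnj (cinner u x)"
        by simp
      then show ?thesis
        by (simp add: cinner_scaleC_right flip: cinner_commute)
    qed
    then have "(u, scaleC c u) \<in> T"
      using positive_selfadjoint_adjoint[OF T] unfolding adjoint_op_def by blast
    from C[OF this] u(1) show False
      by simp
  qed
  moreover have "x = x'" if "(x, w) \<in> shift_op T c" "(x', w) \<in> shift_op T c" for x x' w
  proof -
    obtain y y' where *: "(x, y) \<in> T" "w = y - scaleC c x" "(x', y') \<in> T" "w = y' - scaleC c x'"
      using \<open>(x, w) \<in> _\<close> \<open>(x', w) \<in> _\<close> unfolding shift_op_def by blast
    have "norm (x - x') \<le> C * norm (y - y' - scaleC c (x - x'))"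
      by (intro C linear_operator_diff lin *)
    moreover have "y = w + scaleC c x" "y' = w + scaleC c x'"
      using *(2,4) by (metis diff_add_cancel)+
    ultimately show ?thesis
      by (simp add: scaleC_diff_right)
  qed
  ultimately have "\<forall>w. \<exists>!x. (x, w) \<in> shift_op T c"
    by (metis Range_iff UNIV_I)
  moreover have "\<forall>(x, y)\<in>shift_op T c. norm x \<le> C * norm y"
    using C unfolding shift_op_def by auto
  ultimately show ?l
    unfolding op_spectrum_def by blast
qed

text \<open>Positivity bounds Re <x, (T + t) x> below by t |x|^2, and Cauchy-Schwarz bounds it above
  by |x| |(T + t) x|.\<close>

lemma positive_selfadjoint_shift_bound:
  assumes T: "positive_selfadjoint T" and "(x, y) \<in> T" and "0 \<le> t"
  shows "t * norm x \<le> norm (y + t *\<^sub>R x)"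
proof (cases "x = 0")
  case False
  have "t * (norm x)\<^sup>2 \<le> Re (cinner x (y + t *\<^sub>R x))"
    using positive_selfadjoint_nonneg[OF T assms(2)]
    by (simp add: cinner_add_right cinner_scaleC_right norm_eq_Re_cinner flip: scaleC_of_real)
  also have "\<dots> \<le> norm x * norm (y + t *\<^sub>R x)"
    using complex_Re_le_cmod cinner_cauchy_schwarz order_trans by blast
  finally show ?thesis
    using False by (simp add: power2_eq_square)
qed (use assms in simp)

lemma positive_selfadjoint_spectrum_nonneg:
  assumes T: "positive_selfadjoint T" and "complex_of_real c \<in> op_spectrum T"
  shows "0 \<le> c"
proof (rule ccontr)
  assume "\<not> 0 \<le> c"
  then have "norm x \<le> 1 / (- c) * norm (y - c *\<^sub>R x)" if "(x, y) \<in> T" for x y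
    using positive_selfadjoint_shift_bound[OF T that, of "- c"] by (simp add: field_simps)
  then show False
    using assms(2) real_spectrum_iff[OF T, of c] by blast
qed

text \<open>The lower bound of \<open>real_spectrum_iff\<close> survives a small change of
  \<open>c\<close> at the price of doubling the constant, so the complement is open.\<close>

lemma positive_selfadjoint_spectrum_closed:
  assumes T: "positive_selfadjoint T"
  shows "closed {t. complex_of_real t \<in> op_spectrum T}"
proof -
  have "\<exists>e>0. \<forall>d. dist d c < e \<longrightarrow> complex_of_real d \<notin> op_spectrum T"
    if "complex_of_real c \<notin> op_spectrum T" for c
  proof -
    obtain C' where C': "\<And>x y. (x, y) \<in> T \<Longrightarrow> norm x \<le> C' * norm (y - c *\<^sub>R x)"
      using \<open>_ \<notin> _\<close> real_spectrum_iff[OF T] by blast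
    define C where "C = \<bar>C'\<bar> + 1"
    have C: "norm x \<le> C * norm (y - c *\<^sub>R x)" if "(x, y) \<in> T" for x y
      using C'[OF that] mult_right_mono[of C' C "norm (y - c *\<^sub>R x)"] unfolding C_def by (smt (verit) norm_ge_zero)
    have C0: "0 < C"
      by (simp add: C_def)
    have "complex_of_real d \<notin> op_spectrum T" if d: "dist d c < 1 / (2 * C)" for d
      unfolding real_spectrum_iff[OF T]
    proof (intro exI ballI, clarify)
      fix x y assume xy: "(x, y) \<in> T"
      have "norm (y - c *\<^sub>R x) \<le> norm (y - d *\<^sub>R x) + norm ((d - c) *\<^sub>R x)"
        using norm_triangle_ineq[of "y - d *\<^sub>R x" "(d - c) *\<^sub>R x"] by (simp add: algebra_simps)
      also have "norm ((d - c) *\<^sub>R x) \<le> 1 / (2 * C) * norm x"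
        unfolding norm_scaleR using d by (intro mult_right_mono) (auto simp: dist_real_def)
      finally have "C * norm (y - c *\<^sub>R x) \<le> C * norm (y - d *\<^sub>R x) + C * (1 / (2 * C) * norm x)"
        using C0 by (simp only: mult_le_cancel_left_pos flip: distrib_left)
      then have "norm x \<le> C * norm (y - d *\<^sub>R x) + norm x / 2"
        using C[OF xy] C0 by simp
      then show "norm x \<le> (2 * C) * norm (y - d *\<^sub>R x)"
        by simp
    qed
    then show ?thesis
      using C0 by (intro exI[of _ "1 / (2 * C)"]) auto
  qed
  then show ?thesis
    unfolding closed_def open_dist by auto
qed

text \<open>\<open>S\<close> is the resolvent (T + t)^(-1): membership of the pair in the graph says
  that T + t maps \<open>S w\<close> to \<open>w\<close>. It exists because -t < 0 is not in the
  spectrum.\<close>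

lemma positive_selfadjoint_shift_inverse:
  assumes T: "positive_selfadjoint T" and t: "0 < t"
  shows "\<exists>S. \<forall>w. (S w, w - t *\<^sub>R S w) \<in> T"
proof -
  have "complex_of_real (- t) \<notin> op_spectrum T"
    using positive_selfadjoint_spectrum_nonneg[OF T, of "- t"] t by auto
  then have ex: "\<forall>w. \<exists>!x. (x, w) \<in> shift_op T (complex_of_real (- t))"
    unfolding op_spectrum_def by blast
  have sh: "(x, w) \<in> shift_op T (complex_of_real (- t)) \<longleftrightarrow> (x, w - t *\<^sub>R x) \<in> T" for x w
  proof -
    have "scaleC (complex_of_real (- t)) x = - (t *\<^sub>R x)" for x :: 'a
      by (subst scaleC_of_real) simp
    then show ?thesis
      unfolding shift_op_def by (simp add: eq_diff_eq) (metis add_diff_cancel_right' diff_add_cancel)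
  qed
  show ?thesis
    using ex sh by metis
qed

section \<open>Invariance of the spectrum under dilation\<close>

text \<open>With a = T y and b = T^2 y, this is the factorisation T^2 - s^2 = (T + s)(T - s), where
  T + s is bounded below by s. Approximate eigenvectors of T^2 for s^2 are thus approximate
  eigenvectors of T for s.\<close>

lemma positive_selfadjoint_square_bound:
  assumes T: "positive_selfadjoint T" and "(y, a) \<in> T" "(a, b) \<in> T" and "0 \<le> s"
  shows "s * norm (a - s *\<^sub>R y) \<le> norm (b - s\<^sup>2 *\<^sub>R y)"
proof -
  note lin = positive_selfadjoint_linear[OF T]
  have "(a - s *\<^sub>R y, b - s *\<^sub>R a) \<in> T"
    using linear_operator_diff[OF lin assms(3) linear_operator_scale[OF lin assms(2), of "complex_of_real s"]]
    by (simp add: scaleC_of_real)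
  from positive_selfadjoint_shift_bound[OF T this assms(4)] show ?thesis
    by (simp add: algebra_simps power2_eq_square)
qed

text \<open>The resolvent \<open>(T + t)\<^sup>-\<^sup>1\<close>, applied three times, turns an approximate eigenvector of
  \<open>T\<close> into one that lies in the domain of \<open>T\<^sup>4\<close>, to which \<open>z z\<^sup>* z\<close> and \<open>z\<^sup>* z z\<^sup>*\<close> apply.\<close>

lemma spectrum_transfer:
  fixes T :: "'h::complex_hilbert operator"
  assumes T: "positive_selfadjoint T" and t: "0 < t" and s: "0 < s" and k: "0 < k"
    and step: "\<And>x u v v' v''. (x, u) \<in> T \<Longrightarrow> (u, v) \<in> T \<Longrightarrow> (v, v') \<in> T \<Longrightarrow> (v', v'') \<in> T \<Longrightarrow>
      \<exists>y a b. (y, a) \<in> T \<and> (a, b) \<in> T \<and> norm y = k * norm u \<and>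
        norm (b - s\<^sup>2 *\<^sub>R y) = k' * norm (v' - t\<^sup>2 *\<^sub>R u)"
    and spec: "complex_of_real t \<in> op_spectrum T"
  shows "complex_of_real s \<in> op_spectrum T"
proof (rule ccontr)
  assume "complex_of_real s \<notin> op_spectrum T"
  then obtain C where C: "\<And>x y. (x, y) \<in> T \<Longrightarrow> norm x \<le> C * norm (y - s *\<^sub>R x)"
    using real_spectrum_iff[OF T] by blast
  note lin = positive_selfadjoint_linear[OF T]
  have scaleT: "(r *\<^sub>R x, r *\<^sub>R y) \<in> T" if "(x, y) \<in> T" for r x y
    using linear_operator_scale[OF lin that, of "complex_of_real r"] by (simp add: scaleC_of_real)
  \<comment> \<open>If \<open>s\<close> is not in the spectrum, then on the domain of T^4 the vector
    T x is controlled by T (T^2 - t^2) x; \<open>D\<close> collects the constants of this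
    estimate.\<close>
  define D where "D = \<bar>C\<bar> * \<bar>k'\<bar> / (s * k)"
  have D0: "0 \<le> D"
    using s k by (simp add: D_def)
  have D: "norm u \<le> D * norm (v' - t\<^sup>2 *\<^sub>R u)"
    if c: "(x, u) \<in> T" "(u, v) \<in> T" "(v, v') \<in> T" "(v', v'') \<in> T" for x u v v' v''
  proof -
    obtain y a b where y: "(y, a) \<in> T" "(a, b) \<in> T" "norm y = k * norm u"
      "norm (b - s\<^sup>2 *\<^sub>R y) = k' * norm (v' - t\<^sup>2 *\<^sub>R u)"
      using step[OF c] by blast
    have "s * (k * norm u) \<le> s * (\<bar>C\<bar> * norm (a - s *\<^sub>R y))"
      using C[OF y(1)] s y(3) by (intro mult_left_mono) (smt (verit) mult_right_mono norm_ge_zero, simp)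
    also have "\<dots> = \<bar>C\<bar> * (s * norm (a - s *\<^sub>R y))"
      by simp
    also have "\<dots> \<le> \<bar>C\<bar> * (k' * norm (v' - t\<^sup>2 *\<^sub>R u))"
      using positive_selfadjoint_square_bound[OF T y(1,2), of s] s y(4) by (intro mult_left_mono) auto
    also have "\<dots> \<le> \<bar>C\<bar> * (\<bar>k'\<bar> * norm (v' - t\<^sup>2 *\<^sub>R u))"
      by (intro mult_left_mono mult_right_mono) auto
    finally show ?thesis
      using s k by (simp add: D_def field_simps)
  qed
  obtain S where "\<forall>w. (S w, w - t *\<^sub>R S w) \<in> T"
    using positive_selfadjoint_shift_inverse[OF T t] by (rule exE)
  then have S: "(S w, w - t *\<^sub>R S w) \<in> T" for w
    by blast
  have dbl: "(2 * t) *\<^sub>R x = t *\<^sub>R x + t *\<^sub>R x" for x :: 'h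
    by (simp only: mult_2 scaleR_add_left)
  have dbl': "(2 * t * t) *\<^sub>R x = (t * t) *\<^sub>R x + (t * t) *\<^sub>R x" for x :: 'h
    by (simp only: mult_2 distrib_right scaleR_add_left)
  \<comment> \<open>The operator 1 - 2 t S equals (T - t) S, so it sends \<open>x\<close> to the
    resolvent image of (T - t) x, whose norm is at most |(T - t) x| / t.\<close>
  have r: "t * norm (x - (2 * t) *\<^sub>R S x) \<le> norm (y - t *\<^sub>R x)" if "(x, y) \<in> T" for x y
  proof -
    have *: "(x - (2 * t) *\<^sub>R S x, y - (2 * t) *\<^sub>R (x - t *\<^sub>R S x)) \<in> T"
      by (intro linear_operator_diff lin that scaleT S)
    have "y - (2 * t) *\<^sub>R (x - t *\<^sub>R S x) + t *\<^sub>R (x - (2 * t) *\<^sub>R S x) = y - t *\<^sub>R x"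
      by (simp add: dbl dbl' scaleR_diff_right scaleR_add_right)
    then show ?thesis
      using positive_selfadjoint_shift_bound[OF T *, of t] t by (simp only: less_imp_le)
  qed
  have "norm x0 \<le> (7 + 16 * t\<^sup>2 * D) / t * norm (y0 - t *\<^sub>R x0)" if xy: "(x0, y0) \<in> T" for x0 y0
  proof -
    \<comment> \<open>\<open>x3\<close> is the threefold resolvent image of \<open>x0\<close>, and
      \<open>u\<close>, \<open>v\<close>, \<open>v'\<close>, \<open>v''\<close> are T, T^2, T^3, T^4
      applied to \<open>x3\<close>, computed from T S = 1 - t S.\<close>
    define x1 where "x1 = S x0"
    define x2 where "x2 = S x1"
    define x3 where "x3 = S x2"
    define u where "u = x2 - t *\<^sub>R x3"
    define v where "v = (x1 - t *\<^sub>R x2) - t *\<^sub>R u"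
    define v' where "v' = (x0 - t *\<^sub>R x1) - t *\<^sub>R (x1 - t *\<^sub>R x2) - t *\<^sub>R v"
    define v'' where "v'' = (y0 - t *\<^sub>R (x0 - t *\<^sub>R x1)) - t *\<^sub>R (x0 - t *\<^sub>R x1 - t *\<^sub>R (x1 - t *\<^sub>R x2)) - t *\<^sub>R v'"
    have S3: "(x3, u) \<in> T" and S2: "(x2, x1 - t *\<^sub>R x2) \<in> T" and S1: "(x1, x0 - t *\<^sub>R x1) \<in> T"
      using S unfolding u_def x3_def x2_def x1_def by blast+
    have uv: "(u, v) \<in> T"
      unfolding u_def v_def by (intro linear_operator_diff lin scaleT S2 S3[unfolded u_def])
    have vv': "(v, v') \<in> T"
      unfolding v_def v'_def by (intro linear_operator_diff lin scaleT S1 S2 uv[unfolded v_def])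
    have vv'': "(v', v'') \<in> T"
      unfolding v'_def v''_def by (intro linear_operator_diff lin scaleT xy S1 S2 vv'[unfolded v'_def])
    \<comment> \<open>\<open>r1\<close> is S (T - t) applied to \<open>x0\<close>, and
      \<open>r2\<close>, \<open>r3\<close> are its further resolvent images, so (T - t)
      \<open>x0\<close> controls all three.\<close>
    define r1 where "r1 = x0 - (2 * t) *\<^sub>R x1"
    define r2 where "r2 = x1 - (2 * t) *\<^sub>R x2"
    define r3 where "r3 = x2 - (2 * t) *\<^sub>R x3"
    have n1: "t * norm r1 \<le> norm (y0 - t *\<^sub>R x0)"
      using r[OF xy] unfolding r1_def x1_def .
    have n2: "t * norm r2 \<le> norm r1"
      using r[OF S1] unfolding r1_def r2_def x2_def by (simp add: dbl diff_diff_eq)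
    have n3: "t * norm r3 \<le> norm r2"
      using r[OF S2] unfolding r2_def r3_def x3_def by (simp add: dbl diff_diff_eq)
    have "t * (t * norm r3) \<le> t * norm r2"
      using n3 t by (intro mult_left_mono) auto
    then have n3': "t\<^sup>2 * norm r3 \<le> norm r1"
      using n2 by (simp add: power2_eq_square mult.assoc)
    \<comment> \<open>T (T^2 - t^2) S^3 \<open>x0\<close> reduces to T S \<open>r1\<close>, and T S
      = 1 - t S.\<close>
    have "v' - t\<^sup>2 *\<^sub>R u = r1 - t *\<^sub>R r2"
      unfolding v'_def v_def r1_def r2_def
      by (simp add: dbl power2_eq_square scaleR_diff_right scaleR_add_right)
    then have "norm (v' - t\<^sup>2 *\<^sub>R u) \<le> 2 * norm r1"
      using norm_triangle_ineq4[of r1 "t *\<^sub>R r2"] n2 t by simp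
    then have "D * norm (v' - t\<^sup>2 *\<^sub>R u) \<le> D * (2 * norm r1)"
      using D0 by (rule mult_left_mono)
    then have nu: "norm u \<le> D * (2 * norm r1)"
      using D[OF S3 uv vv' vv''] by simp
    \<comment> \<open>\<open>x0\<close> is rebuilt from small vectors: \<open>x0\<close> =
      \<open>r1\<close> + 2 t \<open>x1\<close>, \<open>x1\<close> = \<open>r2\<close> + 2 t
      \<open>x2\<close> and \<open>x2\<close> = 2 \<open>u\<close> - \<open>r3\<close>. The constant
      in the claim is 7 = 1 + 2 + 4 plus 16 t^2 \<open>D\<close> from the term with
      \<open>u\<close>.\<close>
    have "norm x0 \<le> norm r1 + 2 * t * norm x1" "norm x1 \<le> norm r2 + 2 * t * norm x2"
      using norm_triangle_ineq[of r1 "(2 * t) *\<^sub>R x1"] norm_triangle_ineq[of r2 "(2 * t) *\<^sub>R x2"] t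
      by (simp_all add: r1_def r2_def)
    moreover have "x2 = (u + u) - r3"
      by (simp add: u_def r3_def dbl)
    then have "norm x2 \<le> 2 * norm u + norm r3"
      using norm_triangle_ineq4[of "u + u" r3] norm_triangle_ineq[of u u] by simp
    ultimately have "norm x0 \<le> norm r1 + 2 * t * (norm r2 + 2 * t * (2 * norm u + norm r3))"
      using t by (smt (verit) mult_left_mono)
    also have "\<dots> = norm r1 + 2 * (t * norm r2) + 8 * t\<^sup>2 * norm u + 4 * (t\<^sup>2 * norm r3)"
      by (simp add: algebra_simps power2_eq_square)
    also have "\<dots> \<le> norm r1 + 2 * norm r1 + 8 * t\<^sup>2 * (D * (2 * norm r1)) + 4 * norm r1"
      using n2 n3' nu by (intro add_mono mult_left_mono) auto
    also have "\<dots> = (7 + 16 * t\<^sup>2 * D) * norm r1"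
      by (simp add: algebra_simps)
    also have "\<dots> \<le> (7 + 16 * t\<^sup>2 * D) * (norm (y0 - t *\<^sub>R x0) / t)"
      using n1 D0 t by (intro mult_left_mono) (auto simp: field_simps)
    finally show ?thesis
      by simp
  qed
  then show False
    using spec real_spectrum_iff[OF T, of t] by blast
qed

text \<open>Both squared norms are the pairing of \<open>x\<close> with \<open>v\<close>, once by
  the definition of the adjoint and once by symmetry of T.\<close>

lemma norm_modulus:
  assumes T: "positive_selfadjoint T" and "(x, u) \<in> T" "(u, v) \<in> T" "(x, y) \<in> z" "(y, v) \<in> adjoint_op z"
  shows "norm y = norm u"
proof -
  have "cinner y y = cinner x v"
    using assms(4,5) unfolding adjoint_op_def by blast
  also have "\<dots> = cinner u u"
    using positive_selfadjoint_symmetric[OF T assms(2,3)] by simp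
  finally have "(norm y)\<^sup>2 = (norm u)\<^sup>2"
    by (simp add: norm_eq_Re_cinner)
  then show ?thesis
    by simp
qed

text \<open>The same computation with the roles of z and its adjoint exchanged; the scalar q^2
  supplied by q-normality becomes the factor q.\<close>

lemma norm_modulus_adjoint:
  assumes T: "positive_selfadjoint T" and "(x, u) \<in> T" "(u, v) \<in> T" "(x, y) \<in> adjoint_op z"
    "(y, q\<^sup>2 *\<^sub>R v) \<in> z" and "0 \<le> q"
  shows "norm y = q * norm u"
proof -
  have "cinner y y = cinner (q\<^sup>2 *\<^sub>R v) x"
    using assms(4,5) unfolding adjoint_op_def by fastforce
  also have "\<dots> = q\<^sup>2 * cinner v x"
    by (simp add: cinner_scaleC_left flip: scaleC_of_real)
  also have "cinner v x = cinner u u"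
    using positive_selfadjoint_symmetric[OF T assms(3,2)] by simp
  finally have "(norm y)\<^sup>2 = (q * norm u)\<^sup>2"
    by (simp add: norm_eq_Re_cinner power_mult_distrib)
  then show ?thesis
    using assms(6) by simp
qed

lemma linear_operator_combine:
  assumes "linear_operator T" "(x, y) \<in> T" "(x', y') \<in> T"
  shows "(x - r *\<^sub>R x', y - r *\<^sub>R y') \<in> T"
  using linear_operator_diff[OF assms(1,2) linear_operator_scale[OF assms(1,3), of "complex_of_real r"]]
  by (simp add: scaleC_of_real)

lemma adjoint_op_combine:
  assumes "(x, y) \<in> adjoint_op T" "(x', y') \<in> adjoint_op T"
  shows "(x - r *\<^sub>R x', y - r *\<^sub>R y') \<in> adjoint_op T"
  using adjoint_op_diff[OF assms(1) adjoint_op_scale[OF assms(2), of "complex_of_real r"]]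
  by (simp add: scaleC_of_real)

text \<open>Composed relations record domains, so these equivalences also transfer domains: whether
  z and its adjoint can be applied to \<open>x\<close> one after the other, in either order, is
  decided by the domain of T^2.\<close>

lemma q_normal_relations:
  assumes "q_normal q z" "modulus_of z T"
  shows "(x, v) \<in> T O T \<longleftrightarrow> (\<exists>y. (x, y) \<in> z \<and> (y, v) \<in> adjoint_op z)"
    and "(x, w) \<in> adjoint_op z O z \<longleftrightarrow> (\<exists>v. (x, v) \<in> T O T \<and> w = q\<^sup>2 *\<^sub>R v)"
proof -
  have TT: "T O T = z O adjoint_op z"
    using assms(2) by (simp add: modulus_of_def)
  then show "(x, v) \<in> T O T \<longleftrightarrow> (\<exists>y. (x, y) \<in> z \<and> (y, v) \<in> adjoint_op z)"
    by blast
  have "adjoint_op z O z = scale_op (complex_of_real (q\<^sup>2)) (T O T)"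
    using assms(1) TT by (simp add: q_normal_def)
  also have "(x, w) \<in> \<dots> \<longleftrightarrow> (\<exists>v. (x, v) \<in> T O T \<and> w = q\<^sup>2 *\<^sub>R v)"
    unfolding scale_op_def scaleC_of_real by blast
  finally show "(x, w) \<in> adjoint_op z O z \<longleftrightarrow> (\<exists>v. (x, v) \<in> T O T \<and> w = q\<^sup>2 *\<^sub>R v)" .
qed

text \<open>For y = z x, q-normality gives T^2 y = q^(-2) z T^2 x, hence (T^2 - t^2 / q^2) y =
  q^(-2) z (T^2 - t^2) x. The norms are then computed by \<open>norm_modulus\<close>.\<close>

lemma q_normal_spectrum_divide:
  fixes z T :: "'h::complex_hilbert operator"
  assumes q: "0 < q" and z: "q_normal q z" and mod: "modulus_of z T"
    and t: "0 < t" "complex_of_real t \<in> op_spectrum T"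
  shows "complex_of_real (t / q) \<in> op_spectrum T"
proof (rule spectrum_transfer[where t = t and k = 1 and k' = "1 / q\<^sup>2"])
  show T: "positive_selfadjoint T"
    using mod by (simp add: modulus_of_def)
  note rel = q_normal_relations[OF z mod]
  have lz: "linear_operator z"
    using z by (simp add: q_normal_def)
  fix x u v v' v'' assume c: "(x, u) \<in> T" "(u, v) \<in> T" "(v, v') \<in> T" "(v', v'') \<in> T"
  then have "(x, v) \<in> T O T" "(v, v'') \<in> T O T"
    by blast+
  then obtain y g where y: "(x, y) \<in> z" "(y, v) \<in> adjoint_op z" and g: "(v, g) \<in> z" "(g, v'') \<in> adjoint_op z"
    using rel(1) by blast
  then obtain a b where b: "(y, a) \<in> T" "(a, b) \<in> T" "g = q\<^sup>2 *\<^sub>R b"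
    using rel(2) by blast
  have "norm (g - t\<^sup>2 *\<^sub>R y) = norm (v' - t\<^sup>2 *\<^sub>R u)"
    by (rule norm_modulus[OF T, where z = z and x = "v - t\<^sup>2 *\<^sub>R x" and v = "v'' - t\<^sup>2 *\<^sub>R v"])
      (intro linear_operator_combine adjoint_op_combine positive_selfadjoint_linear[OF T] lz c y g)+
  moreover have "b - (t / q)\<^sup>2 *\<^sub>R y = (1 / q\<^sup>2) *\<^sub>R (g - t\<^sup>2 *\<^sub>R y)"
    using q b by (simp add: scaleR_diff_right power_divide)
  ultimately have "norm (b - (t / q)\<^sup>2 *\<^sub>R y) = 1 / q\<^sup>2 * norm (v' - t\<^sup>2 *\<^sub>R u)"
    by simp
  moreover have "norm y = 1 * norm u"
    using norm_modulus[OF T c(1,2) y] by simp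
  ultimately show "\<exists>y a b. (y, a) \<in> T \<and> (a, b) \<in> T \<and> norm y = 1 * norm u \<and>
        norm (b - (t / q)\<^sup>2 *\<^sub>R y) = 1 / q\<^sup>2 * norm (v' - t\<^sup>2 *\<^sub>R u)"
    using b by blast
qed (use q t in auto)

text \<open>For y the image of x under the adjoint of z, T^2 y is q^2 times the image of T^2 x. With
  the factor q from \<open>norm_modulus_adjoint\<close> this makes q^3.\<close>

lemma q_normal_spectrum_mult:
  fixes z T :: "'h::complex_hilbert operator"
  assumes q: "0 < q" and z: "q_normal q z" and mod: "modulus_of z T"
    and t: "0 < t" "complex_of_real t \<in> op_spectrum T"
  shows "complex_of_real (q * t) \<in> op_spectrum T"
proof (rule spectrum_transfer[where t = t and k = q and k' = "q ^ 3"])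
  show T: "positive_selfadjoint T"
    using mod by (simp add: modulus_of_def)
  note rel = q_normal_relations[OF z mod]
  have lz: "linear_operator z"
    using z by (simp add: q_normal_def)
  fix x u v v' v'' assume c: "(x, u) \<in> T" "(u, v) \<in> T" "(v, v') \<in> T" "(v', v'') \<in> T"
  then have "(x, q\<^sup>2 *\<^sub>R v) \<in> adjoint_op z O z" "(v, q\<^sup>2 *\<^sub>R v'') \<in> adjoint_op z O z"
    using rel(2) by blast+
  then obtain y g where y: "(x, y) \<in> adjoint_op z" "(y, q\<^sup>2 *\<^sub>R v) \<in> z"
    and g: "(v, g) \<in> adjoint_op z" "(g, q\<^sup>2 *\<^sub>R v'') \<in> z"
    by blast
  have "(q\<^sup>2 *\<^sub>R v, q\<^sup>2 *\<^sub>R g) \<in> adjoint_op z"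
    using adjoint_op_scale[OF g(1), of "complex_of_real (q\<^sup>2)"] unfolding scaleC_of_real .
  then obtain a where b: "(y, a) \<in> T" "(a, q\<^sup>2 *\<^sub>R g) \<in> T"
    using rel(1) y by blast
  have "(g - t\<^sup>2 *\<^sub>R y, q\<^sup>2 *\<^sub>R v'' - t\<^sup>2 *\<^sub>R q\<^sup>2 *\<^sub>R v) \<in> z"
    by (intro linear_operator_combine lz y g)
  then have "(g - t\<^sup>2 *\<^sub>R y, q\<^sup>2 *\<^sub>R (v'' - t\<^sup>2 *\<^sub>R v)) \<in> z"
    by (simp add: scaleR_diff_right mult.commute)
  then have "norm (g - t\<^sup>2 *\<^sub>R y) = q * norm (v' - t\<^sup>2 *\<^sub>R u)"
    using q by (intro norm_modulus_adjoint[OF T, where z = z])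
      (auto intro: linear_operator_combine adjoint_op_combine positive_selfadjoint_linear[OF T] c y g)
  moreover have "q\<^sup>2 *\<^sub>R g - (q * t)\<^sup>2 *\<^sub>R y = q\<^sup>2 *\<^sub>R (g - t\<^sup>2 *\<^sub>R y)"
    by (simp add: scaleR_diff_right power_mult_distrib)
  ultimately have "norm (q\<^sup>2 *\<^sub>R g - (q * t)\<^sup>2 *\<^sub>R y) = q ^ 3 * norm (v' - t\<^sup>2 *\<^sub>R u)"
    by (simp add: power2_eq_square power3_eq_cube)
  moreover have "norm y = q * norm u"
    using norm_modulus_adjoint[OF T c(1,2) y] q by simp
  ultimately show "\<exists>y a b. (y, a) \<in> T \<and> (a, b) \<in> T \<and> norm y = q * norm u \<and>
        norm (b - (q * t)\<^sup>2 *\<^sub>R y) = q ^ 3 * norm (v' - t\<^sup>2 *\<^sub>R u)"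
    using b by blast
qed (use q t in auto)

lemma q_normal_spectrum_powi:
  fixes z T :: "'h::complex_hilbert operator"
  assumes q: "0 < q" and z: "q_normal q z" and mod: "modulus_of z T"
    and t: "complex_of_real t \<in> op_spectrum T"
  shows "complex_of_real (q powi k * t) \<in> op_spectrum T"
proof -
  have T: "positive_selfadjoint T"
    using mod by (simp add: modulus_of_def)
  have "0 \<le> t"
    by (rule positive_selfadjoint_spectrum_nonneg[OF T t])
  \<comment> \<open>The two transfer lemmas start from a positive spectral point; 0 is fixed by
    every dilation.\<close>
  then consider "t = 0" | "0 < t"
    by fastforce
  then show ?thesis
  proof cases
    case 2
    show ?thesis
    proof (induction k rule: int_induct[where k = 0])
      case (step1 i)
      have "q powi (i + 1) * t = q * (q powi i * t)"
        using q by (simp add: power_int_add)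
      then show ?case
        using q_normal_spectrum_mult[OF q z mod _ step1(2)] q 2 by (simp only: mult_pos_pos zero_less_power_int)
    next
      case (step2 i)
      have "q powi (i - 1) * t = (q powi i * t) / q"
        using q by (simp add: power_int_diff)
      then show ?case
        using q_normal_spectrum_divide[OF q z mod _ step2(2)] q 2 by (simp only: mult_pos_pos zero_less_power_int)
    qed (use t in simp)
  qed (use t in simp)
qed

section \<open>The Grothendieck group of a commutative monoid\<close>

lemma equiv_groth_rel:
  assumes "comm_monoid M"
  shows "equiv (carrier M \<times> carrier M) (groth_rel M)"
proof (rule equivI)
  interpret comm_monoid M by fact
  show "groth_rel M \<subseteq> (carrier M \<times> carrier M) \<times> carrier M \<times> carrier M"
    unfolding groth_rel_def by auto
  show "refl_on (carrier M \<times> carrier M) (groth_rel M)"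
    unfolding refl_on_def groth_rel_def by auto
  show "sym (groth_rel M)"
    by (rule symI) (auto simp: groth_rel_def intro: sym)
  show "trans (groth_rel M)"
  proof (rule transI)
    fix a b c assume ab: "(a, b) \<in> groth_rel M" and bc: "(b, c) \<in> groth_rel M"
    obtain x y x' y' x'' y'' where abc: "a = (x, y)" "b = (x', y')" "c = (x'', y'')"
      by (metis surj_pair)
    obtain e f where e: "e \<in> carrier M" "x \<otimes>\<^bsub>M\<^esub> y' \<otimes>\<^bsub>M\<^esub> e = x' \<otimes>\<^bsub>M\<^esub> y \<otimes>\<^bsub>M\<^esub> e"
      and f: "f \<in> carrier M" "x' \<otimes>\<^bsub>M\<^esub> y'' \<otimes>\<^bsub>M\<^esub> f = x'' \<otimes>\<^bsub>M\<^esub> y' \<otimes>\<^bsub>M\<^esub> f"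
      and c: "x \<in> carrier M" "y \<in> carrier M" "x' \<in> carrier M" "y' \<in> carrier M" "x'' \<in> carrier M" "y'' \<in> carrier M"
      using ab bc unfolding abc groth_rel_def by blast
    let ?e = "x' \<otimes>\<^bsub>M\<^esub> y' \<otimes>\<^bsub>M\<^esub> e \<otimes>\<^bsub>M\<^esub> f"
    have "x \<otimes>\<^bsub>M\<^esub> y'' \<otimes>\<^bsub>M\<^esub> ?e = (x \<otimes>\<^bsub>M\<^esub> y' \<otimes>\<^bsub>M\<^esub> e) \<otimes>\<^bsub>M\<^esub> (x' \<otimes>\<^bsub>M\<^esub> y'' \<otimes>\<^bsub>M\<^esub> f)"
      using e(1) f(1) c by (simp add: m_ac)
    also have "\<dots> = (x' \<otimes>\<^bsub>M\<^esub> y \<otimes>\<^bsub>M\<^esub> e) \<otimes>\<^bsub>M\<^esub> (x'' \<otimes>\<^bsub>M\<^esub> y' \<otimes>\<^bsub>M\<^esub> f)"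
      unfolding e(2) f(2) ..
    also have "\<dots> = x'' \<otimes>\<^bsub>M\<^esub> y \<otimes>\<^bsub>M\<^esub> ?e"
      using e(1) f(1) c by (simp add: m_ac)
    finally show "(a, c) \<in> groth_rel M"
      unfolding abc groth_rel_def using e(1) f(1) c by (auto intro!: bexI[of _ ?e])
  qed
qed

text \<open>The product of two witnesses is a witness for the sums, so addition respects
  \<open>groth_rel\<close> and the union in the definition collapses to one class.\<close>

lemma groth_class_mult:
  assumes M: "comm_monoid M"
    and c: "x \<in> carrier M" "y \<in> carrier M" "x' \<in> carrier M" "y' \<in> carrier M"
  shows "groth_rel M `` {(x, y)} \<otimes>\<^bsub>grothendieck_group M\<^esub> groth_rel M `` {(x', y')} =
    groth_rel M `` {(x \<otimes>\<^bsub>M\<^esub> x', y \<otimes>\<^bsub>M\<^esub> y')}"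
proof -
  interpret comm_monoid M by fact
  note eq = equiv_groth_rel[OF M]
  let ?f = "\<lambda>u w. groth_rel M `` {(fst u \<otimes>\<^bsub>M\<^esub> fst w, snd u \<otimes>\<^bsub>M\<^esub> snd w)}"
  have "congruent2 (groth_rel M) (groth_rel M) ?f"
  proof (rule congruent2I')
    fix a b a' b' assume 1: "(a, b) \<in> groth_rel M" and 2: "(a', b') \<in> groth_rel M"
    obtain x y z w where ab: "a = (x, y)" "b = (z, w)"
      by (metis surj_pair)
    obtain x' y' z' w' where ab': "a' = (x', y')" "b' = (z', w')"
      by (metis surj_pair)
    obtain e f where e: "e \<in> carrier M" "x \<otimes>\<^bsub>M\<^esub> w \<otimes>\<^bsub>M\<^esub> e = z \<otimes>\<^bsub>M\<^esub> y \<otimes>\<^bsub>M\<^esub> e"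
      and f: "f \<in> carrier M" "x' \<otimes>\<^bsub>M\<^esub> w' \<otimes>\<^bsub>M\<^esub> f = z' \<otimes>\<^bsub>M\<^esub> y' \<otimes>\<^bsub>M\<^esub> f"
      and c: "x \<in> carrier M" "y \<in> carrier M" "z \<in> carrier M" "w \<in> carrier M"
      "x' \<in> carrier M" "y' \<in> carrier M" "z' \<in> carrier M" "w' \<in> carrier M"
      using 1 2 unfolding ab ab' groth_rel_def by blast
    have "(x \<otimes>\<^bsub>M\<^esub> x') \<otimes>\<^bsub>M\<^esub> (w \<otimes>\<^bsub>M\<^esub> w') \<otimes>\<^bsub>M\<^esub> (e \<otimes>\<^bsub>M\<^esub> f) = (x \<otimes>\<^bsub>M\<^esub> w \<otimes>\<^bsub>M\<^esub> e) \<otimes>\<^bsub>M\<^esub> (x' \<otimes>\<^bsub>M\<^esub> w' \<otimes>\<^bsub>M\<^esub> f)"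
      using e(1) f(1) c by (simp add: m_ac)
    also have "\<dots> = (z \<otimes>\<^bsub>M\<^esub> y \<otimes>\<^bsub>M\<^esub> e) \<otimes>\<^bsub>M\<^esub> (z' \<otimes>\<^bsub>M\<^esub> y' \<otimes>\<^bsub>M\<^esub> f)"
      unfolding e(2) f(2) ..
    also have "\<dots> = (z \<otimes>\<^bsub>M\<^esub> z') \<otimes>\<^bsub>M\<^esub> (y \<otimes>\<^bsub>M\<^esub> y') \<otimes>\<^bsub>M\<^esub> (e \<otimes>\<^bsub>M\<^esub> f)"
      using e(1) f(1) c by (simp add: m_ac)
    finally have "((x \<otimes>\<^bsub>M\<^esub> x', y \<otimes>\<^bsub>M\<^esub> y'), (z \<otimes>\<^bsub>M\<^esub> z', w \<otimes>\<^bsub>M\<^esub> w')) \<in> groth_rel M"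
      unfolding groth_rel_def using e(1) f(1) c by (auto intro!: bexI[of _ "e \<otimes>\<^bsub>M\<^esub> f"])
    then show "?f a a' = ?f b b'"
      unfolding ab ab' fst_conv snd_conv by (rule equiv_class_eq[OF eq])
  qed
  from UN_equiv_class2[OF eq eq this, of "(x, y)" "(x', y')"] c show ?thesis
    by (simp add: grothendieck_group_def case_prod_unfold)
qed

lemma comm_group_grothendieck:
  assumes M: "comm_monoid M"
  shows "comm_group (grothendieck_group M)"
proof -
  interpret comm_monoid M by fact
  note eq = equiv_groth_rel[OF M]
  let ?G = "grothendieck_group M"
  have carr: "groth_rel M `` {(x, y)} \<in> carrier ?G" if "x \<in> carrier M" "y \<in> carrier M" for x y
    using that by (auto simp: grothendieck_group_def intro: quotientI)
  have carrE: "\<exists>x y. x \<in> carrier M \<and> y \<in> carrier M \<and> u = groth_rel M `` {(x, y)}" if "u \<in> carrier ?G" for u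
    using that by (auto simp: grothendieck_group_def elim!: quotientE)
  have one: "\<one>\<^bsub>?G\<^esub> = groth_rel M `` {(\<one>\<^bsub>M\<^esub>, \<one>\<^bsub>M\<^esub>)}"
    by (simp add: grothendieck_group_def)
  note gm = groth_class_mult[OF M]
  show ?thesis
  proof (rule comm_groupI)
    fix u w assume u: "u \<in> carrier ?G" and w: "w \<in> carrier ?G"
    then obtain x y x' y' where *: "x \<in> carrier M" "y \<in> carrier M" "u = groth_rel M `` {(x, y)}"
      "x' \<in> carrier M" "y' \<in> carrier M" "w = groth_rel M `` {(x', y')}"
      using carrE by meson
    show "u \<otimes>\<^bsub>?G\<^esub> w \<in> carrier ?G"
      by (simp add: * gm carr)
    show "u \<otimes>\<^bsub>?G\<^esub> w = w \<otimes>\<^bsub>?G\<^esub> u"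
      by (simp add: * gm m_comm)
    fix v assume "v \<in> carrier ?G"
    then obtain x'' y'' where "x'' \<in> carrier M" "y'' \<in> carrier M" "v = groth_rel M `` {(x'', y'')}"
      using carrE by meson
    with * show "u \<otimes>\<^bsub>?G\<^esub> w \<otimes>\<^bsub>?G\<^esub> v = u \<otimes>\<^bsub>?G\<^esub> (w \<otimes>\<^bsub>?G\<^esub> v)"
      by (simp add: gm m_assoc)
  next
    show "\<one>\<^bsub>?G\<^esub> \<in> carrier ?G"
      by (simp add: one carr)
    fix u assume "u \<in> carrier ?G"
    then obtain x y where *: "x \<in> carrier M" "y \<in> carrier M" "u = groth_rel M `` {(x, y)}"
      using carrE by meson
    show "\<one>\<^bsub>?G\<^esub> \<otimes>\<^bsub>?G\<^esub> u = u"
      by (simp add: * one gm)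
    \<comment> \<open>Swapping the entries of a pair gives the inverse.\<close>
    have "((y \<otimes>\<^bsub>M\<^esub> x, x \<otimes>\<^bsub>M\<^esub> y), (\<one>\<^bsub>M\<^esub>, \<one>\<^bsub>M\<^esub>)) \<in> groth_rel M"
      unfolding groth_rel_def using * by (auto simp: m_comm)
    then have "groth_rel M `` {(y, x)} \<otimes>\<^bsub>?G\<^esub> u = \<one>\<^bsub>?G\<^esub>"
      by (simp add: * one gm equiv_class_eq[OF eq])
    then show "\<exists>w\<in>carrier ?G. w \<otimes>\<^bsub>?G\<^esub> u = \<one>\<^bsub>?G\<^esub>"
      using carr * by blast
  qed
qed

section \<open>Projections and \<open>K\<^sub>0\<close>\<close>

lemma star_zero [simp]: "star (0 :: 'a::cstar_algebra_1) = 0"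
  using star_add[of "0 :: 'a" 0] by simp

lemma star_minus: "star (- x :: 'a::cstar_algebra_1) = - star x"
  using star_add[of x "- x"] by (simp add: eq_neg_iff_add_eq_0 add.commute)

lemma star_diff: "star (x - y :: 'a::cstar_algebra_1) = star x - star y"
  using star_add[of x "- y"] by (simp add: star_minus)

lemma star_one [simp]: "star (1 :: 'a::cstar_algebra_1) = 1"
  by (metis mult.left_neutral mult.right_neutral star_mult star_star)

lemma star_sum: "star (sum f A :: 'a::cstar_algebra_1) = (\<Sum>x\<in>A. star (f x))"
  by (induction A rule: infinite_finite_induct) (simp_all add: star_add)

lemma star_mult_self_eq_0: "star x * x = 0 \<Longrightarrow> x = (0 :: 'a::cstar_algebra_1)"
  using cstar_identity[of x] by simp

text \<open>The C*-identity and submultiplicativity give one inequality for every element; applied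
  to \<open>star x\<close> it gives the other.\<close>

lemma norm_star [simp]: "norm (star x) = norm (x :: 'a::cstar_algebra_1)"
proof -
  have "norm x \<le> norm (star x)" for x :: 'a
  proof (cases "x = 0")
    case False
    have "norm x * norm x \<le> norm (star x) * norm x"
      using cstar_identity[of x] norm_mult_ineq[of "star x" x] by (simp add: power2_eq_square)
    then show ?thesis
      using False by simp
  qed simp
  from this[of x] this[of "star x"] show ?thesis
    by (simp add: star_star)
qed

section \<open>Adjoints and direct sums of matrices over a C*-algebra\<close>

lemma star_mat_index [simp]:
  "i < dim_col A \<Longrightarrow> j < dim_row A \<Longrightarrow> star_mat A $$ (i, j) = star (A $$ (j, i))"
  "dim_row (star_mat A) = dim_col A" "dim_col (star_mat A) = dim_row A"
  by (simp_all add: star_mat_def)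

lemma star_mat_carrier: "A \<in> carrier_mat m n \<Longrightarrow> star_mat A \<in> carrier_mat n m"
  by (auto intro: carrier_matI)

lemma star_mat_star_mat [simp]: "star_mat (star_mat A) = (A :: 'a::cstar_algebra_1 mat)"
  by (rule eq_matI) (simp_all add: star_star)

lemma star_mat_mult:
  fixes A :: "'a::cstar_algebra_1 mat"
  assumes "dim_col A = dim_row B"
  shows "star_mat (A * B) = star_mat B * star_mat A"
  using assms by (intro eq_matI) (auto simp: scalar_prod_def star_sum star_mult)

lemma elements_mat_subset_iff:
  "elements_mat A \<subseteq> B \<longleftrightarrow> (\<forall>i<dim_row A. \<forall>j<dim_col A. A $$ (i, j) \<in> B)"
  by (simp add: elements_mat_def UN_subset_iff image_subset_iff Ball_def)

lemma dim_direct_sum [simp]: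
  "dim_row (direct_sum p p') = dim_row p + dim_row p'"
  "dim_col (direct_sum p p') = dim_col p + dim_col p'"
  by (simp_all add: direct_sum_def)

lemma direct_sum_assoc:
  "direct_sum p (direct_sum p' p'') = direct_sum (direct_sum p p') p''"
  using assoc_four_block_mat[of p p' p''] by (simp add: direct_sum_def)

lemma direct_sum_empty: "direct_sum (0\<^sub>m 0 0) p = p"
  by (rule eq_matI) (simp_all add: direct_sum_def)

lemma star_mat_direct_sum: 
  "star_mat (direct_sum p p') = direct_sum (star_mat p) (star_mat p' :: 'a::cstar_algebra_1 mat)"
  by (rule eq_matI) (auto simp: direct_sum_def)

lemma direct_sum_mult:
  fixes p p' r r' :: "'a::semiring_0 mat"
  assumes "dim_col p = dim_row r" "dim_col p' = dim_row r'"
  shows "direct_sum p p' * direct_sum r r' = direct_sum (p * r) (p' * r')"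
proof -
  have c: "p \<in> carrier_mat (dim_row p) (dim_col p)" "p' \<in> carrier_mat (dim_row p') (dim_col p')"
    "r \<in> carrier_mat (dim_col p) (dim_col r)" "r' \<in> carrier_mat (dim_col p') (dim_col r')"
    by (rule carrier_matI; simp add: assms)+
  have pr: "p * r \<in> carrier_mat (dim_row p) (dim_col r)" "p' * r' \<in> carrier_mat (dim_row p') (dim_col r')"
    by (rule mult_carrier_mat[OF c(1,3)], rule mult_carrier_mat[OF c(2,4)])
  let ?z = "\<lambda>m n. 0\<^sub>m m n :: 'a mat"
  have "direct_sum p p' * direct_sum r r' =
    four_block_mat p (?z (dim_row p) (dim_col p')) (?z (dim_row p') (dim_col p)) p' *
    four_block_mat r (?z (dim_col p) (dim_col r')) (?z (dim_col p') (dim_col r)) r'"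
    by (simp only: direct_sum_def assms)
  also have "\<dots> = four_block_mat
     (p * r + ?z (dim_row p) (dim_col p') * ?z (dim_col p') (dim_col r))
     (p * ?z (dim_col p) (dim_col r') + ?z (dim_row p) (dim_col p') * r')
     (?z (dim_row p') (dim_col p) * r + p' * ?z (dim_col p') (dim_col r))
     (?z (dim_row p') (dim_col p) * ?z (dim_col p) (dim_col r') + p' * r')"
    by (rule mult_four_block_mat[OF c(1) zero_carrier_mat zero_carrier_mat c(2) c(3) zero_carrier_mat zero_carrier_mat c(4)])
  also have "\<dots> = direct_sum (p * r) (p' * r')"
    unfolding direct_sum_def index_mult_mat
    by (simp only: right_mult_zero_mat[OF c(1)] right_mult_zero_mat[OF c(2)] left_mult_zero_mat[OF c(3)]
        left_mult_zero_mat[OF c(4)] right_add_zero_mat[OF pr(1)] left_add_zero_mat[OF pr(2)]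
        left_mult_zero_mat[OF zero_carrier_mat] left_add_zero_mat[OF zero_carrier_mat])
  finally show ?thesis .
qed

lemma elements_mat_direct_sum:
  assumes "0 \<in> B" "elements_mat p \<subseteq> B" "elements_mat p' \<subseteq> B"
  shows "elements_mat (direct_sum p p') \<subseteq> B"
  using assms by (auto simp: elements_mat_subset_iff direct_sum_def)

section \<open>Murray-von Neumann classes and their Grothendieck group\<close>

lemma mat_projectionsD:
  assumes "p \<in> mat_projections B"
  shows projection_dim: "p \<in> carrier_mat (dim_row p) (dim_row p)"
    and projection_elements: "elements_mat p \<subseteq> B"
    and projection_star: "star_mat p = p"
    and projection_mult: "p * p = p"
  using assms by (auto simp: mat_projections_def intro!: carrier_matI)

lemma mvn_relI:
  assumes "p \<in> mat_projections B" "p' \<in> mat_projections B" "v \<in> carrier_mat (dim_row p') (dim_row p)"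
    "elements_mat v \<subseteq> B" "star_mat v * v = p" "v * star_mat v = p'"
  shows "(p, p') \<in> mvn_rel B"
  using assms unfolding mvn_rel_def by blast

text \<open>What the matrix arguments use of the coefficient algebra;
  \<open>star_subring_unitized\<close> supplies it for the norm closure
  \<open>unitized_alg\<close>.\<close>

locale star_subring =
  fixes B :: "'a::cstar_algebra_1 set"
  assumes zero: "0 \<in> B" and one: "1 \<in> B"
    and add: "x \<in> B \<Longrightarrow> y \<in> B \<Longrightarrow> x + y \<in> B"
    and mult: "x \<in> B \<Longrightarrow> y \<in> B \<Longrightarrow> x * y \<in> B"
    and star: "x \<in> B \<Longrightarrow> star x \<in> B"
begin

lemma sum_closed: "(\<And>x. x \<in> A \<Longrightarrow> f x \<in> B) \<Longrightarrow> sum f A \<in> B"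
  by (induction A rule: infinite_finite_induct) (simp_all add: zero add)

lemma mat_mult_closed:
  assumes "elements_mat v \<subseteq> B" "elements_mat w \<subseteq> B" "dim_col v = dim_row w"
  shows "elements_mat (v * w) \<subseteq> B"
  using assms unfolding elements_mat_subset_iff
  by (auto simp: scalar_prod_def intro!: sum_closed mult)

lemma star_mat_closed: "elements_mat v \<subseteq> B \<Longrightarrow> elements_mat (star_mat v) \<subseteq> B"
  unfolding elements_mat_subset_iff by (auto intro: star)

lemma equiv_mvn_rel: "equiv (mat_projections B) (mvn_rel B)"
proof (rule equivI)
  show "mvn_rel B \<subseteq> mat_projections B \<times> mat_projections B"
    unfolding mvn_rel_def by auto
  show "refl_on (mat_projections B) (mvn_rel B)"
  proof (rule refl_onI)
    fix p assume p: "p \<in> mat_projections B"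
    note D = mat_projectionsD[OF p]
    show "(p, p) \<in> mvn_rel B"
      by (rule mvn_relI[OF p p D(1,2)]) (simp_all only: D(3,4))
  qed
  show "sym (mvn_rel B)"
  proof (rule symI)
    fix p p' assume "(p, p') \<in> mvn_rel B"
    then obtain v where v: "p \<in> mat_projections B" "p' \<in> mat_projections B"
      "v \<in> carrier_mat (dim_row p') (dim_row p)" "elements_mat v \<subseteq> B" "star_mat v * v = p" "v * star_mat v = p'"
      unfolding mvn_rel_def by blast
    show "(p', p) \<in> mvn_rel B"
      by (rule mvn_relI[OF v(2,1) star_mat_carrier[OF v(3)] star_mat_closed[OF v(4)]])
        (simp_all only: star_mat_star_mat v(5,6))
  qed
  show "trans (mvn_rel B)"
  proof (rule transI)
    fix p p' p'' assume "(p, p') \<in> mvn_rel B" "(p', p'') \<in> mvn_rel B"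
    then obtain v w where p: "p \<in> mat_projections B" "p' \<in> mat_projections B" "p'' \<in> mat_projections B"
      and v: "v \<in> carrier_mat (dim_row p') (dim_row p)" "elements_mat v \<subseteq> B" "star_mat v * v = p" "v * star_mat v = p'"
      and w: "w \<in> carrier_mat (dim_row p'') (dim_row p')" "elements_mat w \<subseteq> B" "star_mat w * w = p'" "w * star_mat w = p''"
      unfolding mvn_rel_def by blast
    note sv = star_mat_carrier[OF v(1)] and sw = star_mat_carrier[OF w(1)]
    note wv = mult_carrier_mat[OF w(1) v(1)]
    have svw: "star_mat (w * v) = star_mat v * star_mat w"
      using v(1) w(1) by (intro star_mat_mult) auto
    have "star_mat (w * v) * (w * v) = star_mat v * (star_mat w * (w * v))"
      unfolding svw by (rule assoc_mult_mat[OF sv sw wv])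
    also have "star_mat w * (w * v) = p' * v"
      using assoc_mult_mat[OF sw w(1) v(1)] w(3) by simp
    \<comment> \<open>Both sides are \<open>v * star_mat v * v\<close>, bracketed
      differently.\<close>
    also have "p' * v = v * p"
      using assoc_mult_mat[OF v(1) sv v(1)] v(3,4) by simp
    also have "star_mat v * (v * p) = p * p"
      using assoc_mult_mat[OF sv v(1) projection_dim[OF p(1)]] v(3) by simp
    also have "\<dots> = p"
      using p by (simp add: mat_projections_def)
    finally have 1: "star_mat (w * v) * (w * v) = p" .
    have "w * v * star_mat (w * v) = w * (v * (star_mat v * star_mat w))"
      unfolding svw by (rule assoc_mult_mat[OF w(1) v(1) mult_carrier_mat[OF sv sw]])
    also have "v * (star_mat v * star_mat w) = p' * star_mat w"
      using assoc_mult_mat[OF v(1) sv sw] v(4) by simp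
    also have "p' * star_mat w = star_mat w * p''"
      using assoc_mult_mat[OF sw w(1) sw] w(3,4) by simp
    also have "w * (star_mat w * p'') = p'' * p''"
      using assoc_mult_mat[OF w(1) sw projection_dim[OF p(3)]] w(4) by simp
    also have "\<dots> = p''"
      using p by (simp add: mat_projections_def)
    finally have 2: "w * v * star_mat (w * v) = p''" .
    show "(p, p'') \<in> mvn_rel B"
      by (rule mvn_relI[OF p(1,3) wv mat_mult_closed[OF w(2) v(2)] 1 2]) (use v(1) w(1) in auto)
  qed
qed

lemma direct_sum_projection:
  assumes "p \<in> mat_projections B" "p' \<in> mat_projections B"
  shows "direct_sum p p' \<in> mat_projections B"
  using assms unfolding mat_projections_def
  by (auto simp: direct_sum_mult star_mat_direct_sum dest: elements_mat_direct_sum[OF zero])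

lemma mvn_direct_sum:
  assumes "(p, p') \<in> mvn_rel B" "(r, r') \<in> mvn_rel B"
  shows "(direct_sum p r, direct_sum p' r') \<in> mvn_rel B"
proof -
  obtain v w where p: "p \<in> mat_projections B" "p' \<in> mat_projections B" "r \<in> mat_projections B" "r' \<in> mat_projections B"
    and v: "v \<in> carrier_mat (dim_row p') (dim_row p)" "elements_mat v \<subseteq> B" "star_mat v * v = p" "v * star_mat v = p'"
    and w: "w \<in> carrier_mat (dim_row r') (dim_row r)" "elements_mat w \<subseteq> B" "star_mat w * w = r" "w * star_mat w = r'"
    using assms unfolding mvn_rel_def by blast
  have c: "direct_sum v w \<in> carrier_mat (dim_row (direct_sum p' r')) (dim_row (direct_sum p r))"
    using v(1) w(1) by (auto intro!: carrier_matI)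
  show ?thesis
  proof (rule mvn_relI[OF direct_sum_projection[OF p(1,3)] direct_sum_projection[OF p(2,4)] c
        elements_mat_direct_sum[OF zero v(2) w(2)]])
    show "star_mat (direct_sum v w) * direct_sum v w = direct_sum p r"
      unfolding star_mat_direct_sum by (subst direct_sum_mult) (simp_all only: star_mat_index v(3) w(3))
    show "direct_sum v w * star_mat (direct_sum v w) = direct_sum p' r'"
      unfolding star_mat_direct_sum by (subst direct_sum_mult) (simp_all only: star_mat_index v(4) w(4))
  qed
qed

text \<open>The flip of the two summands, with the projections themselves in place of identity
  blocks: this gives a partial isometry with the right supports and with entries in
  \<open>B\<close>.\<close>

lemma mvn_direct_sum_commute:
  assumes p: "p \<in> mat_projections B" "p' \<in> mat_projections B"
  shows "(direct_sum p p', direct_sum p' p) \<in> mvn_rel B"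
proof -
  define n where "n = dim_row p"
  define m where "m = dim_row p'"
  have c: "p \<in> carrier_mat n n" "p' \<in> carrier_mat m m"
    using p projection_dim by (auto simp: n_def m_def)
  have pp: "p * p = p" "p' * p' = p'" "star_mat p = p" "star_mat p' = p'" "elements_mat p \<subseteq> B" "elements_mat p' \<subseteq> B"
    using p by (auto simp: mat_projections_def)
  let ?v = "four_block_mat (0\<^sub>m m n) p' p (0\<^sub>m n m)"
  let ?w = "four_block_mat (0\<^sub>m n m) p p' (0\<^sub>m m n)"
  have v: "?v \<in> carrier_mat (m + n) (n + m)"
    using c by auto
  have "star_mat ?v = four_block_mat (0\<^sub>m n m) (star_mat p) (star_mat p') (0\<^sub>m m n)"
    by (rule eq_matI) (use c in \<open>auto\<close>)
  then have sv: "star_mat ?v = ?w"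
    by (simp add: pp)
  have 1: "?w * ?v = direct_sum p p'"
    unfolding direct_sum_def using c
    by (subst mult_four_block_mat[of _ n m _ n _ m _ _ n _ m])
      (auto simp: pp)
  have 2: "?v * ?w = direct_sum p' p"
    unfolding direct_sum_def using c
    by (subst mult_four_block_mat[of _ m n _ m _ n _ _ m _ n])
      (auto simp: pp)
  have 3: "elements_mat ?v \<subseteq> B"
    using pp c zero by (auto simp: elements_mat_subset_iff)
  have "?v \<in> carrier_mat (dim_row (direct_sum p' p)) (dim_row (direct_sum p p'))"
    using v by (simp only: dim_direct_sum n_def m_def)
  then show ?thesis
    by (rule mvn_relI[OF direct_sum_projection[OF p] direct_sum_projection[OF p(2,1)] _ 3])
      (simp_all only: sv 1 2)
qed

lemma V_mult_class:
  assumes "p \<in> mat_projections B" "p' \<in> mat_projections B"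
  shows "mvn_rel B `` {p} \<otimes>\<^bsub>V_monoid B\<^esub> mvn_rel B `` {p'} = mvn_rel B `` {direct_sum p p'}"
proof -
  note eq = equiv_mvn_rel
  have "congruent2 (mvn_rel B) (mvn_rel B) (\<lambda>p p'. mvn_rel B `` {direct_sum p p'})"
    by (intro congruent2I' equiv_class_eq[OF eq] mvn_direct_sum)
  from UN_equiv_class2[OF eq eq this assms] show ?thesis
    by (simp add: V_monoid_def)
qed

lemma empty_projection: "0\<^sub>m 0 0 \<in> mat_projections B"
proof -
  have "star_mat (0\<^sub>m 0 0) = (0\<^sub>m 0 0 :: 'a mat)" "0\<^sub>m 0 0 * 0\<^sub>m 0 0 = (0\<^sub>m 0 0 :: 'a mat)"
    by (rule eq_matI; simp)+
  then show ?thesis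
    by (simp add: mat_projections_def elements_mat_subset_iff)
qed

lemma comm_monoid_V: "comm_monoid (V_monoid B)"
proof -
  have carr: "x \<in> carrier (V_monoid B) \<longleftrightarrow> (\<exists>p\<in>mat_projections B. x = mvn_rel B `` {p})" for x
    by (auto simp: V_monoid_def quotient_def)
  have one: "\<one>\<^bsub>V_monoid B\<^esub> = mvn_rel B `` {0\<^sub>m 0 0}"
    by (simp add: V_monoid_def)
  note * = V_mult_class direct_sum_projection direct_sum_assoc direct_sum_empty empty_projection
  show ?thesis
  proof (rule comm_monoidI)
    show "\<one>\<^bsub>V_monoid B\<^esub> \<in> carrier (V_monoid B)"
      unfolding carr one using empty_projection by blast
    fix x y assume "x \<in> carrier (V_monoid B)" "y \<in> carrier (V_monoid B)"
    then obtain p p' where p: "p \<in> mat_projections B" "p' \<in> mat_projections B"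
      "x = mvn_rel B `` {p}" "y = mvn_rel B `` {p'}"
      unfolding carr by blast
    show "x \<otimes>\<^bsub>V_monoid B\<^esub> y \<in> carrier (V_monoid B)"
      unfolding carr using p * by auto
    show "\<one>\<^bsub>V_monoid B\<^esub> \<otimes>\<^bsub>V_monoid B\<^esub> x = x"
      using p by (simp add: one *)
    show "x \<otimes>\<^bsub>V_monoid B\<^esub> y = y \<otimes>\<^bsub>V_monoid B\<^esub> x"
      using p by (simp add: * equiv_class_eq[OF equiv_mvn_rel mvn_direct_sum_commute])
    fix w assume "w \<in> carrier (V_monoid B)"
    then obtain p'' where "p'' \<in> mat_projections B" "w = mvn_rel B `` {p''}"
      unfolding carr by blast
    then show "x \<otimes>\<^bsub>V_monoid B\<^esub> y \<otimes>\<^bsub>V_monoid B\<^esub> w = x \<otimes>\<^bsub>V_monoid B\<^esub> (y \<otimes>\<^bsub>V_monoid B\<^esub> w)"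
      using p by (simp add: *)
  qed
qed

lemma comm_group_K0: "comm_group (K0_group B)"
  unfolding K0_group_def by (rule comm_group_grothendieck[OF comm_monoid_V])

lemma V_class_carrier: "p \<in> mat_projections B \<Longrightarrow> mvn_rel B `` {p} \<in> carrier (V_monoid B)"
  by (simp add: V_monoid_def quotientI)

lemma K0_class_carrier: "p \<in> mat_projections B \<Longrightarrow> K0_class B p \<in> carrier (K0_group B)"
  using V_class_carrier monoid.one_closed[OF comm_monoid.axioms(1)[OF comm_monoid_V]]
  by (auto simp: K0_class_def K0_group_def grothendieck_group_def intro!: quotientI)

lemma K0_class_direct_sum:
  assumes "p \<in> mat_projections B" "p' \<in> mat_projections B"
  shows "K0_class B (direct_sum p p') = K0_class B p \<otimes>\<^bsub>K0_group B\<^esub> K0_class B p'"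
proof -
  interpret comm_monoid "V_monoid B" by (rule comm_monoid_V)
  show ?thesis
    unfolding K0_class_def K0_group_def
    using assms by (simp add: groth_class_mult[OF comm_monoid_V] V_class_carrier V_mult_class)
qed

lemma K0_class_cong: "(p, p') \<in> mvn_rel B \<Longrightarrow> K0_class B p = K0_class B p'"
  unfolding K0_class_def using equiv_class_eq[OF equiv_mvn_rel] by metis

end

section \<open>Matrices of size one and two, and equivalences between them\<close>

lemma dim_mat_of_rows_list [simp]:
  "dim_row (mat_of_rows_list n xs) = length xs" "dim_col (mat_of_rows_list n xs) = n"
  by (simp_all add: mat_of_rows_list_def)

lemma mat1_mult: "mat1 x * mat1 y = mat1 (x * y :: 'a::semiring_0)"
  by (rule eq_matI) (auto simp: mat_of_rows_list_def scalar_prod_def)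

lemma star_mat_mat1: "star_mat (mat1 x) = mat1 (star x)"
  by (rule eq_matI) (auto simp: mat_of_rows_list_def star_mat_def)

lemma elements_mat1: "elements_mat (mat1 x) \<subseteq> B \<longleftrightarrow> x \<in> B"
  by (auto simp: elements_mat_subset_iff mat_of_rows_list_def)

lemma star_mat_column:
  "star_mat (mat_of_rows_list 1 [[x], [y]]) = mat_of_rows_list 2 [[star x, star y]]"
  by (rule eq_matI) (auto simp: mat_of_rows_list_def star_mat_def less_Suc_eq numeral_2_eq_2)

lemma row_mult_column:
  "mat_of_rows_list 2 [[x, y]] * mat_of_rows_list 1 [[x'], [y']] = mat1 (x * x' + y * y' :: 'a::semiring_0)"
  by (rule eq_matI) (auto simp: mat_of_rows_list_def scalar_prod_def less_Suc_eq numeral_2_eq_2)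

lemma column_mult_row:
  "mat_of_rows_list 1 [[x], [y]] * mat_of_rows_list 2 [[x', y']] =
    mat_of_rows_list 2 [[x * x', x * y'], [y * x', y * y' :: 'a::semiring_0]]"
  by (rule eq_matI) (auto simp: mat_of_rows_list_def scalar_prod_def less_Suc_eq numeral_2_eq_2)

lemma direct_sum_mat1: "direct_sum (mat1 x) (mat1 y) = mat_of_rows_list 2 [[x, 0], [0, y]]"
  by (rule eq_matI) (auto simp: direct_sum_def mat_of_rows_list_def less_Suc_eq numeral_2_eq_2)

lemma mat1_one: "mat1 (1 :: 'a::semiring_1) = 1\<^sub>m 1"
  by (rule eq_matI) (auto simp: mat_of_rows_list_def)

context star_subring
begin

lemma mat1_projection: "x \<in> B \<Longrightarrow> star x = x \<Longrightarrow> x * x = x \<Longrightarrow> mat1 x \<in> mat_projections B"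
  by (simp add: mat_projections_def mat1_mult star_mat_mat1 elements_mat1 del: One_nat_def)

text \<open>The C*-identity applied to \<open>w - w * p\<close> gives \<open>w * p = w\<close>;
  hence \<open>p'\<close> is idempotent too, and \<open>w\<close> implements the
  equivalence.\<close>

lemma K0_class_partial_isometry:
  assumes w: "w \<in> B" and p: "star w * w = p" "p * p = p" and p': "w * star w = p'"
  shows "mat1 p' \<in> mat_projections B" and "K0_class B (mat1 p) = K0_class B (mat1 p')"
proof -
  have sp: "star p = p" and sp': "star p' = p'"
    by (simp_all add: star_mult star_star flip: p(1) p')
  have "star (w - w * p) * (w - w * p) = p - p * p - (p * p - p * p * p)"
    by (simp add: star_diff star_mult star_star sp algebra_simps p(1)[symmetric])
  then have "w * p = w"
    using star_mult_self_eq_0[of "w - w * p"] by (simp add: p(2))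
  have "p' * p' = w * (star w * w) * star w"
    by (simp add: mult.assoc flip: p')
  then have pp': "p' * p' = p'"
    using \<open>w * p = w\<close> p(1) p' by simp
  have P: "mat1 p \<in> mat_projections B"
    using w p sp mult[OF star[OF w] w] by (intro mat1_projection) auto
  show P': "mat1 p' \<in> mat_projections B"
    using w p' sp' pp' mult[OF w star[OF w]] by (intro mat1_projection) auto
  have "(mat1 p, mat1 p') \<in> mvn_rel B"
    by (rule mvn_relI[OF P P', of "mat1 w"])
      (auto simp: mat1_mult star_mat_mat1 elements_mat1 w p p' simp del: One_nat_def intro!: carrier_matI)
  then show "K0_class B (mat1 p) = K0_class B (mat1 p')"
    by (rule K0_class_cong)
qed

text \<open>The column with entries \<open>x\<close> and \<open>y\<close> implements the equivalence
  of \<open>x + y\<close> with the diagonal matrix; its off-diagonal products vanish by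
  orthogonality.\<close>

lemma K0_class_orthogonal_sum:
  assumes x: "x \<in> B" "star x = x" "x * x = x" and y: "y \<in> B" "star y = y" "y * y = y"
    and xy: "x * y = 0"
  shows "K0_class B (mat1 (x + y)) = K0_class B (mat1 x) \<otimes>\<^bsub>K0_group B\<^esub> K0_class B (mat1 y)"
proof -
  have yx: "y * x = 0"
    using arg_cong[OF xy, of star] x y by (simp add: star_mult)
  have P: "mat1 (x + y) \<in> mat_projections B" "mat1 x \<in> mat_projections B" "mat1 y \<in> mat_projections B"
    using x y xy yx by (auto intro!: mat1_projection add simp: star_add algebra_simps simp del: One_nat_def)
  have "(mat1 (x + y), direct_sum (mat1 x) (mat1 y)) \<in> mvn_rel B"
  proof (rule mvn_relI[OF P(1) direct_sum_projection[OF P(2,3)], of "mat_of_rows_list 1 [[x], [y]]"])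
    show "elements_mat (mat_of_rows_list 1 [[x], [y]]) \<subseteq> B"
      using x y by (auto simp: elements_mat_subset_iff mat_of_rows_list_def less_Suc_eq)
  qed (auto simp: star_mat_column row_mult_column column_mult_row direct_sum_mat1 x y xy yx simp del: One_nat_def intro!: carrier_matI)
  then show ?thesis
    using K0_class_cong K0_class_direct_sum[OF P(2,3)] by metis
qed

text \<open>The isometries need not have entries in \<open>B\<close>.\<close>

lemma mvn_rel_isometries:
  assumes X: "X \<in> carrier_mat m k" "star_mat X * X = 1\<^sub>m k"
    and Y: "Y \<in> carrier_mat n k" "star_mat Y * Y = 1\<^sub>m k"
    and B: "elements_mat (Y * star_mat X) \<subseteq> B"
  shows "(X * star_mat X, Y * star_mat Y) \<in> mvn_rel B"
proof -
  note sX = star_mat_carrier[OF X(1)] and sY = star_mat_carrier[OF Y(1)]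
  define w where "w = Y * star_mat X"
  have w: "w \<in> carrier_mat n m"
    unfolding w_def by (rule mult_carrier_mat[OF Y(1) sX])
  have sw: "star_mat w = X * star_mat Y"
    unfolding w_def using X(1) Y(1) by (subst star_mat_mult) auto
  \<comment> \<open>The isometry relation cancels in the middle. Generality in the sizes and in the
    last factor lets this serve for both products of \<open>w\<close> with its adjoint and for the
    idempotence of both range projections.\<close>
  have mid: "(Y * star_mat X) * (X * star_mat Z) = Y * star_mat Z"
    if X: "X \<in> carrier_mat m k" "star_mat X * X = 1\<^sub>m k" and Y: "Y \<in> carrier_mat n k"
      and Z: "Z \<in> carrier_mat l k" for X Y Z and l m n :: nat
  proof -
    note sX = star_mat_carrier[OF X(1)] and sZ = star_mat_carrier[OF Z]
    have "(Y * star_mat X) * (X * star_mat Z) = Y * (star_mat X * (X * star_mat Z))"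
      by (rule assoc_mult_mat[OF Y sX mult_carrier_mat[OF X(1) sZ]])
    also have "star_mat X * (X * star_mat Z) = star_mat Z"
      using assoc_mult_mat[OF sX X(1) sZ] X(2) left_mult_one_mat[OF sZ] by simp
    finally show ?thesis .
  qed
  have 1: "star_mat w * w = X * star_mat X" and 2: "w * star_mat w = Y * star_mat Y"
    unfolding sw unfolding w_def by (rule mid[OF Y X(1) X(1)], rule mid[OF X Y(1) Y(1)])
  have proj: "Z * star_mat Z \<in> mat_projections B"
    if Z: "Z \<in> carrier_mat l k" "star_mat Z * Z = 1\<^sub>m k" and "elements_mat (Z * star_mat Z) \<subseteq> B" for Z and l
  proof -
    have "star_mat (Z * star_mat Z) = Z * star_mat Z"
      using Z(1) by (subst star_mat_mult) auto
    then show ?thesis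
      using that mid[OF Z Z(1) Z(1)] by (auto simp: mat_projections_def)
  qed
  have "elements_mat w \<subseteq> B"
    using B by (simp only: w_def)
  \<comment> \<open>That the entries lie in \<open>B\<close> is known through \<open>w\<close>,
    since this projection is \<open>star_mat w * w\<close>.\<close>
  have P: "X * star_mat X \<in> mat_projections B"
    by (rule proj[OF X], fold 1, rule mat_mult_closed[OF star_mat_closed])
      (use \<open>elements_mat w \<subseteq> B\<close> w in auto)
  have Q: "Y * star_mat Y \<in> mat_projections B"
    by (rule proj[OF Y], fold 2, rule mat_mult_closed[OF _ star_mat_closed])
      (use \<open>elements_mat w \<subseteq> B\<close> w in auto)
  show ?thesis
    by (rule mvn_relI[OF P Q _ \<open>elements_mat w \<subseteq> B\<close> 1 2]) (use w X(1) Y(1) in auto)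
qed

lemma K0_class_isometry_columns:
  assumes x: "star x * x + star x' * x' = 1" and y: "star y * y + star y' * y' = 1"
    and B: "y * star x \<in> B" "y * star x' \<in> B" "y' * star x \<in> B" "y' * star x' \<in> B"
  shows "K0_class B (mat_of_rows_list 2 [[x * star x, x * star x'], [x' * star x, x' * star x']]) =
    K0_class B (mat_of_rows_list 2 [[y * star y, y * star y'], [y' * star y, y' * star y']])"
proof -
  have "(mat_of_rows_list 1 [[x], [x']] * star_mat (mat_of_rows_list 1 [[x], [x']]),
    mat_of_rows_list 1 [[y], [y']] * star_mat (mat_of_rows_list 1 [[y], [y']])) \<in> mvn_rel B"
  proof (rule mvn_rel_isometries)
    show "elements_mat (mat_of_rows_list 1 [[y], [y']] * star_mat (mat_of_rows_list 1 [[x], [x']])) \<subseteq> B"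
      unfolding star_mat_column column_mult_row
      using B by (auto simp: elements_mat_subset_iff mat_of_rows_list_def less_Suc_eq numeral_2_eq_2)
  qed (auto simp: star_mat_column row_mult_column x y mat1_one simp del: One_nat_def intro!: carrier_matI)
  then show ?thesis
    unfolding star_mat_column column_mult_row by (rule K0_class_cong)
qed

lemma K0_class_diagonal:
  assumes "mat1 x \<in> mat_projections B" "mat1 y \<in> mat_projections B"
  shows "K0_class B (mat_of_rows_list 2 [[x, 0], [0, y]]) = K0_class B (mat1 x) \<otimes>\<^bsub>K0_group B\<^esub> K0_class B (mat1 y)"
  using K0_class_direct_sum[OF assms] by (simp only: direct_sum_mat1)

end

section \<open>The dilation crossed product\<close>

text \<open>The function that \<open>fn_elt\<close> places in degree 0, here made available for all
  powers of U; it is 0 off the compactification, as \<open>cont_fun\<close> demands.\<close>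

definition lift_fun :: "real set \<Rightarrow> real \<Rightarrow> (real \<Rightarrow> real) \<Rightarrow> real option \<Rightarrow> complex" where
  "lift_fun X c F = (\<lambda>x. case x of None \<Rightarrow> complex_of_real c
     | Some t \<Rightarrow> if t \<in> X then complex_of_real (F t) else 0)"

text \<open>The condition under which \<open>lift_fun\<close> is shown to be continuous on the
  compactification. The filter is the trace of \<open>at_top\<close> on \<open>X\<close>; for
  bounded \<open>X\<close> it is trivial, in accordance with infinity being isolated then.\<close>

definition cont_at_infty :: "real set \<Rightarrow> real \<Rightarrow> (real \<Rightarrow> real) \<Rightarrow> bool" where
  "cont_at_infty X c F \<longleftrightarrow> continuous_on X F \<and> (F \<longlongrightarrow> c) (inf at_top (principal X))"

lemma topspace_Xinf [simp]: "topspace (Xinf X) = insert None (Some ` X)"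
  by (simp add: Xinf_def)

lemma openin_XinfI:
  assumes "openin (top_of_set X) {t \<in> X. Some t \<in> V}"
    and "None \<in> V \<Longrightarrow> compact {t \<in> X. Some t \<notin> V}"
    and "V \<subseteq> insert None (Some ` X)"
  shows "openin (Xinf X) V"
proof (cases "None \<in> V")
  case True
  let ?C = "{t \<in> X. Some t \<notin> V}"
  have "compactin (top_of_set X) ?C" "closedin (top_of_set X) ?C"
    using assms(2)[OF True] by (auto simp: compactin_subtopology intro!: closed_subset compact_imp_closed)
  moreover have "V = insert None (Some ` (topspace (top_of_set X) - ?C))"
    using True assms(3) by auto
  ultimately show ?thesis
    unfolding Xinf_def openin_Alexandroff_compactification by blast
next
  case False
  then have "V = Some ` {t \<in> X. Some t \<in> V}"
    using assms(3) by auto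
  then show ?thesis
    unfolding Xinf_def openin_Alexandroff_compactification using assms(1) by blast
qed

lemma openin_XinfD:
  assumes "openin (Xinf X) V"
  shows "openin (top_of_set X) {t \<in> X. Some t \<in> V}"
    and "None \<in> V \<Longrightarrow> compact {t \<in> X. Some t \<notin> V}"
proof -
  consider U where "openin (top_of_set X) U" "V = Some ` U"
    | C where "compactin (top_of_set X) C" "closedin (top_of_set X) C" "V = insert None (Some ` (X - C))"
    using assms unfolding Xinf_def openin_Alexandroff_compactification by auto
  then have "openin (top_of_set X) {t \<in> X. Some t \<in> V} \<and> (None \<in> V \<longrightarrow> compact {t \<in> X. Some t \<notin> V})"
  proof cases
    case 1
    then have "{t \<in> X. Some t \<in> V} = U"
      using openin_subset[OF 1(1)] by auto
    then show ?thesis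
      using 1 by auto
  next
    case 2
    then have "C \<subseteq> X" "compact C"
      by (auto simp: compactin_subtopology)
    then have "{t \<in> X. Some t \<in> V} = X - C" "{t \<in> X. Some t \<notin> V} = C"
      using 2 by auto
    then show ?thesis
      using 2 \<open>compact C\<close> by (metis openin_diff openin_subtopology_self topspace_euclidean_subtopology openin_topspace)
  qed
  then show "openin (top_of_set X) {t \<in> X. Some t \<in> V}" "None \<in> V \<Longrightarrow> compact {t \<in> X. Some t \<notin> V}"
    by blast+
qed

lemma lift_fun_cont_fun:
  assumes X: "closed X" "X \<subseteq> {0..}" and F: "cont_at_infty X c F"
  shows "lift_fun X c F \<in> cont_fun (Xinf X)"
proof -
  have cF: "continuous_on X (\<lambda>t. complex_of_real (F t))"
    using F by (auto simp: cont_at_infty_def intro!: continuous_intros)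
  have "openin (Xinf X) {x \<in> topspace (Xinf X). lift_fun X c F x \<in> U}" (is "openin _ ?V") if U: "open U" for U
  proof (rule openin_XinfI)
    have "{t \<in> X. Some t \<in> ?V} = X \<inter> (\<lambda>t. complex_of_real (F t)) -` U"
      by (auto simp: lift_fun_def)
    then show "openin (top_of_set X) {t \<in> X. Some t \<in> ?V}"
      using continuous_openin_preimage_gen[OF cF U] by simp
    show "?V \<subseteq> insert None (Some ` X)"
      by auto
    assume "None \<in> ?V"
    then have c: "complex_of_real c \<in> U"
      by (simp add: lift_fun_def)
    have eq: "{t \<in> X. Some t \<notin> ?V} = X \<inter> (\<lambda>t. complex_of_real (F t)) -` (- U)" (is "?C = _")
      by (auto simp: lift_fun_def)
    have "closed ?C"
      unfolding eq using cF X(1) U by (intro continuous_closed_preimage) auto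
    have "((\<lambda>t. complex_of_real (F t)) \<longlongrightarrow> complex_of_real c) (inf at_top (principal X))"
      using F by (auto simp: cont_at_infty_def intro!: tendsto_of_real)
    then have "\<forall>\<^sub>F t in inf at_top (principal X). complex_of_real (F t) \<in> U"
      using U c by (rule topological_tendstoD)
    \<comment> \<open>Beyond \<open>M\<close> all values lie in \<open>U\<close>, so the part of
      \<open>X\<close> outside the preimage is confined to [0, \<open>M\<close>]; being closed as
      well, it is compact.\<close>
    then obtain M where M: "\<And>t. M \<le> t \<Longrightarrow> t \<in> X \<Longrightarrow> complex_of_real (F t) \<in> U"
      by (auto simp: eventually_inf_principal eventually_at_top_linorder)
    have "?C \<subseteq> {0..M}"
    proof
      fix t assume "t \<in> ?C"
      then have "t \<in> X" "\<not> M \<le> t"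
        unfolding eq using M[of t] by auto
      then show "t \<in> {0..M}"
        using X(2) by auto
    qed
    then have "bounded ?C"
      using bounded_subset[OF bounded_closed_interval] by blast
    with \<open>closed ?C\<close> show "compact ?C"
      by (simp only: compact_eq_bounded_closed)
  qed
  then show ?thesis
    unfolding cont_fun_def continuous_map_def by (auto simp: lift_fun_def split: option.split)
qed

section \<open>Finite sums and the closure of their images\<close>

lemma lau_algD:
  assumes "a \<in> lau_alg K"
  shows lau_alg_finite: "finite {k. a k \<noteq> (\<lambda>x. 0)}" and lau_alg_coeff: "a k \<in> cont_fun K"
  using assms by (auto simp: lau_alg_def)

lemma lau_monom_alg:
  assumes "f \<in> cont_fun K"
  shows "lau_monom k f \<in> lau_alg K"
proof -
  have "{j. lau_monom k f j \<noteq> (\<lambda>x. 0)} \<subseteq> {k}"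
    by (auto simp: lau_monom_def)
  then have "finite {j. lau_monom k f j \<noteq> (\<lambda>x. 0)}"
    by (rule finite_subset) simp
  moreover have "(\<lambda>x. 0) \<in> cont_fun K"
    by (simp add: cont_fun_def)
  ultimately have "lau_monom k f j \<in> cont_fun K" for j
    using assms by (cases "j = k") (simp_all add: lau_monom_def)
  with \<open>finite _\<close> show ?thesis
    unfolding lau_alg_def by simp
qed

lemma lau_mult_monom:
  "lau_mult \<theta> (lau_monom k f) (lau_monom l g) = lau_monom (k + l) (\<lambda>x. f x * g (\<theta> k x))"
proof -
  \<comment> \<open>The sum in \<open>lau_mult\<close> runs over the support of the left factor,
    which is empty if \<open>f\<close> is identically zero.\<close>
  have "{j. lau_monom k f j \<noteq> (\<lambda>x. 0)} = (if f = (\<lambda>x. 0) then {} else {k})"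
    by (auto simp: lau_monom_def fun_eq_iff)
  then show ?thesis
    unfolding lau_mult_def by (auto simp: lau_monom_def fun_eq_iff)
qed

lemma lau_star_monom: "lau_star \<theta> (lau_monom k f) = lau_monom (- k) (\<lambda>x. cnj (f (\<theta> (- k) x)))"
  by (auto simp: lau_star_def lau_monom_def fun_eq_iff)

lemma lau_add_monom: "lau_add (lau_monom k f) (lau_monom k g) = lau_monom k (\<lambda>x. f x + g x)"
  by (auto simp: lau_add_def lau_monom_def fun_eq_iff)

lemma star_subring_closure:
  fixes S :: "'a::cstar_algebra_1 set"
  assumes "0 \<in> S" "1 \<in> S" and add: "\<And>x y. x \<in> S \<Longrightarrow> y \<in> S \<Longrightarrow> x + y \<in> S"
    and mult: "\<And>x y. x \<in> S \<Longrightarrow> y \<in> S \<Longrightarrow> x * y \<in> S" and star: "\<And>x. x \<in> S \<Longrightarrow> star x \<in> S"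
  shows "star_subring (closure S)"
proof
  show "0 \<in> closure S" "1 \<in> closure S"
    using assms(1,2) by (auto intro: subsetD[OF closure_subset])
  fix x assume "x \<in> closure S"
  then obtain s where s: "\<And>n. s n \<in> S" "s \<longlonglongrightarrow> x"
    unfolding closure_sequential by auto
  have "(\<lambda>n. star (s n)) \<longlonglongrightarrow> star x"
    using s(2) unfolding tendsto_iff dist_norm by (simp only: norm_star flip: star_diff)
  then show "star x \<in> closure S"
    unfolding closure_sequential using star[OF s(1)] by (intro exI[of _ "\<lambda>n. star (s n)"] conjI allI)
  fix y assume "y \<in> closure S"
  then obtain r where r: "\<And>n. r n \<in> S" "r \<longlonglongrightarrow> y"
    unfolding closure_sequential by auto
  show "x + y \<in> closure S"
    unfolding closure_sequential using add[OF s(1) r(1)] tendsto_add[OF s(2) r(2)]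
    by (intro exI[of _ "\<lambda>n. s n + r n"] conjI allI)
  show "x * y \<in> closure S"
    unfolding closure_sequential using mult[OF s(1) r(1)] tendsto_mult[OF s(2) r(2)]
    by (intro exI[of _ "\<lambda>n. s n * r n"] conjI allI)
qed

text \<open>Invariance is required for all integer powers, so that every dilation is a homeomorphism
  of \<open>X\<close>.\<close>

locale dilation_product =
  fixes q :: real and X :: "real set" and \<iota> :: "real option laurent \<Rightarrow> 'a::cstar_algebra_1"
  assumes q_pos: "0 < q" and closed_X: "closed X" and X_nonneg: "X \<subseteq> {0..}"
    and X_inv: "t \<in> X \<Longrightarrow> q powi k * t \<in> X"
    and enveloping: "enveloping_map (Xinf X) (dilation q) \<iota>"
begin

lemma powi_inverse [simp]: "q powi k * (q powi (- k) * t) = t" "q powi (- k) * (q powi k * t) = t"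
  using q_pos by (simp_all add: power_int_minus)

lemma X_inv_iff [simp]: "q powi k * t \<in> X \<longleftrightarrow> t \<in> X"
  using X_inv[of t k] X_inv[of "q powi k * t" "- k"] by auto

lemma continuous_map_dilation: "continuous_map (Xinf X) (Xinf X) (dilation q k)"
proof -
  have "openin (Xinf X) {x \<in> topspace (Xinf X). dilation q k x \<in> V}" (is "openin _ ?W")
    if V: "openin (Xinf X) V" for V
  proof (rule openin_XinfI)
    have "openin (top_of_set X) (X \<inter> (\<lambda>t. q powi k * t) -` {t \<in> X. Some t \<in> V})"
      by (rule continuous_openin_preimage[OF _ _ openin_XinfD(1)[OF V]]) (auto intro!: continuous_intros)
    moreover have "{t \<in> X. Some t \<in> ?W} = X \<inter> (\<lambda>t. q powi k * t) -` {t \<in> X. Some t \<in> V}"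
      by (auto simp: dilation_def)
    ultimately show "openin (top_of_set X) {t \<in> X. Some t \<in> ?W}"
      by simp
    show "?W \<subseteq> insert None (Some ` X)"
      by auto
    assume "None \<in> ?W"
    \<comment> \<open>The complement of the preimage is the image of the complement of
      \<open>V\<close> under the inverse dilation, so it inherits compactness.\<close>
    then have "compact ((\<lambda>t. q powi (- k) * t) ` {t \<in> X. Some t \<notin> V})"
      using openin_XinfD(2)[OF V] by (intro compact_continuous_image continuous_intros) (auto simp: dilation_def)
    moreover have "{t \<in> X. Some t \<notin> ?W} = (\<lambda>t. q powi (- k) * t) ` {t \<in> X. Some t \<notin> V}"
      by (auto simp: dilation_def image_iff) (metis X_inv_iff powi_inverse(2))
    ultimately show "compact {t \<in> X. Some t \<notin> ?W}"
      by simp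
  qed
  then show ?thesis
    unfolding continuous_map_def by (auto simp: dilation_def)
qed

lemma dilation_in_topspace [simp]: "dilation q k x \<in> topspace (Xinf X) \<longleftrightarrow> x \<in> topspace (Xinf X)"
  by (cases x) (auto simp: dilation_def)

lemma cont_fun_closed:
  assumes "f \<in> cont_fun (Xinf X)"
  shows cont_fun_dilation: "(\<lambda>x. f (dilation q k x)) \<in> cont_fun (Xinf X)"
    and cont_fun_cnj: "(\<lambda>x. cnj (f x)) \<in> cont_fun (Xinf X)"
    and cont_fun_add: "g \<in> cont_fun (Xinf X) \<Longrightarrow> (\<lambda>x. f x + g x) \<in> cont_fun (Xinf X)"
    and cont_fun_mult: "g \<in> cont_fun (Xinf X) \<Longrightarrow> (\<lambda>x. f x * g x) \<in> cont_fun (Xinf X)"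
proof -
  have f: "continuous_map (Xinf X) euclidean f" "\<And>x. x \<notin> topspace (Xinf X) \<Longrightarrow> f x = 0"
    using assms by (auto simp: cont_fun_def)
  have "f (dilation q k x) = 0" if "x \<notin> topspace (Xinf X)" for x
    using f(2)[of "dilation q k x"] that dilation_in_topspace by blast
  then show "(\<lambda>x. f (dilation q k x)) \<in> cont_fun (Xinf X)"
    unfolding cont_fun_def using continuous_map_compose[OF continuous_map_dilation f(1), of k]
    by (auto simp: o_def)
  have "continuous_map euclidean euclidean cnj"
    by (simp add: continuous_on_cnj)
  from continuous_map_compose[OF f(1) this] f(2) show "(\<lambda>x. cnj (f x)) \<in> cont_fun (Xinf X)"
    unfolding cont_fun_def by (auto simp: o_def)
  assume "g \<in> cont_fun (Xinf X)"
  then have g: "continuous_map (Xinf X) euclidean g"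
    by (auto simp: cont_fun_def)
  have fg: "continuous_map (Xinf X) euclidean (\<lambda>x. (f x, g x))"
    using continuous_map_pairedI[OF f(1) g] by (simp add: euclidean_product_topology)
  have op: "continuous_map euclidean euclidean (\<lambda>(x :: complex, y). x * y)"
    "continuous_map euclidean euclidean (\<lambda>(x :: complex, y). x + y)"
    by (auto simp: case_prod_unfold intro!: continuous_intros)
  have "continuous_map (Xinf X) euclidean (\<lambda>x. f x * g x)" "continuous_map (Xinf X) euclidean (\<lambda>x. f x + g x)"
    using continuous_map_compose[OF fg op(1)] continuous_map_compose[OF fg op(2)] by (simp_all add: o_def)
  then show "(\<lambda>x. f x + g x) \<in> cont_fun (Xinf X)" "(\<lambda>x. f x * g x) \<in> cont_fun (Xinf X)"
    using f(2) \<open>g \<in> _\<close> unfolding cont_fun_def by auto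
qed

lemma cont_fun_sum:
  assumes "\<And>k. k \<in> A \<Longrightarrow> f k \<in> cont_fun (Xinf X)"
  shows "(\<lambda>x. \<Sum>k\<in>A. f k x) \<in> cont_fun (Xinf X)"
  using assms
proof (induction A rule: infinite_finite_induct)
  case (insert k A)
  then have "(\<lambda>x. f k x + (\<Sum>k\<in>A. f k x)) \<in> cont_fun (Xinf X)"
    by (intro cont_fun_add) auto
  then show ?case
    using insert by simp
qed (simp_all add: cont_fun_def)

lemma lau_add_alg:
  assumes a: "a \<in> lau_alg (Xinf X)" and b: "b \<in> lau_alg (Xinf X)"
  shows "lau_add a b \<in> lau_alg (Xinf X)"
proof -
  have "{k. lau_add a b k \<noteq> (\<lambda>x. 0)} \<subseteq> {k. a k \<noteq> (\<lambda>x. 0)} \<union> {k. b k \<noteq> (\<lambda>x. 0)}"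
    by (auto simp: lau_add_def)
  then have "finite {k. lau_add a b k \<noteq> (\<lambda>x. 0)}"
    using lau_alg_finite[OF a] lau_alg_finite[OF b] finite_subset by blast
  then show ?thesis
    using cont_fun_add[OF lau_alg_coeff[OF a] lau_alg_coeff[OF b]]
    unfolding lau_alg_def by (simp add: lau_add_def)
qed

lemma lau_star_alg:
  assumes a: "a \<in> lau_alg (Xinf X)"
  shows "lau_star (dilation q) a \<in> lau_alg (Xinf X)"
proof -
  have "{k. lau_star (dilation q) a k \<noteq> (\<lambda>x. 0)} \<subseteq> uminus ` {k. a k \<noteq> (\<lambda>x. 0)}"
  proof
    fix k assume "k \<in> {k. lau_star (dilation q) a k \<noteq> (\<lambda>x. 0)}"
    then have "a (- k) \<noteq> (\<lambda>x. 0)"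
      by (auto simp: lau_star_def)
    then show "k \<in> uminus ` {k. a k \<noteq> (\<lambda>x. 0)}"
      by (intro image_eqI[of _ _ "- k"]) auto
  qed
  then have "finite {k. lau_star (dilation q) a k \<noteq> (\<lambda>x. 0)}"
    using lau_alg_finite[OF a] finite_subset by blast
  then show ?thesis
    using cont_fun_cnj[OF cont_fun_dilation[OF lau_alg_coeff[OF a]]]
    unfolding lau_alg_def by (simp add: lau_star_def)
qed

lemma lau_mult_alg:
  assumes a: "a \<in> lau_alg (Xinf X)" and b: "b \<in> lau_alg (Xinf X)"
  shows "lau_mult (dilation q) a b \<in> lau_alg (Xinf X)"
proof -
  let ?A = "{k. a k \<noteq> (\<lambda>x. 0)}" and ?B = "{k. b k \<noteq> (\<lambda>x. 0)}"
  have "{k. lau_mult (dilation q) a b k \<noteq> (\<lambda>x. 0)} \<subseteq> (\<lambda>(i, j). i + j) ` (?A \<times> ?B)"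
  proof
    fix m assume "m \<in> {k. lau_mult (dilation q) a b k \<noteq> (\<lambda>x. 0)}"
    then obtain x where "(\<Sum>k\<in>?A. a k x * b (m - k) (dilation q k x)) \<noteq> 0"
      by (auto simp: lau_mult_def fun_eq_iff)
    then obtain k where "k \<in> ?A" "a k x * b (m - k) (dilation q k x) \<noteq> 0"
      by (meson sum.neutral)
    then show "m \<in> (\<lambda>(i, j). i + j) ` (?A \<times> ?B)"
      by (intro image_eqI[of _ _ "(k, m - k)"]) auto
  qed
  then have "finite {k. lau_mult (dilation q) a b k \<noteq> (\<lambda>x. 0)}"
    using lau_alg_finite[OF a] lau_alg_finite[OF b] finite_subset by blast
  moreover have "lau_mult (dilation q) a b m \<in> cont_fun (Xinf X)" for m
    unfolding lau_mult_def
    by (intro cont_fun_sum cont_fun_mult cont_fun_dilation lau_alg_coeff[OF a] lau_alg_coeff[OF b])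
  ultimately show ?thesis
    unfolding lau_alg_def by simp
qed

lemma enveloping_hom:
  assumes a: "a \<in> lau_alg (Xinf X)"
  shows "\<iota> (lau_star (dilation q) a) = star (\<iota> a)"
    and "b \<in> lau_alg (Xinf X) \<Longrightarrow> \<iota> (lau_add a b) = \<iota> a + \<iota> b"
    and "b \<in> lau_alg (Xinf X) \<Longrightarrow> \<iota> (lau_mult (dilation q) a b) = \<iota> a * \<iota> b"
  using enveloping a unfolding enveloping_map_def by blast+

abbreviation vanishing :: "real option laurent set" where
  "vanishing \<equiv> {a \<in> lau_alg (Xinf X). \<forall>k. k \<noteq> 0 \<longrightarrow> a k (Some 0) = 0 \<and> a k None = 0}"

text \<open>Dilations fix 0 and infinity, so at these points the product is an ordinary convolution;
  in degree \<open>m\<close> \<noteq> 0 each summand has a factor of nonzero degree, which vanishes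
  there.\<close>

lemma lau_mult_vanishing:
  assumes a: "a \<in> vanishing" and b: "b \<in> vanishing"
  shows "lau_mult (dilation q) a b \<in> vanishing"
proof -
  have "lau_mult (dilation q) a b m x = 0" if "m \<noteq> 0" "x \<in> {None, Some 0}" for m x
  proof -
    have x: "dilation q k x = x" for k
      using that by (auto simp: dilation_def)
    have "a k x * b (m - k) x = 0" for k
    proof (cases "k = 0")
      case True
      then show ?thesis
        using b that by auto
    next
      case False
      then show ?thesis
        using a that by auto
    qed
    then show ?thesis
      unfolding lau_mult_def x by (simp only: sum.neutral_const)
  qed
  then show ?thesis
    using lau_mult_alg a b by auto
qed

lemma star_subring_unitized: "star_subring (unitized_alg X \<iota>)"
proof -
  let ?S = "\<iota> ` vanishing"
  have S: "unitized_alg X \<iota> = closure ?S"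
    by (simp add: unitized_alg_def)
  have one: "1 \<in> ?S"
  proof
    show "1 = \<iota> (lau_one (Xinf X))"
      using enveloping by (simp add: enveloping_map_def)
    have "(indicator (topspace (Xinf X)) :: _ \<Rightarrow> complex) = lift_fun X 1 (\<lambda>t. 1)"
      by (auto simp: lift_fun_def fun_eq_iff indicator_def split: option.split)
    moreover have "lift_fun X 1 (\<lambda>t. 1) \<in> cont_fun (Xinf X)"
      by (intro lift_fun_cont_fun closed_X X_nonneg) (simp add: cont_at_infty_def)
    ultimately show "lau_one (Xinf X) \<in> vanishing"
      by (auto simp: lau_one_def intro!: lau_monom_alg) (auto simp: lau_monom_def)
  qed
  have add: "x + y \<in> ?S" if "x \<in> ?S" "y \<in> ?S" for x y
  proof -
    obtain a b where ab: "a \<in> vanishing" "b \<in> vanishing" "x = \<iota> a" "y = \<iota> b"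
      using \<open>x \<in> ?S\<close> \<open>y \<in> ?S\<close> by blast
    have "x + y = \<iota> (lau_add a b)"
      using ab by (simp add: enveloping_hom(2))
    moreover have "lau_add a b \<in> vanishing"
      using ab lau_add_alg[of a b] by (auto simp: lau_add_def)
    ultimately show ?thesis
      by blast
  qed
  have mult: "x * y \<in> ?S" if "x \<in> ?S" "y \<in> ?S" for x y
  proof -
    obtain a b where ab: "a \<in> vanishing" "b \<in> vanishing" "x = \<iota> a" "y = \<iota> b"
      using \<open>x \<in> ?S\<close> \<open>y \<in> ?S\<close> by blast
    have "x * y = \<iota> (lau_mult (dilation q) a b)"
      using ab by (simp add: enveloping_hom(3))
    then show ?thesis
      using lau_mult_vanishing[OF ab(1,2)] by blast
  qed
  have star: "star x \<in> ?S" if "x \<in> ?S" for x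
  proof -
    obtain a where a: "a \<in> vanishing" "x = \<iota> a"
      using \<open>x \<in> ?S\<close> by blast
    have "star x = \<iota> (lau_star (dilation q) a)"
      using a by (simp add: enveloping_hom(1))
    moreover have "lau_star (dilation q) a \<in> vanishing"
      using a by (auto simp: lau_star_alg) (auto simp: lau_star_def dilation_def)
    ultimately show ?thesis
      by blast
  qed
  have zero: "0 \<in> ?S"
  proof -
    have "(\<lambda>x. 0) \<in> cont_fun (Xinf X)"
      by (simp add: cont_fun_def)
    from lau_monom_alg[OF this, of 0] have z: "(\<lambda>k x. 0) \<in> lau_alg (Xinf X)"
      by (simp add: lau_monom_def)
    have e: "lau_add (\<lambda>k x. 0) (\<lambda>k x. 0) = (\<lambda>k x. 0)"
      by (simp add: lau_add_def)
    have "x = 0" if "x = x + x" for x :: 'a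
      using that by simp
    from this[OF enveloping_hom(2)[OF z z, unfolded e]] have "\<iota> (\<lambda>k x. 0) = 0" .
    then show ?thesis
      using z by (intro image_eqI[of _ _ "\<lambda>k x. 0"]) auto
  qed
  show ?thesis
    unfolding S by (rule star_subring_closure[OF zero one add mult star])
qed

end

section \<open>Functions on the spectrum with a limit at infinity\<close>

lemma cont_at_infty_const: "cont_at_infty X c (\<lambda>_. c)"
  by (simp add: cont_at_infty_def)

lemma cont_at_infty_mult:
  "cont_at_infty X c F \<Longrightarrow> cont_at_infty X d G \<Longrightarrow> cont_at_infty X (c * d) (\<lambda>t. F t * G t)"
  unfolding cont_at_infty_def by (auto intro!: continuous_intros tendsto_mult)

lemma cont_at_infty_add:
  "cont_at_infty X c F \<Longrightarrow> cont_at_infty X d G \<Longrightarrow> cont_at_infty X (c + d) (\<lambda>t. F t + G t)"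
  unfolding cont_at_infty_def by (auto intro!: continuous_intros tendsto_add)

lemma cont_at_infty_eventually_const:
  assumes "continuous_on X F" "\<And>t. M < t \<Longrightarrow> F t = c"
  shows "cont_at_infty X c F"
proof -
  have "\<forall>\<^sub>F t in at_top. F t = c"
    using eventually_gt_at_top[of M] by eventually_elim (rule assms(2))
  then have "\<forall>\<^sub>F t in inf at_top (principal X). F t = c"
    by (rule filter_leD[OF inf_le1])
  then show ?thesis
    using assms(1) tendsto_eventually unfolding cont_at_infty_def by blast
qed

lemma cont_at_infty_at_top: "continuous_on X F \<Longrightarrow> (F \<longlongrightarrow> c) at_top \<Longrightarrow> cont_at_infty X c F"
  unfolding cont_at_infty_def by (blast intro: tendsto_mono[OF inf_le1])

text \<open>A function may jump at a point outside \<open>X\<close>, because such a point separates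
  \<open>X\<close> into relatively open pieces. This is how the gaps of the spectrum enter.\<close>

lemma continuous_on_If_open:
  assumes "open A" "open C" "X \<subseteq> A \<union> C" "A \<inter> C = {}" "continuous_on (X \<inter> A) f" "continuous_on (X \<inter> C) g"
  shows "continuous_on X (\<lambda>t. if t \<in> A then f t else g t)"
proof -
  have X: "X \<inter> A \<union> X \<inter> C = X"
    using assms(3) by auto
  have "continuous_on (X \<inter> A \<union> X \<inter> C) (\<lambda>t. if t \<in> A then f t else g t)"
    using assms by (intro continuous_on_cases_local_open) (auto simp: X openin_open)
  then show ?thesis
    by (simp only: X)
qed

definition cut_fun :: "real \<Rightarrow> real \<Rightarrow> (real \<Rightarrow> real) \<Rightarrow> real \<Rightarrow> real" where
  "cut_fun a b f t = (if t \<in> {a<..<b} then f t else 0)"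

text \<open>Both endpoints lie in gaps of \<open>X\<close>, so cutting off there keeps continuity,
  and the function is 0 beyond \<open>b\<close>.\<close>

lemma cont_at_infty_cut_fun:
  assumes "a \<notin> X" "b \<notin> X" "continuous_on (X \<inter> {a<..<b}) f"
  shows "cont_at_infty X 0 (cut_fun a b f)"
proof (rule cont_at_infty_eventually_const[where M = b])
  have "X \<subseteq> {a<..<b} \<union> - {a..b}"
  proof
    fix x assume "x \<in> X"
    then have "x \<noteq> a" "x \<noteq> b"
      using assms(1,2) by auto
    then show "x \<in> {a<..<b} \<union> - {a..b}"
      by auto
  qed
  then have "continuous_on X (\<lambda>t. if t \<in> {a<..<b} then f t else 0)"
    using assms(3) by (intro continuous_on_If_open[where C = "- {a..b}"]) auto
  then show "continuous_on X (cut_fun a b f)"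
    by (simp add: cut_fun_def[abs_def])
qed (simp add: cut_fun_def)

section \<open>Calculus of the monomials F(|z|) U^k\<close>

context dilation_product
begin

text \<open>\<open>F(|z|) U\<^sup>k\<close>, where \<open>c\<close> is the value of \<open>F\<close> at infinity\<close>

definition elt :: "int \<Rightarrow> real \<Rightarrow> (real \<Rightarrow> real) \<Rightarrow> 'a" where
  "elt k c F = \<iota> (lau_monom k (lift_fun X c F))"

text \<open>Multiplication by a power of q preserves \<open>X\<close> and divergence to infinity, so
  the limit is unchanged.\<close>

lemma cont_at_infty_dilation:
  assumes "cont_at_infty X c F"
  shows "cont_at_infty X c (\<lambda>t. F (q powi k * t))"
proof -
  have lim: "filterlim (\<lambda>t. q powi k * t) (inf at_top (principal X)) (inf at_top (principal X))"
  proof (rule filterlim_inf[THEN iffD2], intro conjI)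
    have "filterlim (\<lambda>t. q powi k * t) at_top at_top"
      using q_pos by (intro filterlim_tendsto_pos_mult_at_top[OF tendsto_const] filterlim_ident) auto
    then show "filterlim (\<lambda>t. q powi k * t) at_top (inf at_top (principal X))"
      by (rule filterlim_mono) auto
    show "filterlim (\<lambda>t. q powi k * t) (principal X) (inf at_top (principal X))"
      unfolding filterlim_principal eventually_inf_principal by (simp add: always_eventually)
  qed
  have F: "continuous_on X F" "(F \<longlongrightarrow> c) (inf at_top (principal X))"
    using assms by (simp_all add: cont_at_infty_def)
  have "continuous_on X (\<lambda>t. F (q powi k * t))"
    by (rule continuous_on_compose2[OF F(1)]) (simp_all add: continuous_on_mult_left image_subset_iff)
  then show ?thesis
    using filterlim_compose[OF F(2) lim] by (simp add: cont_at_infty_def)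
qed

lemma lift_cont_fun: "cont_at_infty X c F \<Longrightarrow> lift_fun X c F \<in> cont_fun (Xinf X)"
  by (rule lift_fun_cont_fun[OF closed_X X_nonneg])

lemma monom_alg: "cont_at_infty X c F \<Longrightarrow> lau_monom k (lift_fun X c F) \<in> lau_alg (Xinf X)"
  by (intro lau_monom_alg lift_cont_fun)

lemma elt_cong: "(\<And>t. t \<in> X \<Longrightarrow> F t = G t) \<Longrightarrow> elt k c F = elt k c G"
  unfolding elt_def by (rule arg_cong[of _ _ "\<lambda>f. \<iota> (lau_monom k f)"])
    (auto simp: lift_fun_def fun_eq_iff split: option.split)

text \<open>Moving U^k past G replaces G by its dilate under q^k.\<close>

lemma elt_mult:
  assumes "cont_at_infty X c F" "cont_at_infty X d G"
  shows "elt k c F * elt l d G = elt (k + l) (c * d) (\<lambda>t. F t * G (q powi k * t))"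
proof -
  have "(\<lambda>x. lift_fun X c F x * lift_fun X d G (dilation q k x)) = lift_fun X (c * d) (\<lambda>t. F t * G (q powi k * t))"
    by (auto simp: lift_fun_def dilation_def fun_eq_iff split: option.split)
  then show ?thesis
    unfolding elt_def by (simp add: lau_mult_monom flip: enveloping_hom(3)[OF monom_alg[OF assms(1)] monom_alg[OF assms(2)]])
qed

lemma elt_star:
  assumes "cont_at_infty X c F"
  shows "star (elt k c F) = elt (- k) c (\<lambda>t. F (q powi (- k) * t))"
proof -
  have "(\<lambda>x. cnj (lift_fun X c F (dilation q (- k) x))) = lift_fun X c (\<lambda>t. F (q powi (- k) * t))"
    by (auto simp: lift_fun_def dilation_def fun_eq_iff split: option.split)
  then show ?thesis
    unfolding elt_def by (simp add: lau_star_monom flip: enveloping_hom(1)[OF monom_alg[OF assms]])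
qed

lemma elt_add:
  assumes "cont_at_infty X c F" "cont_at_infty X d G"
  shows "elt k c F + elt k d G = elt k (c + d) (\<lambda>t. F t + G t)"
proof -
  have "(\<lambda>x. lift_fun X c F x + lift_fun X d G x) = lift_fun X (c + d) (\<lambda>t. F t + G t)"
    by (auto simp: lift_fun_def fun_eq_iff split: option.split)
  then show ?thesis
    unfolding elt_def by (simp add: lau_add_monom flip: enveloping_hom(2)[OF monom_alg[OF assms(1)] monom_alg[OF assms(2)]])
qed

lemma elt_zero:
  assumes "\<And>t. t \<in> X \<Longrightarrow> F t = 0"
  shows "elt k 0 F = 0"
proof -
  have "elt k 0 F = elt k 0 (\<lambda>_. 0)"
    using assms by (rule elt_cong)
  moreover have "elt k 0 (\<lambda>_. 0) = elt k 0 (\<lambda>_. 0) + elt k 0 (\<lambda>_. 0)"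
    by (subst elt_add) (simp_all add: cont_at_infty_const)
  ultimately show ?thesis
    by simp
qed

lemma indicator_lift: "(indicator (topspace (Xinf X)) :: _ \<Rightarrow> complex) = lift_fun X 1 (\<lambda>_. 1)"
  by (auto simp: lift_fun_def fun_eq_iff indicator_def split: option.split)

lemma elt_one: "elt 0 1 (\<lambda>_. 1) = 1"
  using enveloping unfolding enveloping_map_def elt_def lau_one_def indicator_lift by blast

lemma U_elt_power: "U_elt X \<iota> ^ n = elt (int n) 1 (\<lambda>_. 1)"
proof (induction n)
  case (Suc n)
  have "U_elt X \<iota> = elt 1 1 (\<lambda>_. 1)"
    unfolding U_elt_def elt_def indicator_lift ..
  then show ?case
    using Suc by (simp add: elt_mult cont_at_infty_const)
qed (simp add: elt_one)

lemma star_U_elt_power: "star (U_elt X \<iota>) ^ n = elt (- int n) 1 (\<lambda>_. 1)"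
proof -
  have "star (x ^ n) = star x ^ n" for x :: 'a
    by (induction n) (simp_all add: star_mult power_commutes)
  from this[symmetric] show ?thesis
    by (simp add: U_elt_power elt_star cont_at_infty_const)
qed

lemma fn_elt_eq: "fn_elt X \<iota> c f = elt 0 c f"
  by (simp add: fn_elt_def elt_def lift_fun_def)

text \<open>Coefficients of nonzero powers of U must vanish at 0 and at infinity. The constant 1
  does not, so powers of U are brought into the algebra only together with a suitable
  coefficient.\<close>

lemma elt_unitized:
  assumes F: "cont_at_infty X c F" and "k = 0 \<or> (c = 0 \<and> F 0 = 0)"
  shows "elt k c F \<in> unitized_alg X \<iota>"
  unfolding unitized_alg_def elt_def
proof (rule subsetD[OF closure_subset imageI])
  show "lau_monom k (lift_fun X c F) \<in> vanishing"
  proof (rule CollectI, intro conjI allI impI)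
    show "lau_monom k (lift_fun X c F) \<in> lau_alg (Xinf X)"
      by (rule monom_alg[OF F])
    fix m :: int assume "m \<noteq> 0"
    then show "lau_monom k (lift_fun X c F) m (Some 0) = 0" "lau_monom k (lift_fun X c F) m None = 0"
      using assms(2) by (auto simp: lau_monom_def lift_fun_def)
  qed
qed

sublocale unitized: star_subring "unitized_alg X \<iota>"
  by (rule star_subring_unitized)

end

section \<open>Classes of projections\<close>

text \<open>The zero projection is orthogonal to itself, so its class is an idempotent of a
  group.\<close>

lemma (in star_subring) K0_class_mat1_zero: "K0_class B (mat1 0) = \<one>\<^bsub>K0_group B\<^esub>"
proof -
  interpret G: comm_group "K0_group B"
    by (rule comm_group_K0)
  have "mat1 0 \<in> mat_projections B"
    by (rule mat1_projection) (simp_all add: zero)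
  then have c: "K0_class B (mat1 0) \<in> carrier (K0_group B)"
    by (rule K0_class_carrier)
  have "K0_class B (mat1 (0 + 0)) = K0_class B (mat1 0) \<otimes>\<^bsub>K0_group B\<^esub> K0_class B (mat1 0)"
    by (rule K0_class_orthogonal_sum) (simp_all add: zero)
  then have "K0_class B (mat1 0) \<otimes>\<^bsub>K0_group B\<^esub> K0_class B (mat1 0) = K0_class B (mat1 0)"
    by simp
  then show ?thesis
    using G.l_cancel_one[OF c c] by simp
qed

section \<open>Classes of indicator projections\<close>

locale gapped_dilation_product = dilation_product +
  assumes q_less_1: "q < 1" and gap: "1 \<notin> X"
begin

abbreviation "K \<equiv> K0_group (unitized_alg X \<iota>)"

abbreviation cls :: "real \<Rightarrow> (real \<Rightarrow> real) \<Rightarrow> ('a mat set \<times> 'a mat set) set" where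
  "cls c F \<equiv> K0_class (unitized_alg X \<iota>) (mat1 (elt 0 c F))"

sublocale K0: comm_group K
  by (rule unitized.comm_group_K0)

text \<open>Invariance spreads the gap at 1 to all powers of q; these are the points at which
  functions are cut below.\<close>

lemma powi_notin [simp]: "q powi k \<notin> X"
  using X_inv_iff[of k 1] gap by simp

lemma q_notin [simp]: "q \<notin> X"
  using powi_notin[of 1] by simp

lemma elt0_projection:
  assumes F: "cont_at_infty X c F" and "c * c = c" "\<And>t. t \<in> X \<Longrightarrow> F t * F t = F t"
  shows "elt 0 c F \<in> unitized_alg X \<iota>" "star (elt 0 c F) = elt 0 c F" "elt 0 c F * elt 0 c F = elt 0 c F"
proof -
  show "elt 0 c F \<in> unitized_alg X \<iota>"
    by (rule elt_unitized[OF F]) simp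
  show "star (elt 0 c F) = elt 0 c F"
    by (simp add: elt_star[OF F])
  have "elt 0 c F * elt 0 c F = elt 0 c (\<lambda>t. F t * F t)"
    by (simp add: elt_mult[OF F F] assms(2))
  also have "\<dots> = elt 0 c F"
    by (rule elt_cong) (rule assms(3))
  finally show "elt 0 c F * elt 0 c F = elt 0 c F" .
qed

lemma cls_carrier:
  assumes "cont_at_infty X c F" "c * c = c" "\<And>t. t \<in> X \<Longrightarrow> F t * F t = F t"
  shows "mat1 (elt 0 c F) \<in> mat_projections (unitized_alg X \<iota>)" "cls c F \<in> carrier K"
proof -
  show "mat1 (elt 0 c F) \<in> mat_projections (unitized_alg X \<iota>)"
    by (rule unitized.mat1_projection[OF elt0_projection[OF assms]])
  then show "cls c F \<in> carrier K"
    by (rule unitized.K0_class_carrier)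
qed

lemma cls_add:
  assumes F: "cont_at_infty X c F" "c * c = c" "\<And>t. t \<in> X \<Longrightarrow> F t * F t = F t"
    and G: "cont_at_infty X d G" "d * d = d" "\<And>t. t \<in> X \<Longrightarrow> G t * G t = G t"
    and orth: "c * d = 0" "\<And>t. t \<in> X \<Longrightarrow> F t * G t = 0"
    and sum: "e = c + d" "\<And>t. t \<in> X \<Longrightarrow> H t = F t + G t"
  shows "cls e H = cls c F \<otimes>\<^bsub>K\<^esub> cls d G"
proof -
  have "elt 0 c F * elt 0 d G = elt 0 0 (\<lambda>t. F t * G t)"
    by (simp add: elt_mult[OF F(1) G(1)] orth(1))
  also have "\<dots> = 0"
    by (rule elt_zero) (rule orth(2))
  finally have 0: "elt 0 c F * elt 0 d G = 0" .
  have "elt 0 e H = elt 0 c F + elt 0 d G"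
    unfolding elt_add[OF F(1) G(1)] sum(1) by (rule elt_cong) (rule sum(2))
  then show ?thesis
    using unitized.K0_class_orthogonal_sum[OF elt0_projection[OF F] elt0_projection[OF G] 0] by simp
qed

abbreviation chi :: "real \<Rightarrow> real \<Rightarrow> real \<Rightarrow> real" where
  "chi a b \<equiv> cut_fun a b (\<lambda>_. 1)"

lemma cont_chi: "a \<notin> X \<Longrightarrow> b \<notin> X \<Longrightarrow> cont_at_infty X 0 (chi a b)"
  by (rule cont_at_infty_cut_fun) simp_all

lemma chi_idem: "chi a b t * chi a b t = chi a b t"
  by (simp add: cut_fun_def)

lemma chi_elt_eq: "chi_elt X \<iota> a b = elt 0 0 (chi a b)"
proof -
  have "indicator {a<..<b} = chi a b"
    by (auto simp: cut_fun_def fun_eq_iff indicator_def)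
  then show ?thesis
    unfolding chi_elt_def fn_elt_eq by simp
qed

text \<open>The partial isometry \<open>w\<close> is U^(-j) cut off to the dilated interval. The
  condition 0 \<le> \<open>a\<close> keeps 0 out of that open interval, so \<open>w\<close> lies in
  the algebra.\<close>

lemma cls_chi_translate:
  assumes a: "0 \<le> a" "a \<notin> X" "b \<notin> X"
  shows "cls 0 (chi (q powi j * a) (q powi j * b)) = cls 0 (chi a b)"
proof -
  let ?c = "chi (q powi j * a) (q powi j * b)"
  define w where "w = elt (- j) 0 ?c"
  have c: "cont_at_infty X 0 ?c"
    by (rule cont_chi) (simp_all add: a)
  have sc: "?c (q powi j * t) = chi a b t" for t
    using q_pos by (simp add: cut_fun_def)
  have sw: "star w = elt j 0 (chi a b)"
    unfolding w_def elt_star[OF c] by (simp add: sc)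
  have cab: "cont_at_infty X 0 (chi a b)"
    by (rule cont_chi) (simp_all add: a)
  have "star w * w = elt 0 0 (chi a b)"
    unfolding sw unfolding w_def elt_mult[OF cab c] by (simp add: sc chi_idem)
  moreover have "w * star w = elt 0 0 ?c"
  proof -
    have "chi a b (q powi (- j) * t) = ?c t" for t
      using sc[of "q powi (- j) * t"] by simp
    then show ?thesis
      unfolding sw unfolding w_def elt_mult[OF c cab] by (simp add: chi_idem)
  qed
  moreover have "w \<in> unitized_alg X \<iota>"
    unfolding w_def
  proof (rule elt_unitized[OF c])
    have "0 \<le> q powi j * a"
      using a(1) q_pos by simp
    then show "- j = 0 \<or> 0 = 0 \<and> ?c 0 = 0"
      by (simp add: cut_fun_def)
  qed
  ultimately show ?thesis
    using unitized.K0_class_partial_isometry(2)[of w "elt 0 0 (chi a b)" "elt 0 0 ?c"]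
      elt0_projection(3)[OF cab _ chi_idem] by simp
qed

text \<open>The interval is cut at the powers of q between its endpoints; each of the
  \<open>m\<close> pieces is a dilate of (q, 1), and the induction splits off the lowest
  one.\<close>

lemma cls_chi_power: "cls 0 (chi (q powi (i + int m)) (q powi i)) = cls 0 (chi q 1) [^]\<^bsub>K\<^esub> m"
proof (induction m)
  case 0
  have "elt 0 0 (chi (q powi i) (q powi i)) = 0"
    by (rule elt_zero) (simp add: cut_fun_def)
  then show ?case
    by (simp add: unitized.K0_class_mat1_zero del: One_nat_def)
next
  case (Suc m)
  let ?a = "q powi (i + int (Suc m))" and ?b = "q powi (i + int m)"
  have ab: "?a = q powi (i + int m) * q"
    using q_pos by (simp add: power_int_add algebra_simps)
  have "?a < ?b"
    unfolding ab using q_pos q_less_1 by simp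
  have bi: "?b = q powi i * q ^ m"
    using q_pos by (simp add: power_int_add)
  have "?b \<le> q powi i"
    unfolding bi using q_pos q_less_1 by (simp add: power_le_one)
  have "cls 0 (chi ?a (q powi i)) = cls 0 (chi ?b (q powi i)) \<otimes>\<^bsub>K\<^esub> cls 0 (chi ?a ?b)"
  proof (rule cls_add)
    fix t assume "t \<in> X"
    then have "t \<noteq> ?b"
      using powi_notin by metis
    then show "chi ?a (q powi i) t = chi ?b (q powi i) t + chi ?a ?b t"
      using \<open>?a < ?b\<close> \<open>?b \<le> q powi i\<close> unfolding cut_fun_def by auto
    show "chi ?b (q powi i) t * chi ?a ?b t = 0"
      unfolding cut_fun_def by auto
  qed (simp_all only: chi_idem cont_chi powi_notin not_False_eq_True mult_zero_left add_0)
  also have "cls 0 (chi ?a ?b) = cls 0 (chi q 1)"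
    using cls_chi_translate[of q 1 "i + int m"] q_pos gap ab by simp
  finally show ?case
    using Suc.IH by simp
qed

lemma cls_chi_carrier: "a \<notin> X \<Longrightarrow> b \<notin> X \<Longrightarrow> cls 0 (chi a b) \<in> carrier K"
  by (rule cls_carrier(2)[OF cont_chi _ chi_idem]) simp_all

text \<open>With \<open>low\<close>, the discontinuous replacement for the pair F, G of the Bott
  projections; on \<open>X\<close> the two are complementary because 1 is not in
  \<open>X\<close>.\<close>

definition high :: "real \<Rightarrow> real" where "high t = (if t \<in> {1<..} then 1 else 0)"

definition low :: "real \<Rightarrow> real" where "low t = (if t \<in> {..<1} then 1 else 0)"

lemma cont_high: "cont_at_infty X 1 high"
proof (rule cont_at_infty_eventually_const[where M = 1])
  have "X \<subseteq> {1<..} \<union> {..<1}"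
    using gap by (metis UnCI greaterThan_iff lessThan_iff linorder_neqE_linordered_idom subsetI)
  then show "continuous_on X high"
    unfolding high_def[abs_def] by (intro continuous_on_If_open[where C = "{..<1}"]) auto
qed (simp add: high_def)

lemma cont_low: "cont_at_infty X 0 low"
proof (rule cont_at_infty_eventually_const[where M = 1])
  have "X \<subseteq> {..<1} \<union> {1<..}"
    using gap by (metis UnCI greaterThan_iff lessThan_iff linorder_neqE_linordered_idom subsetI)
  then show "continuous_on X low"
    unfolding low_def[abs_def] by (intro continuous_on_If_open[where C = "{1<..}"]) auto
qed (simp add: low_def)

lemma high_low:
  shows "high t * high t = high t" "low t * low t = low t" "high t * low t = 0" "low t * high t = 0"
    and "t \<in> X \<Longrightarrow> high t + low t = 1"
proof -
  assume "t \<in> X"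
  then have "t \<noteq> 1"
    using gap by auto
  then show "high t + low t = 1"
    by (auto simp: high_def low_def)
qed (simp_all add: high_def low_def)

lemma cls_one: "K0_class (unitized_alg X \<iota>) (mat1 1) = cls 1 high \<otimes>\<^bsub>K\<^esub> cls 0 low"
proof -
  have "cls 1 (\<lambda>_. 1) = cls 1 high \<otimes>\<^bsub>K\<^esub> cls 0 low"
    by (rule cls_add[OF cont_high _ high_low(1) cont_low _ high_low(2)]) (simp_all add: high_low)
  then show ?thesis
    by (simp only: elt_one)
qed

lemma power_less_iff: "q ^ n * t < 1 \<longleftrightarrow> t < q powi (- int n)" "1 < q ^ n * t \<longleftrightarrow> q powi (- int n) < t"
  using q_pos by (simp_all add: power_int_minus field_simps)

lemma powi_neg_ge_1: "1 \<le> q powi (- int n)"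
  using q_pos q_less_1 by (simp add: power_int_minus one_le_inverse_iff power_le_one)

text \<open>Dilation moves the cut from 1 up to q^(-n), which adds the indicator of (1, q^(-n)),
  that is, \<open>n\<close> pieces.\<close>

lemma cls_low_translate:
  "cls 0 (\<lambda>t. low (q powi int n * t)) = cls 0 low \<otimes>\<^bsub>K\<^esub> (cls 0 (chi q 1) [^]\<^bsub>K\<^esub> n)"
proof -
  have "cls 0 (\<lambda>t. low (q powi int n * t)) = cls 0 low \<otimes>\<^bsub>K\<^esub> cls 0 (chi 1 (q powi (- int n)))"
  proof (rule cls_add[OF cont_low _ high_low(2) cont_chi _ chi_idem])
    fix t assume "t \<in> X"
    then have "t \<noteq> 1"
      using gap by auto
    then show "low (q powi int n * t) = low t + chi 1 (q powi (- int n)) t"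
      using powi_neg_ge_1[of n] unfolding low_def cut_fun_def by (auto simp: power_less_iff)
    show "low t * chi 1 (q powi (- int n)) t = 0"
      unfolding low_def cut_fun_def by simp
  qed (simp_all add: gap)
  then show ?thesis
    using cls_chi_power[of "- int n" n] by simp
qed

text \<open>Here the same interval is lost under dilation; with the dilate on the right-hand side
  the identity is a sum of orthogonal projections.\<close>

lemma cls_high_translate:
  "cls 1 high = cls 1 (\<lambda>t. high (q powi int n * t)) \<otimes>\<^bsub>K\<^esub> (cls 0 (chi q 1) [^]\<^bsub>K\<^esub> n)"
proof -
  have "cls 1 high = cls 1 (\<lambda>t. high (q powi int n * t)) \<otimes>\<^bsub>K\<^esub> cls 0 (chi 1 (q powi (- int n)))"
  proof (rule cls_add[OF cont_at_infty_dilation[OF cont_high] _ high_low(1) cont_chi _ chi_idem])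
    fix t assume "t \<in> X"
    then have "t \<noteq> 1" "t \<noteq> q powi (- int n)"
      using gap powi_notin by metis+
    then show "high t = high (q powi int n * t) + chi 1 (q powi (- int n)) t"
      using powi_neg_ge_1[of n] unfolding high_def cut_fun_def by (auto simp: power_less_iff)
    show "high (q powi int n * t) * chi 1 (q powi (- int n)) t = 0"
      unfolding high_def cut_fun_def by (simp add: power_less_iff)
  qed (simp_all add: gap)
  then show ?thesis
    using cls_chi_power[of "- int n" n] by simp
qed

section \<open>Bott projections\<close>

lemma elt_mult_star:
  assumes F: "cont_at_infty X c F" and G: "cont_at_infty X d G"
  shows "elt k c (\<lambda>t. F (q powi k * t)) * star (elt l d (\<lambda>t. G (q powi l * t))) =
      elt (k - l) (c * d) (\<lambda>t. F (q powi k * t) * G (q powi k * t))"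
    and "star (elt k c (\<lambda>t. F (q powi k * t))) * elt k d (\<lambda>t. G (q powi k * t)) = elt 0 (c * d) (\<lambda>t. F t * G t)"
proof -
  note dF = cont_at_infty_dilation[OF F] and dG = cont_at_infty_dilation[OF G]
  \<comment> \<open>A coefficient dilated by q^l in front of U^l is the same as U^l G, so the
    adjoint is G U^(-l) with G undilated.\<close>
  have "star (elt l d (\<lambda>t. G (q powi l * t))) = elt (- l) d G"
    unfolding elt_star[OF dG] by simp
  then show "elt k c (\<lambda>t. F (q powi k * t)) * star (elt l d (\<lambda>t. G (q powi l * t))) =
      elt (k - l) (c * d) (\<lambda>t. F (q powi k * t) * G (q powi k * t))"
    by (simp add: elt_mult[OF dF G])
  have "star (elt k c (\<lambda>t. F (q powi k * t))) = elt (- k) c F"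
    unfolding elt_star[OF dF] by simp
  then show "star (elt k c (\<lambda>t. F (q powi k * t))) * elt k d (\<lambda>t. G (q powi k * t)) = elt 0 (c * d) (\<lambda>t. F t * G t)"
    by (simp add: elt_mult[OF F dG])
qed

definition bott_matrix :: "int \<Rightarrow> int \<Rightarrow> (real \<Rightarrow> real) \<Rightarrow> (real \<Rightarrow> real) \<Rightarrow> 'a mat" where
  "bott_matrix k l F G = mat_of_rows_list 2
    [[elt 0 1 (\<lambda>t. F (q powi k * t) * F (q powi k * t)), elt (k - l) 0 (\<lambda>t. F (q powi k * t) * G (q powi k * t))],
     [elt (l - k) 0 (\<lambda>t. G (q powi l * t) * F (q powi l * t)), elt 0 0 (\<lambda>t. G (q powi l * t) * G (q powi l * t))]]"

text \<open>The matrix is \<open>v v\<^sup>*\<close> for the isometric column \<open>v = (U\<^sup>k F, U\<^sup>l G)\<close>. Neither \<open>v\<close> nor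
  the column \<open>v'\<close> of another pair lies in the algebra, but \<open>v' v\<^sup>*\<close> does. The gap at \<open>1\<close> permits
  a discontinuous pair, for which the matrix is diagonal.\<close>

lemma K0_class_bott_matrix:
  assumes F: "cont_at_infty X 1 F" and G: "cont_at_infty X 0 G" and F0: "F 0 = 0"
    and FG: "\<And>t. t \<in> X \<Longrightarrow> F t * F t + G t * G t = 1"
  shows "K0_class (unitized_alg X \<iota>) (bott_matrix k l F G) =
    cls 1 (\<lambda>t. high (q powi k * t)) \<otimes>\<^bsub>K\<^esub> cls 0 (\<lambda>t. low (q powi l * t))"
proof -
  define col where "col F G = (elt k 1 (\<lambda>t. F (q powi k * t)), elt l 0 (\<lambda>t. G (q powi l * t)))" for F G
  have iso: "star (fst (col F G)) * fst (col F G) + star (snd (col F G)) * snd (col F G) = 1"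
    if F: "cont_at_infty X 1 F" and G: "cont_at_infty X 0 G"
      and FG: "\<And>t. t \<in> X \<Longrightarrow> F t * F t + G t * G t = 1" for F G
  proof -
    have "star (fst (col F G)) * fst (col F G) + star (snd (col F G)) * snd (col F G) =
      elt 0 1 (\<lambda>t. F t * F t) + elt 0 0 (\<lambda>t. G t * G t)"
      unfolding col_def fst_conv snd_conv elt_mult_star(2)[OF F F] elt_mult_star(2)[OF G G] by simp
    also have "\<dots> = elt 0 1 (\<lambda>t. F t * F t + G t * G t)"
      using elt_add[OF cont_at_infty_mult[OF F F] cont_at_infty_mult[OF G G]] by simp
    also have "\<dots> = elt 0 1 (\<lambda>_. 1)"
      by (rule elt_cong) (rule FG)
    finally show ?thesis
      unfolding elt_one .
  qed
  have mat: "bott_matrix k l F G = mat_of_rows_list 2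
      [[fst (col F G) * star (fst (col F G)), fst (col F G) * star (snd (col F G))],
       [snd (col F G) * star (fst (col F G)), snd (col F G) * star (snd (col F G))]]"
    if F: "cont_at_infty X 1 F" and G: "cont_at_infty X 0 G" for F G
    unfolding bott_matrix_def col_def fst_conv snd_conv elt_mult_star(1)[OF F F] elt_mult_star(1)[OF F G]
      elt_mult_star(1)[OF G F] elt_mult_star(1)[OF G G] by simp
  note H = cont_high cont_low
  have high0: "high 0 = 0"
    by (simp add: high_def)
  have H1: "high t * high t + low t * low t = 1" if "t \<in> X" for t
    using high_low(5)[OF that] by (simp add: high_low)
  have "K0_class (unitized_alg X \<iota>) (bott_matrix k l F G) = K0_class (unitized_alg X \<iota>) (bott_matrix k l high low)"
    unfolding mat[OF F G] mat[OF H]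
  proof (rule unitized.K0_class_isometry_columns[OF iso[OF F G FG] iso[OF H H1]])
    \<comment> \<open>Only the mixed products can carry a nonzero power of U. They vanish at
      infinity because of the factor \<open>low\<close> or \<open>G\<close>, and at 0 because of the
      factor \<open>high\<close> or \<open>F\<close>.\<close>
    have in0: "elt m (c * d) (\<lambda>t. F (q powi j * t) * G (q powi j * t)) \<in> unitized_alg X \<iota>"
      if "cont_at_infty X c F" "cont_at_infty X d G" "m = 0 \<or> (c * d = 0 \<and> F 0 * G 0 = 0)" for m j c d F G
      using that(3) by (intro elt_unitized cont_at_infty_mult cont_at_infty_dilation that(1,2)) simp
    show "fst (col high low) * star (fst (col F G)) \<in> unitized_alg X \<iota>"
      "fst (col high low) * star (snd (col F G)) \<in> unitized_alg X \<iota>"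
      "snd (col high low) * star (fst (col F G)) \<in> unitized_alg X \<iota>"
      "snd (col high low) * star (snd (col F G)) \<in> unitized_alg X \<iota>"
      unfolding col_def fst_conv snd_conv elt_mult_star(1)[OF cont_high F] elt_mult_star(1)[OF cont_high G]
        elt_mult_star(1)[OF cont_low F] elt_mult_star(1)[OF cont_low G]
      by (rule in0; simp add: F G H F0 high0)+
  qed
  \<comment> \<open>Off the diagonal the products of \<open>high\<close> and \<open>low\<close> are
    zero; on it both functions are idempotent.\<close>
  also have "bott_matrix k l high low = mat_of_rows_list 2
    [[elt 0 1 (\<lambda>t. high (q powi k * t)), 0], [0, elt 0 0 (\<lambda>t. low (q powi l * t))]]"
    unfolding bott_matrix_def high_low by (simp add: elt_zero)
  also have "K0_class (unitized_alg X \<iota>) \<dots> =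
    cls 1 (\<lambda>t. high (q powi k * t)) \<otimes>\<^bsub>K\<^esub> cls 0 (\<lambda>t. low (q powi l * t))"
    by (rule unitized.K0_class_diagonal; rule cls_carrier) (simp_all add: H cont_at_infty_dilation high_low)
  finally show ?thesis .
qed

text \<open>The function \<open>a'\<close> of \<open>bott_pos\<close>, the square root of
  \<open>a\<close> on the nonnegative half-line.\<close>

definition bott_scale :: "nat \<Rightarrow> real \<Rightarrow> real" where
  "bott_scale n t = q powr (- (real n / 2) * (real n - 1)) * t ^ n"

lemma bott_scale_square: "(bott_scale n t)\<^sup>2 = q powr (- real n * (real n - 1)) * t ^ (2 * n)"
proof -
  have "(q powr (- (real n / 2) * (real n - 1)))\<^sup>2 = q powr (- real n * (real n - 1))"
    unfolding power2_eq_square powr_add[symmetric] by (rule arg_cong[of _ _ "(powr) q"]) (simp add: field_simps)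
  then show ?thesis
    unfolding bott_scale_def power_mult_distrib by (simp add: power_mult[symmetric] mult.commute)
qed

text \<open>The exponents add up as -n(n-1)/2 + n^2 = n(n+1)/2. Hence \<open>b'\<close> is the
  dilate of \<open>a'\<close> by q^n, and all entries of the Bott projections come from one
  function.\<close>

lemma bott_scale_dilation: "bott_scale n (q powi int n * t) = q powr (real n / 2 * (real n + 1)) * t ^ n"
proof -
  have "(q ^ n) ^ n = q powr (real n * real n)"
    using q_pos by (simp add: powr_realpow[symmetric] powr_powr)
  then have "q powr (- (real n / 2) * (real n - 1)) * (q ^ n) ^ n = q powr (real n / 2 * (real n + 1))"
    by (simp add: powr_add[symmetric]) (simp add: field_simps)
  then show ?thesis
    unfolding bott_scale_def by (simp add: power_mult_distrib mult.assoc[symmetric])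
qed

lemma bott_scale_dilation_square:
  "(bott_scale n (q powi int n * t))\<^sup>2 = q powr (real n * (real n + 1)) * t ^ (2 * n)"
proof -
  have "(q powr (real n / 2 * (real n + 1)))\<^sup>2 = q powr (real n * (real n + 1))"
    unfolding power2_eq_square powr_add[symmetric] by (rule arg_cong[of _ _ "(powr) q"]) (simp add: field_simps)
  then show ?thesis
    unfolding bott_scale_dilation power_mult_distrib by (simp add: power_mult[symmetric] mult.commute)
qed

text \<open>With \<open>bott_scale\<close> as the tangent of an angle, \<open>bott_sin\<close> and
  \<open>bott_cos\<close> are its sine and cosine, the functions F and G of the isometric
  column.\<close>

definition bott_sin :: "nat \<Rightarrow> real \<Rightarrow> real" where
  "bott_sin n t = bott_scale n t / sqrt (1 + (bott_scale n t)\<^sup>2)"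

definition bott_cos :: "nat \<Rightarrow> real \<Rightarrow> real" where
  "bott_cos n t = 1 / sqrt (1 + (bott_scale n t)\<^sup>2)"

lemma bott_sin_cos:
  "bott_sin n t * bott_sin n t = (bott_scale n t)\<^sup>2 / (1 + (bott_scale n t)\<^sup>2)"
  "bott_sin n t * bott_cos n t = bott_scale n t / (1 + (bott_scale n t)\<^sup>2)"
  "bott_cos n t * bott_sin n t = bott_scale n t / (1 + (bott_scale n t)\<^sup>2)"
  "bott_cos n t * bott_cos n t = 1 / (1 + (bott_scale n t)\<^sup>2)"
  by (simp_all add: bott_sin_def bott_cos_def power2_eq_square add_nonneg_nonneg)

lemma bott_sin_cos_square: "bott_sin n t * bott_sin n t + bott_cos n t * bott_cos n t = 1"
proof -
  have "0 < 1 + (bott_scale n t)\<^sup>2"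
    by (simp add: add_pos_nonneg)
  then show ?thesis
    unfolding bott_sin_cos by (simp add: field_simps)
qed

text \<open>For \<open>n\<close> \<ge> 1 the tangent tends to infinity, so the limits are those of x
  / sqrt (1 + x^2) and 1 / sqrt (1 + x^2).\<close>

lemma cont_bott:
  assumes "1 \<le> n"
  shows "cont_at_infty X 1 (bott_sin n)" "cont_at_infty X 0 (bott_cos n)"
proof -
  have pos: "sqrt (1 + (bott_scale n t)\<^sup>2) \<noteq> 0" for t
    by (smt (verit) real_sqrt_eq_zero_cancel_iff zero_le_power2)
  have cont: "continuous_on X (bott_scale n)"
    unfolding bott_scale_def[abs_def] by (intro continuous_intros)
  have lim: "filterlim (bott_scale n) at_top at_top"
    unfolding bott_scale_def[abs_def] using q_pos assms
    by (intro filterlim_tendsto_pos_mult_at_top[OF tendsto_const] filterlim_pow_at_top filterlim_ident) auto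
  have "((\<lambda>x::real. x / sqrt (1 + x\<^sup>2)) \<longlongrightarrow> 1) at_top" "((\<lambda>x::real. 1 / sqrt (1 + x\<^sup>2)) \<longlongrightarrow> 0) at_top"
    by real_asymp+
  note lims = this[THEN filterlim_compose, OF lim]
  show "cont_at_infty X 1 (bott_sin n)"
    unfolding bott_sin_def[abs_def] by (intro cont_at_infty_at_top continuous_intros cont lims ballI pos)
  show "cont_at_infty X 0 (bott_cos n)"
    unfolding bott_cos_def[abs_def] by (intro cont_at_infty_at_top continuous_intros cont lims ballI pos)
qed

lemma elt_mult_U:
  assumes "cont_at_infty X 0 F"
  shows "elt 0 0 F * U_elt X \<iota> ^ n = elt (int n) 0 F" "elt 0 0 F * star (U_elt X \<iota>) ^ n = elt (- int n) 0 F"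
    and "U_elt X \<iota> ^ n * elt 0 0 F = elt (int n) 0 (\<lambda>t. F (q powi int n * t))"
  unfolding U_elt_power star_U_elt_power
  by (simp_all add: elt_mult[OF assms cont_at_infty_const] elt_mult[OF cont_at_infty_const assms])

text \<open>In the first case U^n sits in the lower entry of the column, in the second in the upper
  one; accordingly the entries of one row are dilated by q^n.\<close>

lemma bott_eq_bott_matrix:
  assumes n: "1 \<le> n"
  shows "bott_pos q X \<iota> n = bott_matrix 0 (int n) (bott_sin n) (bott_cos n)"
    and "bott_neg q X \<iota> n = bott_matrix (int n) 0 (bott_sin n) (bott_cos n)"
proof -
  note sc = cont_at_infty_mult[OF cont_bott[OF n], simplified]
  have e: "(\<lambda>t. bott_scale n t / (1 + (bott_scale n t)\<^sup>2)) = (\<lambda>t. bott_sin n t * bott_cos n t)"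
    by (simp only: bott_sin_cos)
  have e': "(\<lambda>t. bott_scale n (q powi int n * t) / (1 + (bott_scale n (q powi int n * t))\<^sup>2)) =
      (\<lambda>t. bott_sin n (q powi int n * t) * bott_cos n (q powi int n * t))"
    by (simp only: bott_sin_cos)
  have 1: "elt 0 0 (\<lambda>t. bott_scale n t / (1 + (bott_scale n t)\<^sup>2)) * star (U_elt X \<iota>) ^ n =
      elt (- int n) 0 (\<lambda>t. bott_scale n t / (1 + (bott_scale n t)\<^sup>2))"
    unfolding e by (rule elt_mult_U(2)[OF sc])
  have 2: "elt 0 0 (\<lambda>t. bott_scale n (q powi int n * t) / (1 + (bott_scale n (q powi int n * t))\<^sup>2)) * U_elt X \<iota> ^ n =
      elt (int n) 0 (\<lambda>t. bott_scale n (q powi int n * t) / (1 + (bott_scale n (q powi int n * t))\<^sup>2))"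
    unfolding e' by (rule elt_mult_U(1)[OF cont_at_infty_dilation[OF sc]])
  show "bott_pos q X \<iota> n = bott_matrix 0 (int n) (bott_sin n) (bott_cos n)"
    unfolding bott_pos_def Let_def bott_matrix_def fn_elt_eq bott_sin_cos
      bott_scale_square[symmetric] bott_scale_dilation_square[symmetric] bott_scale_dilation[symmetric]
      bott_scale_def[symmetric] 1 2 by simp
  show "bott_neg q X \<iota> n = bott_matrix (int n) 0 (bott_sin n) (bott_cos n)"
    unfolding bott_neg_def Let_def bott_matrix_def fn_elt_eq bott_sin_cos
      bott_scale_square[symmetric] bott_scale_dilation_square[symmetric] bott_scale_dilation[symmetric]
      bott_scale_def[symmetric] 1 2 by simp
qed

text \<open>By \<open>K0_class_bott_matrix\<close> only one of \<open>high\<close> and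
  \<open>low\<close> is dilated by q^n. In comparison with [1] = [\<open>high\<close>] +
  [\<open>low\<close>], dilating \<open>low\<close> gains \<open>n\<close> copies of the class of
  (q, 1), and dilating \<open>high\<close> loses them.\<close>

lemma K0_class_bott:
  assumes n: "1 \<le> n"
  shows "K0_class (unitized_alg X \<iota>) (bott_pos q X \<iota> n) =
      K0_class (unitized_alg X \<iota>) (mat1 1) \<otimes>\<^bsub>K\<^esub> (cls 0 (chi q 1) [^]\<^bsub>K\<^esub> n)"
    and "K0_class (unitized_alg X \<iota>) (bott_neg q X \<iota> n) =
      K0_class (unitized_alg X \<iota>) (mat1 1) \<otimes>\<^bsub>K\<^esub> inv\<^bsub>K\<^esub> (cls 0 (chi q 1) [^]\<^bsub>K\<^esub> n)"
proof -
  have "bott_sin n 0 = 0"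
    using n by (simp add: bott_sin_def bott_scale_def)
  note bm = K0_class_bott_matrix[OF cont_bott[OF n] this bott_sin_cos_square]
  let ?g = "cls 0 (chi q 1) [^]\<^bsub>K\<^esub> n"
  have g: "?g \<in> carrier K"
    by (intro K0.nat_pow_closed cls_chi_carrier) (simp_all add: gap)
  have h: "cls 1 (\<lambda>t. high (q powi k * t)) \<in> carrier K" for k
    by (rule cls_carrier(2)[OF cont_at_infty_dilation[OF cont_high]]) (simp_all add: high_low)
  have l: "cls 0 low \<in> carrier K"
    by (rule cls_carrier(2)[OF cont_low]) (simp_all add: high_low)
  have h0: "cls 1 high \<in> carrier K"
    using h[of 0] by simp
  show "K0_class (unitized_alg X \<iota>) (bott_pos q X \<iota> n) =
      K0_class (unitized_alg X \<iota>) (mat1 1) \<otimes>\<^bsub>K\<^esub> ?g"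
    unfolding bott_eq_bott_matrix(1)[OF n] bm cls_low_translate cls_one
    using g h0 l by (simp add: K0.m_assoc)
  have "K0_class (unitized_alg X \<iota>) (mat1 1) \<otimes>\<^bsub>K\<^esub> inv\<^bsub>K\<^esub> ?g =
      (cls 1 (\<lambda>t. high (q powi int n * t)) \<otimes>\<^bsub>K\<^esub> ?g) \<otimes>\<^bsub>K\<^esub> cls 0 low \<otimes>\<^bsub>K\<^esub> inv\<^bsub>K\<^esub> ?g"
    unfolding cls_one cls_high_translate[of n, symmetric] ..
  also have "\<dots> = cls 1 (\<lambda>t. high (q powi int n * t)) \<otimes>\<^bsub>K\<^esub> cls 0 low \<otimes>\<^bsub>K\<^esub> (?g \<otimes>\<^bsub>K\<^esub> inv\<^bsub>K\<^esub> ?g)"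
    using g h[of "int n"] l by (simp only: K0.m_ac K0.m_closed K0.inv_closed)
  also have "\<dots> = cls 1 (\<lambda>t. high (q powi int n * t)) \<otimes>\<^bsub>K\<^esub> cls 0 low"
    using g h[of "int n"] l by (simp only: K0.r_inv K0.r_one K0.m_closed)
  finally show "K0_class (unitized_alg X \<iota>) (bott_neg q X \<iota> n) =
      K0_class (unitized_alg X \<iota>) (mat1 1) \<otimes>\<^bsub>K\<^esub> inv\<^bsub>K\<^esub> ?g"
    unfolding bott_eq_bott_matrix(2)[OF n] bm by simp
qed

end

section \<open>Powers-Rieffel projections\<close>

lemma (in gapped_dilation_product) K0_class_powers_rieffel:
  assumes phi: "continuous_on {q..1} \<phi>" "\<forall>t\<in>{q..1}. 0 \<le> \<phi> t \<and> \<phi> t \<le> 1" and n: "1 \<le> n"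
  shows "K0_class (unitized_alg X \<iota>) (mat1 (powers_rieffel q X \<iota> \<phi> n)) = cls 0 (chi q 1) [^]\<^bsub>K\<^esub> n"
proof -
  \<comment> \<open>The initial projection of \<open>w\<close> lives on (q, \<open>?b\<close>).
    Since q = q^(1-n) q^n, this interval consists of exactly \<open>n\<close> pieces, although the
    support of \<open>pr_f\<close> reaches up to q^(-n).\<close>
  let ?b = "q powi (1 - int n)"
  define A where "A = cut_fun q 1 (\<lambda>t. sqrt (\<phi> t))"
  define D where "D = cut_fun q 1 (\<lambda>t. sqrt (1 - \<phi> t))"
  define F where "F t = A t + chi 1 ?b t" for t
  \<comment> \<open>The second summand is U^n D, with the coefficient moved to the left of U^n and
    hence dilated.\<close>
  define w where "w = elt 0 0 F + elt (int n) 0 (\<lambda>t. D (q ^ n * t))"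
  have phi': "continuous_on (X \<inter> {q<..<1}) \<phi>"
    by (rule continuous_on_subset[OF phi(1)]) auto
  have A: "cont_at_infty X 0 A" and D: "cont_at_infty X 0 D"
    unfolding A_def D_def by (intro cont_at_infty_cut_fun q_notin gap continuous_intros phi')+
  have F: "cont_at_infty X 0 F"
    using cont_at_infty_add[OF A cont_chi[OF gap powi_notin]] unfolding F_def[abs_def] by simp
  have E: "cont_at_infty X 0 (\<lambda>t. D (q ^ n * t))"
    using cont_at_infty_dilation[OF D, of "int n"] by simp
  note pi = powi_inverse[where k = "int n", unfolded power_int_of_nat]
  have qn: "0 < q ^ n" "q ^ n \<le> q"
    using q_pos q_less_1 n power_decreasing[of 1 n q] by simp_all
  have b: "?b = q / q ^ n" and c: "q powi (- int n) = 1 / q ^ n"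
    using q_pos power_int_diff[of q 1 "int n"] by (simp_all add: power_int_minus field_simps)
  have b_iff: "t < ?b \<longleftrightarrow> q ^ n * t < q" "?b \<le> t \<longleftrightarrow> q \<le> q ^ n * t" for t
    unfolding b using qn by (simp_all add: field_simps)
  have c_iff: "t \<le> q powi (- int n) \<longleftrightarrow> q ^ n * t \<le> 1" for t
    unfolding c using qn by (simp add: field_simps)
  have less_1: "q ^ n * t < q" if "t < 1" for t
  proof -
    have "q ^ n * t < q ^ n * 1"
      using qn that by (intro mult_strict_left_mono)
    then show ?thesis
      using qn by linarith
  qed
  have ne: "t \<noteq> 1" "t \<noteq> q" "q ^ n * t \<noteq> q" "q ^ n * t \<noteq> 1" if "t \<in> X" for t
  proof -
    show "t \<noteq> 1" "t \<noteq> q"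
      using that gap q_notin by auto
    have "q ^ n * t \<in> X"
      using X_inv[OF that, of "int n"] by simp
    then show "q ^ n * t \<noteq> q" "q ^ n * t \<noteq> 1"
      using gap q_notin by auto
  qed
  have phi_sq: "sqrt (\<phi> t) * sqrt (\<phi> t) = \<phi> t" "sqrt (1 - \<phi> t) * sqrt (1 - \<phi> t) = 1 - \<phi> t" if "q < t" "t < 1" for t
    using phi(2) that by simp_all
  \<comment> \<open>The supports are disjoint: \<open>F\<close> lives below \<open>?b\<close>, and
    the dilate of \<open>D\<close> lives between \<open>?b\<close> and q^(-n).\<close>
  have FE: "F t * D (q ^ n * t) = 0" for t
    using less_1[of t] unfolding F_def A_def D_def cut_fun_def by (auto simp: b_iff)
  have FF: "F t * F t + D t * D t = chi q ?b t" if "t \<in> X" for t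
    using less_1[of t] ne[OF that] phi_sq[of t] q_less_1 unfolding F_def A_def D_def cut_fun_def
    by (auto simp: b_iff)
  \<comment> \<open>The closed intervals in \<open>pr_f\<close> and the open ones here differ only
    at endpoints, which lie outside \<open>X\<close>. For \<open>n\<close> = 1 the middle interval
    is empty.\<close>
  have f: "F t * F t + D (q ^ n * t) * D (q ^ n * t) = pr_f q \<phi> n t" if "t \<in> X" for t
    using less_1[of t] ne[OF that] phi_sq[of t] phi_sq[of "q ^ n * t"] q_less_1
    unfolding F_def A_def D_def cut_fun_def pr_f_def by (auto simp: b_iff c_iff)
  have h: "F t * D t = pr_h q \<phi> t" if "t \<in> X" for t
    using ne[OF that] unfolding F_def A_def D_def cut_fun_def pr_h_def by (auto simp: real_sqrt_mult)
  have FD: "cont_at_infty X 0 (\<lambda>t. F t * D t)"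
    using cont_at_infty_mult[OF F D] by simp
  have sw: "star w = elt 0 0 F + elt (- int n) 0 D"
    using elt_star[OF F, of 0] elt_star[OF E, of "int n"]
    by (simp add: w_def star_add pi)
  have *: "elt (int n) 0 (\<lambda>t. D (q ^ n * t)) * elt l 0 G = elt (int n + l) 0 (\<lambda>t. D (q ^ n * t) * G (q ^ n * t))"
    if "cont_at_infty X 0 G" for G l
    using elt_mult[OF E that, of "int n" l] by simp
  \<comment> \<open>The cross terms of \<open>star w * w\<close> vanish by \<open>FE\<close>; the
    second is the adjoint of the first.\<close>
  have "elt 0 0 F * elt (int n) 0 (\<lambda>t. D (q ^ n * t)) = 0"
    by (simp add: elt_mult[OF F E] FE elt_zero)
  moreover have "elt (- int n) 0 D * elt 0 0 F = 0"
    using arg_cong[OF calculation, of star] elt_star[OF F, of 0] elt_star[OF E, of "int n"]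
    by (simp add: star_mult pi)
  moreover have "elt (- int n) 0 D * elt (int n) 0 (\<lambda>t. D (q ^ n * t)) = elt 0 0 (\<lambda>t. D t * D t)"
    using elt_mult[OF D E, of "- int n" "int n"] by (simp add: pi)
  moreover have "elt 0 0 F * elt 0 0 F + elt 0 0 (\<lambda>t. D t * D t) = elt 0 0 (chi q ?b)"
    using elt_add[OF cont_at_infty_mult[OF F F] cont_at_infty_mult[OF D D]] elt_cong[OF FF]
    by (simp add: elt_mult[OF F F])
  ultimately have sww: "star w * w = elt 0 0 (chi q ?b)"
    unfolding sw unfolding w_def by (simp add: distrib_left distrib_right)
  \<comment> \<open>In this order the cross terms survive and become the two terms of the projection
    that contain h.\<close>
  have "w * star w = elt 0 0 (\<lambda>t. F t * F t) + elt (- int n) 0 (\<lambda>t. F t * D t) +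
      elt (int n) 0 (\<lambda>t. D (q ^ n * t) * F (q ^ n * t)) + elt 0 0 (\<lambda>t. D (q ^ n * t) * D (q ^ n * t))"
    unfolding sw unfolding w_def
    by (simp add: distrib_left distrib_right elt_mult[OF F F] elt_mult[OF F D] * F D)
  moreover have "elt 0 0 (\<lambda>t. F t * F t) + elt 0 0 (\<lambda>t. D (q ^ n * t) * D (q ^ n * t)) = elt 0 0 (pr_f q \<phi> n)"
    using elt_add[OF cont_at_infty_mult[OF F F] cont_at_infty_mult[OF E E]] elt_cong[OF f] by simp
  moreover have hh: "elt 0 0 (pr_h q \<phi>) = elt 0 0 (\<lambda>t. F t * D t)"
    by (rule elt_cong) (rule h[symmetric])
  have "U_elt X \<iota> ^ n * elt 0 0 (pr_h q \<phi>) = elt (int n) 0 (\<lambda>t. D (q ^ n * t) * F (q ^ n * t))"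
    unfolding hh elt_mult_U(3)[OF FD] by (simp add: mult.commute)
  moreover have "elt 0 0 (pr_h q \<phi>) * star (U_elt X \<iota>) ^ n = elt (- int n) 0 (\<lambda>t. F t * D t)"
    unfolding hh by (rule elt_mult_U(2)[OF FD])
  ultimately have "w * star w = powers_rieffel q X \<iota> \<phi> n"
    unfolding powers_rieffel_def Let_def fn_elt_eq by (simp add: algebra_simps)
  moreover have "w \<in> unitized_alg X \<iota>"
    unfolding w_def
    by (intro unitized.add elt_unitized F E) (use q_pos in \<open>simp_all add: D_def cut_fun_def\<close>)
  ultimately have "cls 0 (chi q ?b) = K0_class (unitized_alg X \<iota>) (mat1 (powers_rieffel q X \<iota> \<phi> n))"
    using unitized.K0_class_partial_isometry(2)[OF _ sww elt0_projection(3)[OF cont_chi[OF q_notin powi_notin] _ chi_idem]]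
    by simp
  then show ?thesis
    using cls_chi_power[of "1 - int n" n] by simp
qed

section \<open>Complementary projections and the final identities\<close>

lemma (in gapped_dilation_product) K0_class_one_minus_chi:
  assumes "a \<notin> X" "b \<notin> X"
  defines "p \<equiv> 1 - elt 0 0 (chi a b)"
  shows "K0_class (unitized_alg X \<iota>) (mat1 p) \<in> carrier K"
    and "K0_class (unitized_alg X \<iota>) (mat1 1) = K0_class (unitized_alg X \<iota>) (mat1 p) \<otimes>\<^bsub>K\<^esub> cls 0 (chi a b)"
proof -
  \<comment> \<open>Written as a sum and a product, so that the rules for
    \<open>cont_at_infty\<close> give the value 1 at infinity.\<close>
  let ?F = "\<lambda>t. 1 + (- 1) * chi a b t"
  note chi = cont_chi[OF assms(1,2)]
  have F: "cont_at_infty X 1 ?F"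
    using cont_at_infty_add[OF cont_at_infty_const[of X 1] cont_at_infty_mult[OF cont_at_infty_const[of X "- 1"] chi]]
    by simp
  have idem: "?F t * ?F t = ?F t" "?F t * chi a b t = 0" for t
    by (simp_all add: cut_fun_def)
  have "elt 0 1 ?F + elt 0 0 (chi a b) = 1"
    unfolding elt_add[OF F chi] by (simp add: elt_one)
  then have p: "p = elt 0 1 ?F"
    by (simp only: p_def eq_diff_eq[symmetric])
  show "K0_class (unitized_alg X \<iota>) (mat1 p) \<in> carrier K"
    unfolding p by (rule cls_carrier(2)[OF F _ idem(1)]) simp
  have "cls 1 (\<lambda>_. 1) = cls 1 ?F \<otimes>\<^bsub>K\<^esub> cls 0 (chi a b)"
    by (rule cls_add[OF F _ idem(1) chi _ chi_idem _ idem(2)]) simp_all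
  then show "K0_class (unitized_alg X \<iota>) (mat1 1) = K0_class (unitized_alg X \<iota>) (mat1 p) \<otimes>\<^bsub>K\<^esub> cls 0 (chi a b)"
    by (simp only: elt_one p)
qed

text \<open>Positivity and self-adjointness of the modulus make the spectrum closed and nonnegative;
  q-normality gives its invariance.\<close>

lemma gapped_dilation_product_spectrum:
  assumes "0 < q" "q < 1" "q_normal q z" "modulus_of z absz"
    and X: "X = {t. complex_of_real t \<in> op_spectrum absz}" and "1 \<notin> X"
    and "enveloping_map (Xinf X) (dilation q) \<iota>"
  shows "gapped_dilation_product q X \<iota>"
proof
  have T: "positive_selfadjoint absz"
    using assms(4) by (simp add: modulus_of_def)
  show "closed X"
    unfolding X by (rule positive_selfadjoint_spectrum_closed[OF T])
  show "X \<subseteq> {0..}"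
    unfolding X using positive_selfadjoint_spectrum_nonneg[OF T] by auto
  show "q powi k * t \<in> X" if "t \<in> X" for t k
    using that q_normal_spectrum_powi[OF assms(1,3,4)] unfolding X by simp
qed (use assms in auto)

theorem corollary13:
  fixes q :: real and z absz :: "'h::complex_hilbert operator" and X :: "real set"
    and \<iota> :: "real option laurent \<Rightarrow> 'a::cstar_algebra_1"
    and \<phi> :: "real \<Rightarrow> real" and n :: nat
  assumes "0 < q" and "q < 1"
    and "q_normal q z" and "nonzero_op z"
    and "modulus_of z absz"
    and "X = {t. complex_of_real t \<in> op_spectrum absz}"
    and "X \<noteq> {0..}" and "1 \<notin> X"
    and "enveloping_map (Xinf X) (dilation q) \<iota>"
    and "continuous_on {q..1} \<phi>" and "\<forall>t\<in>{q..1}. 0 \<le> \<phi> t \<and> \<phi> t \<le> 1"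
    and "\<phi> q = 0" and "\<phi> 1 = 1"
    and "1 \<le> n"
  defines "B \<equiv> unitized_alg X \<iota>"
    and "K \<equiv> K0_group (unitized_alg X \<iota>)"
    and "R \<equiv> powers_rieffel q X \<iota> \<phi> n"
  shows
    "K0_class B (bott_pos q X \<iota> n) = K0_class B (mat1 1) \<otimes>\<^bsub>K\<^esub> K0_class B (mat1 R)
     \<and> K0_class B (mat1 1) \<otimes>\<^bsub>K\<^esub> K0_class B (mat1 R)
       = K0_class B (mat1 1) \<otimes>\<^bsub>K\<^esub> (K0_class B (mat1 (chi_elt X \<iota> q 1)) [^]\<^bsub>K\<^esub> n)
     \<and> K0_class B (mat1 1) \<otimes>\<^bsub>K\<^esub> (K0_class B (mat1 (chi_elt X \<iota> q 1)) [^]\<^bsub>K\<^esub> n)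
       = K0_class B (mat_of_rows_list 2 [[1, 0], [0, chi_elt X \<iota> (q ^ n) 1]])
     \<and> K0_class B (bott_neg q X \<iota> n) = K0_class B (mat1 1) \<otimes>\<^bsub>K\<^esub> inv\<^bsub>K\<^esub> K0_class B (mat1 R)
     \<and> K0_class B (mat1 1) \<otimes>\<^bsub>K\<^esub> inv\<^bsub>K\<^esub> K0_class B (mat1 R)
       = K0_class B (mat1 1) \<otimes>\<^bsub>K\<^esub> inv\<^bsub>K\<^esub> (K0_class B (mat1 (chi_elt X \<iota> q 1)) [^]\<^bsub>K\<^esub> n)
     \<and> K0_class B (mat1 1) \<otimes>\<^bsub>K\<^esub> inv\<^bsub>K\<^esub> (K0_class B (mat1 (chi_elt X \<iota> q 1)) [^]\<^bsub>K\<^esub> n)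
       = K0_class B (mat1 (1 - chi_elt X \<iota> (q ^ n) 1))"
proof -
  interpret gapped_dilation_product q X \<iota>
    by (rule gapped_dilation_product_spectrum) fact+
  have B: "unitized_alg X \<iota> = B"
    by (simp only: B_def)
  have K: "K0_group B = K"
    by (simp only: K_def B_def)
  note G = K0.is_group[unfolded B K]
  let ?g = "K0_class B (mat1 (chi_elt X \<iota> q 1)) [^]\<^bsub>K\<^esub> n"
  have R: "K0_class B (mat1 R) = ?g"
    using K0_class_powers_rieffel[unfolded B K, of \<phi> n] assms(10,11,14)
    by (simp only: chi_elt_eq R_def)
  \<comment> \<open>The interval from q^n to q^0 consists of \<open>n\<close> pieces.\<close>
  have chi: "K0_class B (mat1 (chi_elt X \<iota> (q ^ n) 1)) = ?g"
    using cls_chi_power[of 0 n, unfolded B K] by (simp add: chi_elt_eq)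
  have qn: "q ^ n \<notin> X"
    using powi_notin[of "int n"] by simp
  have chi_projection: "mat1 (chi_elt X \<iota> (q ^ n) 1) \<in> mat_projections B"
    unfolding chi_elt_eq B[symmetric] by (rule cls_carrier(1)[OF cont_chi[OF qn gap] _ chi_idem]) simp
  have one_projection: "mat1 1 \<in> mat_projections B"
    unfolding B[symmetric] by (rule unitized.mat1_projection[OF unitized.one]) simp_all
  have g: "?g \<in> carrier K"
    using unitized.K0_class_carrier[unfolded B K, OF chi_projection] chi by simp
  have diag: "K0_class B (mat_of_rows_list 2 [[1, 0], [0, chi_elt X \<iota> (q ^ n) 1]]) = K0_class B (mat1 1) \<otimes>\<^bsub>K\<^esub> ?g"
    using unitized.K0_class_diagonal[unfolded B K, OF one_projection chi_projection] chi by simp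
  \<comment> \<open>This includes [1] = [1 - chi] + n [chi of (q, 1)], which is solved for the
    complement below.\<close>
  note compl = K0_class_one_minus_chi[OF qn gap, folded chi_elt_eq, unfolded B K chi]
  have "K0_class B (mat1 1) \<otimes>\<^bsub>K\<^esub> inv\<^bsub>K\<^esub> ?g = K0_class B (mat1 (1 - chi_elt X \<iota> (q ^ n) 1))"
    unfolding compl(2) using g compl(1) by (simp add: group.inv_solve_right[OF G] group.inv_solve_right'[OF G] monoid.m_closed[OF group.is_monoid[OF G]])
  then show ?thesis
    using K0_class_bott[OF assms(14), unfolded B K, folded chi_elt_eq] R diag by simp
qed

end
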